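(* Let $H$ be a finite dimensional Hopf algebra over a field $k$, let $G=\mathrm{Aut}_{Hopf}(H)\times \mathrm{Aut}_{Hopf}(H)$ with multiplication $(\alpha,\beta)*(\gamma,\delta)=(\delta\alpha\delta^{-1}\gamma,\delta\beta)$, and let $CT(H)=\{H^{*op}\bowtie H(\alpha,\beta)\}_{(\alpha,\beta)\in G}$ be the crossed Turaev $G$-algebra described in the context. Then $CT(H)$ is coquasitriangular with structure $$\sigma_{(\alpha,\beta),(\gamma,\delta)}(p\bowtie h,\ q\bowtie h')=p(\delta^{-1}(h'))\,q(1)\,\varepsilon(h)$$ for $p\bowtie h\in CT(H)_{(\alpha,\beta)}$, $q\bowtie h'\in CT(H)_{(\gamma,\delta)}$.
   Context: $\mathrm{Aut}_{Hopf}(H)$ is the group of Hopf algebra automorphisms of $H$ under composition. In $G$ the unit is $(id,id)$ and $(\alpha,\beta)^{-1}=(\beta^{-1}\alpha^{-1}\beta,\beta^{-1})$. The antipode $S$ of $H$ is bijective since $H$ is finite dimensional. On $H^*$ juxtaposition denotes the convolution product $(pq)(h)=p(h_1)q(h_2)$ (with unit $\varepsilon$), $p\mapsto p_1\otimes p_2$ is determined by $p(hh')=p_1(h)p_2(h')$, and $S^{-1*}(p)=p\circ S^{-1}$. $H^{*op}$ is $H^*$ with opposite multiplication; all products of elements of $H^*$ written in formulas are convolution products. $\{h_i\},\{h^i\}$ are dual bases of $H$ and $H^*$. The crossed Turaev $G$-algebra $CT(H)$: the component $CT(H)_{(\alpha,\beta)}=H^{*op}\bowtie H(\alpha,\beta)$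 is the vector space $H^*\otimes H$ (elements $p\bowtie h$) with coalgebra structure $$\bar\Delta(p\bowtie h)=\sum_{i,j}\bigl(p_1\bowtie\beta(h_j)h_1S^{-1}\alpha(h_i)\bigr)\otimes\bigl(h^ip_2h^j\bowtie h_2\bigr),\qquad\bar\varepsilon(p\bowtie h)=p(1)\varepsilon(h),$$ where $h_1\otimes h_2=\Delta(h)$; the multiplication is, for $p\bowtie h\in CT(H)_{(\alpha,\beta)}$ and $q\bowtie h'\in CT(H)_{(\gamma,\delta)}$, $$(p\bowtie h)(q\bowtie h')=qp\bowtie\delta(h)\,\delta\alpha\delta^{-1}(h')\in CT(H)_{(\alpha,\beta)*(\gamma,\delta)};$$ the unit is $\varepsilon\bowtie1$; the antipode is $$S_{(\alpha,\beta)}(p\bowtie h)=\sum_{i,j}h^iS^{-1*}(p)S^{-1*}(h^j)\bowtie\beta^{-1}(h_j)\,\beta^{-1}\alpha^{-1}S(h)\,\beta^{-1}\alpha^{-1}\beta(h_i);$$ the crossing is $\psi_{(\alpha,\beta)}(p\bowtie h)=p\circ\alpha^{-1}\beta\bowtie\beta^{-1}\delta\alpha\delta^{-1}(h)\in CT(H)_{(\alpha,\beta)*(\gamma,\delta)*(\alpha,\beta)^{-1}}$ for $p\bowtie h\in CT(H)_{(\gamma,\delta)}$. For a group $G$, a crossed Turaev $G$-algebra is a family $A=\{A_a\}_{a\in G}$ of coalgebras with associative unital coalgebra maps $m_{a,b}:A_a\otimes A_b\to A_{ab}$, $\eta:k\to A_1$, an antipode $S_a:A_a\to A_{a^{-1}}$,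 and coalgebra isomorphisms $\psi_b:A_a\to A_{bab^{-1}}$ that are multiplicative in $b$ and compatible with $m,\eta,S$. It is called coquasitriangular if there is a family of convolution invertible linear maps $\sigma_{a,b}:A_a\otimes A_b\to k$ such that for all $x\in A_a$, $y\in A_b$, $z\in A_c$ (Sweedler notation in each $A_a$): (TCT1) $\sigma_{ab,c}(xy,z)=\sigma_{a,c}(x,z_2)\,\sigma_{b,c}(y,z_1)$; (TCT2) $\sigma_{a,bc}(x,yz)=\sigma_{a,b}(x_1,y)\,\sigma_{b^{-1}ab,c}(\psi_{b^{-1}}(x_2),z)$; (TCT3) $\sigma_{a,b}(x_1,y_1)\,y_2\psi_{b^{-1}}(x_2)=x_1y_1\,\sigma_{a,b}(x_2,y_2)$; (TCT4) $\sigma_{a,b}(x,y)=\sigma_{cac^{-1},cbc^{-1}}(\psi_c(x),\psi_c(y))$ for all $c\in G$. *)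

theory Defs
  imports Complex_Main "HOL-Algebra.Group" "HOL-Library.Function_Algebras"
begin

section \<open>Vector spaces and tensor products\<close>

text \<open>
  A vector space is a linear subspace of a type carrying a vector space structure; addition is
  that of the type.  The spaces of functions used below have pointwise addition
  (\<^theory>\<open>HOL-Library.Function_Algebras\<close>) and pointwise scalar multiplication.
\<close>

record ('v, 'k) vspace = "'v partial_object" +
  scal :: "'k \<Rightarrow> 'v \<Rightarrow> 'v"

definition is_vspace :: "('v::ab_group_add, 'k::field) vspace \<Rightarrow> bool"
  where "is_vspace V \<longleftrightarrow> vector_space (scal V) \<and> module.subspace (scal V) (carrier V)"

definition linear_map ::
    "('v::ab_group_add, 'k::field) vspace \<Rightarrow> ('w::ab_group_add, 'k) vspace \<Rightarrow> ('v \<Rightarrow> 'w) \<Rightarrow> bool"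
  where "linear_map V W f \<longleftrightarrow>
    (\<forall>x\<in>carrier V. f x \<in> carrier W) \<and>
    (\<forall>x\<in>carrier V. \<forall>y\<in>carrier V. f (x + y) = f x + f y) \<and>
    (\<forall>c. \<forall>x\<in>carrier V. f (scal V c x) = scal W c (f x))"

definition bilinear_map ::
    "('v::ab_group_add, 'k::field) vspace \<Rightarrow> ('w::ab_group_add, 'k) vspace
      \<Rightarrow> ('x::ab_group_add, 'k) vspace \<Rightarrow> ('v \<Rightarrow> 'w \<Rightarrow> 'x) \<Rightarrow> bool"
  where "bilinear_map V W X B \<longleftrightarrow>
    (\<forall>v\<in>carrier V. linear_map W X (\<lambda>w. B v w)) \<and>
    (\<forall>w\<in>carrier W. linear_map V X (\<lambda>v. B v w))"

definition scalars :: "('k::field, 'k) vspace"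
  where "scalars = \<lparr>carrier = UNIV, scal = (*)\<rparr>"

definition pscale :: "'k::field \<Rightarrow> ('x \<Rightarrow> 'k) \<Rightarrow> 'x \<Rightarrow> 'k"
  where "pscale c f = (\<lambda>x. c * f x)"

text \<open>
  Over a field, \<open>V \<otimes> W\<close> embeds into the dual of the space of bilinear forms on \<open>V \<times> W\<close>, with
  \<open>v \<otimes> w\<close> acting by evaluation at \<open>(v, w)\<close>.  The tensor product is constructed as the linear span of
  these evaluations (no finiteness needed); functionals are set to \<open>0\<close> on functions that are not
  bilinear forms, so that equality of functions is equality in \<open>V \<otimes> W\<close>.  The universal property is
  proved in \<open>tensor_lift_pure\<close> and \<open>tensor_lift_unique\<close> below.
\<close>

type_synonym ('v, 'w, 'k) tensor = "('v \<Rightarrow> 'w \<Rightarrow> 'k) \<Rightarrow> 'k"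

definition pure ::
    "('v::ab_group_add, 'k::field) vspace \<Rightarrow> ('w::ab_group_add, 'k) vspace
      \<Rightarrow> 'v \<Rightarrow> 'w \<Rightarrow> ('v, 'w, 'k) tensor"
  where "pure V W v w = (\<lambda>B. if bilinear_map V W scalars B then B v w else 0)"

definition tensor_space ::
    "('v::ab_group_add, 'k::field) vspace \<Rightarrow> ('w::ab_group_add, 'k) vspace
      \<Rightarrow> (('v, 'w, 'k) tensor, 'k) vspace"
  where "tensor_space V W =
    \<lparr>carrier = module.span pscale {pure V W v w | v w. v \<in> carrier V \<and> w \<in> carrier W},
     scal = pscale\<rparr>"

text \<open>The linear map \<open>V \<otimes> W \<rightarrow> X\<close> induced by a bilinear map \<open>V \<times> W \<rightarrow> X\<close>.\<close>

definition tensor_lift ::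
    "('v::ab_group_add, 'k::field) vspace \<Rightarrow> ('w::ab_group_add, 'k) vspace
      \<Rightarrow> ('x::ab_group_add, 'k) vspace \<Rightarrow> ('v \<Rightarrow> 'w \<Rightarrow> 'x) \<Rightarrow> ('v, 'w, 'k) tensor \<Rightarrow> 'x"
  where "tensor_lift V W X B =
    (SOME L. linear_map (tensor_space V W) X L \<and>
       (\<forall>v\<in>carrier V. \<forall>w\<in>carrier W. L (pure V W v w) = B v w))"

definition dual_space :: "('v::ab_group_add, 'k::field) vspace \<Rightarrow> ('v \<Rightarrow> 'k, 'k) vspace"
  where "dual_space V =
    \<lparr>carrier = {f. linear_map V scalars f \<and> (\<forall>x. x \<notin> carrier V \<longrightarrow> f x = 0)}, scal = pscale\<rparr>"


subsection \<open>The universal property\<close>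

lemma vector_space_pscale: "vector_space (pscale :: 'k::field \<Rightarrow> ('x \<Rightarrow> 'k) \<Rightarrow> 'x \<Rightarrow> 'k)"
  by unfold_locales (auto simp: pscale_def fun_eq_iff algebra_simps)

lemma vector_space_mult: "vector_space ((*) :: 'k::field \<Rightarrow> 'k \<Rightarrow> 'k)"
  by unfold_locales (auto simp: algebra_simps)

lemma functional_separates:
  assumes "vector_space (s :: 'k::field \<Rightarrow> 'x::ab_group_add \<Rightarrow> 'x)" "x \<noteq> 0"
  obtains f where "Vector_Spaces.linear s (*) f" "f x \<noteq> (0::'k)"
proof -
  interpret vector_space_pair s "(*) :: 'k \<Rightarrow> 'k \<Rightarrow> 'k"
    by (rule vector_space_pair.intro[OF assms(1) vector_space_mult])
  have "vs1.independent {x}"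
    using assms(2) by (simp add: vs1.dependent_single)
  then obtain g where "Vector_Spaces.linear s (*) g" "\<forall>y\<in>{x}. g y = (1::'k)"
    using linear_independent_extend[of "{x}" "\<lambda>_. 1"] by blast
  then show ?thesis using that by auto
qed

lemma bilinear_map_comp:
  assumes "bilinear_map V W X B" "Vector_Spaces.linear (scal X) (*) f"
  shows "bilinear_map V W scalars (\<lambda>v w. f (B v w))"
proof -
  interpret Vector_Spaces.linear "scal X" "(*)" f by fact
  show ?thesis
    using assms(1) unfolding bilinear_map_def linear_map_def
    by (auto simp: scalars_def add scale)
qed

lemma tensor_lift_exists:
  fixes V :: "('v::ab_group_add, 'k::field) vspace" and W :: "('w::ab_group_add, 'k) vspace"
    and X :: "('x::ab_group_add, 'k) vspace"
  assumes X: "is_vspace X" and B: "bilinear_map V W X B"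
  shows "\<exists>L. linear_map (tensor_space V W) X L \<and>
       (\<forall>v\<in>carrier V. \<forall>w\<in>carrier W. L (pure V W v w) = B v w)"
proof -
  let ?P = "{pure V W v w | v w. v \<in> carrier V \<and> w \<in> carrier W}"
  have X': "vector_space (scal X)" "module.subspace (scal X) (carrier X)"
    using X by (auto simp: is_vspace_def)
  interpret vector_space_pair "pscale :: 'k \<Rightarrow> (('v \<Rightarrow> 'w \<Rightarrow> 'k) \<Rightarrow> 'k) \<Rightarrow> _" "scal X"
    by (rule vector_space_pair.intro[OF vector_space_pscale X'(1)])
  obtain C where C: "C \<subseteq> ?P" "vs1.independent C" "?P \<subseteq> vs1.span C"
    by (rule vs1.maximal_independent_subset)
  define rep where
    "rep t = (SOME vw. fst vw \<in> carrier V \<and> snd vw \<in> carrier W \<and> t = pure V W (fst vw) (snd vw))"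
    for t :: "('v, 'w, 'k) tensor"
  have rep: "fst (rep t) \<in> carrier V" "snd (rep t) \<in> carrier W"
      "pure V W (fst (rep t)) (snd (rep t)) = t" if t: "t \<in> ?P" for t
  proof -
    have "\<exists>vw. fst vw \<in> carrier V \<and> snd vw \<in> carrier W \<and> t = pure V W (fst vw) (snd vw)"
      using t by auto
    from someI_ex[OF this] show "fst (rep t) \<in> carrier V" "snd (rep t) \<in> carrier W"
      "pure V W (fst (rep t)) (snd (rep t)) = t" unfolding rep_def by auto
  qed
  obtain L where L: "Vector_Spaces.linear pscale (scal X) L"
      "\<forall>t\<in>C. L t = B (fst (rep t)) (snd (rep t))"
    using linear_independent_extend[OF C(2), of "\<lambda>t. B (fst (rep t)) (snd (rep t))"] by blast
  interpret L: Vector_Spaces.linear pscale "scal X" L by fact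
  have eval: "f (L t) = t (\<lambda>v w. f (B v w))"
    if f: "Vector_Spaces.linear (scal X) (*) f" and t: "t \<in> vs1.span C" for f t
  proof -
    interpret f: Vector_Spaces.linear "scal X" "(*)" f by fact
    note bf = bilinear_map_comp[OF B f]
    from t show ?thesis
    proof (induction rule: vs1.span_induct_alt)
      case base
      show ?case unfolding L.zero f.zero by simp
    next
      case (step c x y)
      have "x \<in> ?P" using C(1) step(1) by (rule subsetD)
      have e: "pure V W v w (\<lambda>v w. f (B v w)) = f (B v w)" for v w
        by (simp only: pure_def bf if_True)
      have x: "x (\<lambda>v w. f (B v w)) = f (B (fst (rep x)) (snd (rep x)))"
        using e[of "fst (rep x)" "snd (rep x)"] unfolding rep(3)[OF \<open>x \<in> ?P\<close>] .
      have Lx: "L x = B (fst (rep x)) (snd (rep x))" using L(2) step(1) by (rule bspec)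
      have "f (L (pscale c x + y)) = c * f (L x) + f (L y)"
        by (simp only: L.add L.scale f.add f.scale)
      also have "\<dots> = (pscale c x + y) (\<lambda>v w. f (B v w))"
        unfolding step(2) Lx x[symmetric] by (simp add: pscale_def)
      finally show ?case .
    qed
  qed
  have pure: "L (pure V W v w) = B v w" if vw: "v \<in> carrier V" "w \<in> carrier W" for v w
  proof (rule ccontr)
    assume "L (pure V W v w) \<noteq> B v w"
    then obtain f where f: "Vector_Spaces.linear (scal X) (*) f" "f (L (pure V W v w) - B v w) \<noteq> 0"
      using functional_separates[OF X'(1), of "L (pure V W v w) - B v w"] by auto
    interpret f: Vector_Spaces.linear "scal X" "(*)" f by fact
    have "pure V W v w \<in> vs1.span C" using C(3) vw by blast
    from eval[OF f(1) this] have "f (L (pure V W v w)) = f (B v w)"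
      using bilinear_map_comp[OF B f(1)] by (simp add: pure_def)
    with f(2) show False by (simp add: f.diff)
  qed
  have mem: "L t \<in> carrier X" if "t \<in> vs1.span ?P" for t
    using that
  proof (induction rule: vs1.span_induct_alt)
    case base
    show ?case unfolding L.zero by (rule vs2.subspace_0[OF X'(2)])
  next
    case (step c x y)
    then obtain v w where vw: "x = pure V W v w" "v \<in> carrier V" "w \<in> carrier W" by blast
    have "B v w \<in> carrier X"
      using B vw(2,3) unfolding bilinear_map_def linear_map_def by blast
    moreover have "L (pscale c x + y) = scal X c (B v w) + L y"
      by (simp only: L.add L.scale vw(1) pure[OF vw(2,3)])
    ultimately show ?case
      using step(2) by (simp only: vs2.subspace_add[OF X'(2)] vs2.subspace_scale[OF X'(2)])
  qed
  have "linear_map (tensor_space V W) X L"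
    unfolding linear_map_def using mem by (simp add: tensor_space_def L.add L.scale)
  with pure show ?thesis by blast
qed

lemma tensor_lift_linear:
  assumes "is_vspace X" "bilinear_map V W X B"
  shows "linear_map (tensor_space V W) X (tensor_lift V W X B)"
  using someI_ex[OF tensor_lift_exists[OF assms]] unfolding tensor_lift_def by blast

lemma tensor_lift_pure:
  assumes "is_vspace X" "bilinear_map V W X B" "v \<in> carrier V" "w \<in> carrier W"
  shows "tensor_lift V W X B (pure V W v w) = B v w"
  using someI_ex[OF tensor_lift_exists[OF assms(1,2)]] assms(3,4) unfolding tensor_lift_def by blast

lemma tensor_lift_unique:
  fixes V :: "('v::ab_group_add, 'k::field) vspace" and W :: "('w::ab_group_add, 'k) vspace"
    and X :: "('x::ab_group_add, 'k) vspace"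
  assumes X: "is_vspace X" and B: "bilinear_map V W X B"
    and L: "linear_map (tensor_space V W) X L"
    and eq: "\<And>v w. v \<in> carrier V \<Longrightarrow> w \<in> carrier W \<Longrightarrow> L (pure V W v w) = B v w"
    and t: "t \<in> carrier (tensor_space V W)"
  shows "L t = tensor_lift V W X B t"
proof -
  let ?P = "{pure V W v w | v w. v \<in> carrier V \<and> w \<in> carrier W}"
  let ?M = "tensor_lift V W X B"
  interpret T: vector_space "pscale :: 'k \<Rightarrow> (('v \<Rightarrow> 'w \<Rightarrow> 'k) \<Rightarrow> 'k) \<Rightarrow> _"
    by (rule vector_space_pscale)
  have M: "linear_map (tensor_space V W) X ?M" by (rule tensor_lift_linear[OF X B])
  have add: "F (x + y) = F x + F y" "F (pscale c x) = scal X c (F x)"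
    if "linear_map (tensor_space V W) X F" "x \<in> T.span ?P" "y \<in> T.span ?P" for F c x y
    using that unfolding linear_map_def by (auto simp: tensor_space_def)
  have "t \<in> T.span ?P" using t by (simp add: tensor_space_def)
  then have "t \<in> T.span ?P \<and> L t = ?M t"
  proof (induction rule: T.span_induct_alt)
    case base
    have zero: "F 0 = 0" if "linear_map (tensor_space V W) X F" for F
      using add(1)[OF that T.span_zero T.span_zero] by simp
    show ?case unfolding zero[OF L] zero[OF M] using T.span_zero by blast
  next
    case (step c x y)
    then have x: "x \<in> T.span ?P" by (blast intro: T.span_base)
    have Lx: "L x = ?M x" using step(1) eq tensor_lift_pure[OF X B] by auto
    have y: "y \<in> T.span ?P" "L y = ?M y" using step(2) by blast+
    have F: "F (pscale c x + y) = scal X c (F x) + F y"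
      if "linear_map (tensor_space V W) X F" for F
      unfolding add(1)[OF that T.span_scale[OF x] y(1)] add(2)[OF that x x] ..
    have "L (pscale c x + y) = ?M (pscale c x + y)"
      unfolding F[OF L] F[OF M] Lx y(2) ..
    with T.span_add[OF T.span_scale[OF x] y(1)] show ?case by (rule conjI)
  qed
  then show ?thesis ..
qed


section \<open>Coalgebras and Hopf algebras\<close>

text \<open>Coassociativity is stated with both sides in \<open>(V \<otimes> V) \<otimes> V\<close>.\<close>

definition coalgebra ::
    "('v::ab_group_add, 'k::field) vspace \<Rightarrow> ('v \<Rightarrow> ('v, 'v, 'k) tensor) \<Rightarrow> ('v \<Rightarrow> 'k) \<Rightarrow> bool"
  where "coalgebra V \<Delta> \<epsilon> \<longleftrightarrow>
    is_vspace V \<and>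
    linear_map V (tensor_space V V) \<Delta> \<and>
    linear_map V scalars \<epsilon> \<and>
    (let VV = tensor_space V V; VVV = tensor_space VV V in
      \<forall>x\<in>carrier V.
        tensor_lift V V VVV
          (\<lambda>x1 x2. tensor_lift V V VVV (\<lambda>u v. pure VV V (pure V V u v) x2) (\<Delta> x1)) (\<Delta> x) =
        tensor_lift V V VVV
          (\<lambda>x1 x2. tensor_lift V V VVV (\<lambda>u v. pure VV V (pure V V x1 u) v) (\<Delta> x2)) (\<Delta> x)) \<and>
    (\<forall>x\<in>carrier V.
      tensor_lift V V V (\<lambda>x1 x2. scal V (\<epsilon> x1) x2) (\<Delta> x) = x \<and>
      tensor_lift V V V (\<lambda>x1 x2. scal V (\<epsilon> x2) x1) (\<Delta> x) = x)"

locale hopf_algebra =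
  vector_space scale
  for scale :: "'k::field \<Rightarrow> 'h::ring_1 \<Rightarrow> 'h" +
  fixes \<Delta> :: "'h \<Rightarrow> ('h, 'h, 'k) tensor"
    and \<epsilon> :: "'h \<Rightarrow> 'k"
    and S :: "'h \<Rightarrow> 'h"
  assumes scale_mult_left: "scale c (x * y) = scale c x * y"
    and scale_mult_right: "scale c (x * y) = x * scale c y"
    and coalgebra: "coalgebra \<lparr>carrier = UNIV, scal = scale\<rparr> \<Delta> \<epsilon>"
    and comult_mult:
      "(let H = \<lparr>carrier = UNIV, scal = scale\<rparr>; HH = tensor_space H H in
        \<Delta> (x * y) =
          tensor_lift H H HH
            (\<lambda>x1 x2. tensor_lift H H HH (\<lambda>y1 y2. pure H H (x1 * y1) (x2 * y2)) (\<Delta> y)) (\<Delta> x))"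
    and comult_one:
      "(let H = \<lparr>carrier = UNIV, scal = scale\<rparr> in \<Delta> 1 = pure H H 1 1)"
    and counit_mult: "\<epsilon> (x * y) = \<epsilon> x * \<epsilon> y"
    and counit_one: "\<epsilon> 1 = 1"
    and antipode_linear: "Vector_Spaces.linear scale scale S"
    and antipode_left:
      "(let H = \<lparr>carrier = UNIV, scal = scale\<rparr> in
        tensor_lift H H H (\<lambda>x1 x2. S x1 * x2) (\<Delta> x) = scale (\<epsilon> x) 1)"
    and antipode_right:
      "(let H = \<lparr>carrier = UNIV, scal = scale\<rparr> in
        tensor_lift H H H (\<lambda>x1 x2. x1 * S x2) (\<Delta> x) = scale (\<epsilon> x) 1)"
begin

definition H :: "('h, 'k) vspace"
  where "H = \<lparr>carrier = UNIV, scal = scale\<rparr>"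

definition Aut_Hopf :: "('h \<Rightarrow> 'h) set"
  where "Aut_Hopf = {f. bij f \<and> Vector_Spaces.linear scale scale f \<and>
    (\<forall>x y. f (x * y) = f x * f y) \<and> f 1 = 1 \<and>
    (\<forall>x. \<Delta> (f x) = tensor_lift H H (tensor_space H H) (\<lambda>x1 x2. pure H H (f x1) (f x2)) (\<Delta> x)) \<and>
    (\<forall>x. \<epsilon> (f x) = \<epsilon> x) \<and>
    (\<forall>x. f (S x) = S (f x))}"

text \<open>Inverses of functions are written \<open>inv_into UNIV\<close>, as \<open>inv\<close> is the inverse in a group.\<close>

definition G :: "(('h \<Rightarrow> 'h) \<times> ('h \<Rightarrow> 'h)) monoid"
  where "G = \<lparr>carrier = Aut_Hopf \<times> Aut_Hopf,
    mult = (\<lambda>(\<alpha>, \<beta>) (\<gamma>, \<delta>). (\<delta> \<circ> \<alpha> \<circ> inv_into UNIV \<delta> \<circ> \<gamma>, \<delta> \<circ> \<beta>)),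
    one = (id, id)\<rparr>"

definition convol :: "('h \<Rightarrow> 'k) \<Rightarrow> ('h \<Rightarrow> 'k) \<Rightarrow> 'h \<Rightarrow> 'k"
  where "convol p q = (\<lambda>x. tensor_lift H H scalars (\<lambda>x1 x2. p x1 * q x2) (\<Delta> x))"

definition dual_comult :: "('h \<Rightarrow> 'k) \<Rightarrow> ('h \<Rightarrow> 'k, 'h \<Rightarrow> 'k, 'k) tensor"
  where "dual_comult p =
    (THE t. t \<in> carrier (tensor_space (dual_space H) (dual_space H)) \<and>
      (\<forall>x y. tensor_lift (dual_space H) (dual_space H) scalars (\<lambda>p1 p2. p1 x * p2 y) t = p (x * y)))"

end


section \<open>Crossed Turaev group algebras\<close>

text \<open>
  \<open>tmult A a b\<close> is \<open>A\<^sub>a \<otimes> A\<^sub>b \<rightarrow> A\<^sub>a\<^sub>b\<close>, given as a bilinear map;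
  \<open>antip A a\<close> is \<open>A\<^sub>a \<rightarrow> A\<^sub>c\<close> for \<open>c = a\<inverse>\<close>; and \<open>cross A b a\<close> is the restriction of
  \<open>\<psi>\<^sub>b\<close> to \<open>A\<^sub>a\<close>, with values in \<open>A\<^sub>c\<close> for \<open>c = b a b\<inverse>\<close>.
\<close>

record ('g, 'v, 'k) turaev =
  comp :: "'g \<Rightarrow> ('v, 'k) vspace"
  cop :: "'g \<Rightarrow> 'v \<Rightarrow> ('v, 'v, 'k) tensor"
  cou :: "'g \<Rightarrow> 'v \<Rightarrow> 'k"
  tmult :: "'g \<Rightarrow> 'g \<Rightarrow> 'v \<Rightarrow> 'v \<Rightarrow> 'v"
  tunit :: 'v
  antip :: "'g \<Rightarrow> 'v \<Rightarrow> 'v"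
  cross :: "'g \<Rightarrow> 'g \<Rightarrow> 'v \<Rightarrow> 'v"

text \<open>\<open>sweedler A a X B x\<close> is \<open>B(x\<^sub>1, x\<^sub>2) \<in> X\<close>, for \<open>B\<close> bilinear and \<open>x \<in> A\<^sub>a\<close>.\<close>

definition sweedler ::
    "('g, 'v::ab_group_add, 'k::field) turaev \<Rightarrow> 'g \<Rightarrow> ('x::ab_group_add, 'k) vspace
      \<Rightarrow> ('v \<Rightarrow> 'v \<Rightarrow> 'x) \<Rightarrow> 'v \<Rightarrow> 'x"
  where "sweedler A a X B x = tensor_lift (comp A a) (comp A a) X B (cop A a x)"

locale crossed_turaev = group G
  for G :: "'g monoid" (structure)
    and A :: "('g, 'v::ab_group_add, 'k::field) turaev" +
  assumes comp_coalgebra: "a \<in> carrier G \<Longrightarrow> coalgebra (comp A a) (cop A a) (cou A a)"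
    and tmult_bilinear: "\<lbrakk>a \<in> carrier G; b \<in> carrier G\<rbrakk> \<Longrightarrow>
      bilinear_map (comp A a) (comp A b) (comp A (a \<otimes> b)) (tmult A a b)"
    and tmult_cop:
      "\<lbrakk>a \<in> carrier G; b \<in> carrier G; x \<in> carrier (comp A a); y \<in> carrier (comp A b)\<rbrakk> \<Longrightarrow>
      (let C = comp A (a \<otimes> b); CC = tensor_space C C in
        cop A (a \<otimes> b) (tmult A a b x y) =
          sweedler A a CC (\<lambda>x1 x2. sweedler A b CC
            (\<lambda>y1 y2. pure C C (tmult A a b x1 y1) (tmult A a b x2 y2)) y) x)"
    and tmult_cou:
      "\<lbrakk>a \<in> carrier G; b \<in> carrier G; x \<in> carrier (comp A a); y \<in> carrier (comp A b)\<rbrakk> \<Longrightarrow>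
      cou A (a \<otimes> b) (tmult A a b x y) = cou A a x * cou A b y"
    and tmult_assoc:
      "\<lbrakk>a \<in> carrier G; b \<in> carrier G; c \<in> carrier G;
        x \<in> carrier (comp A a); y \<in> carrier (comp A b); z \<in> carrier (comp A c)\<rbrakk> \<Longrightarrow>
      tmult A (a \<otimes> b) c (tmult A a b x y) z = tmult A a (b \<otimes> c) x (tmult A b c y z)"
    and tunit_closed: "tunit A \<in> carrier (comp A \<one>)"
    and tunit_cop: "cop A \<one> (tunit A) = pure (comp A \<one>) (comp A \<one>) (tunit A) (tunit A)"
    and tunit_cou: "cou A \<one> (tunit A) = 1"
    and tunit_left: "\<lbrakk>a \<in> carrier G; x \<in> carrier (comp A a)\<rbrakk> \<Longrightarrow> tmult A \<one> a (tunit A) x = x"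
    and tunit_right: "\<lbrakk>a \<in> carrier G; x \<in> carrier (comp A a)\<rbrakk> \<Longrightarrow> tmult A a \<one> x (tunit A) = x"
    and antip_linear: "a \<in> carrier G \<Longrightarrow> linear_map (comp A a) (comp A (inv a)) (antip A a)"
    and antip_left: "\<lbrakk>a \<in> carrier G; x \<in> carrier (comp A a)\<rbrakk> \<Longrightarrow>
      sweedler A a (comp A \<one>) (\<lambda>x1 x2. tmult A (inv a) a (antip A a x1) x2) x =
        scal (comp A \<one>) (cou A a x) (tunit A)"
    and antip_right: "\<lbrakk>a \<in> carrier G; x \<in> carrier (comp A a)\<rbrakk> \<Longrightarrow>
      sweedler A a (comp A \<one>) (\<lambda>x1 x2. tmult A a (inv a) x1 (antip A a x2)) x =
        scal (comp A \<one>) (cou A a x) (tunit A)"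
    and cross_linear: "\<lbrakk>a \<in> carrier G; b \<in> carrier G\<rbrakk> \<Longrightarrow>
      linear_map (comp A a) (comp A (b \<otimes> a \<otimes> inv b)) (cross A b a)"
    and cross_bij: "\<lbrakk>a \<in> carrier G; b \<in> carrier G\<rbrakk> \<Longrightarrow>
      bij_betw (cross A b a) (carrier (comp A a)) (carrier (comp A (b \<otimes> a \<otimes> inv b)))"
    and cross_cop: "\<lbrakk>a \<in> carrier G; b \<in> carrier G; x \<in> carrier (comp A a)\<rbrakk> \<Longrightarrow>
      (let C = comp A (b \<otimes> a \<otimes> inv b) in
        cop A (b \<otimes> a \<otimes> inv b) (cross A b a x) =
          sweedler A a (tensor_space C C) (\<lambda>x1 x2. pure C C (cross A b a x1) (cross A b a x2)) x)"
    and cross_cou: "\<lbrakk>a \<in> carrier G; b \<in> carrier G; x \<in> carrier (comp A a)\<rbrakk> \<Longrightarrow>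
      cou A (b \<otimes> a \<otimes> inv b) (cross A b a x) = cou A a x"
    and cross_cross:
      "\<lbrakk>a \<in> carrier G; b \<in> carrier G; c \<in> carrier G; x \<in> carrier (comp A a)\<rbrakk> \<Longrightarrow>
      cross A (b \<otimes> c) a x = cross A b (c \<otimes> a \<otimes> inv c) (cross A c a x)"
    and cross_tmult:
      "\<lbrakk>a \<in> carrier G; b \<in> carrier G; c \<in> carrier G;
        x \<in> carrier (comp A a); y \<in> carrier (comp A b)\<rbrakk> \<Longrightarrow>
      cross A c (a \<otimes> b) (tmult A a b x y) =
        tmult A (c \<otimes> a \<otimes> inv c) (c \<otimes> b \<otimes> inv c) (cross A c a x) (cross A c b y)"
    and cross_tunit: "c \<in> carrier G \<Longrightarrow> cross A c \<one> (tunit A) = tunit A"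
    and cross_antip: "\<lbrakk>a \<in> carrier G; c \<in> carrier G; x \<in> carrier (comp A a)\<rbrakk> \<Longrightarrow>
      cross A c (inv a) (antip A a x) = antip A (c \<otimes> a \<otimes> inv c) (cross A c a x)"

text \<open>
  The linear maps \<open>\<sigma>\<^sub>a\<^sub>,\<^sub>b : A\<^sub>a \<otimes> A\<^sub>b \<rightarrow> k\<close> are given as bilinear forms.  Convolution invertibility
  refers to the tensor product coalgebra \<open>A\<^sub>a \<otimes> A\<^sub>b\<close>.
\<close>

locale coquasitriangular = crossed_turaev G A
  for G :: "'g monoid" (structure)
    and A :: "('g, 'v::ab_group_add, 'k::field) turaev" +
  fixes \<sigma> :: "'g \<Rightarrow> 'g \<Rightarrow> 'v \<Rightarrow> 'v \<Rightarrow> 'k"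
  assumes bilinear: "\<lbrakk>a \<in> carrier G; b \<in> carrier G\<rbrakk> \<Longrightarrow>
      bilinear_map (comp A a) (comp A b) scalars (\<sigma> a b)"
    and convolution_invertible: "\<lbrakk>a \<in> carrier G; b \<in> carrier G\<rbrakk> \<Longrightarrow>
      \<exists>\<tau>. bilinear_map (comp A a) (comp A b) scalars \<tau> \<and>
        (\<forall>x\<in>carrier (comp A a). \<forall>y\<in>carrier (comp A b).
          sweedler A a scalars (\<lambda>x1 x2. sweedler A b scalars
            (\<lambda>y1 y2. \<sigma> a b x1 y1 * \<tau> x2 y2) y) x = cou A a x * cou A b y \<and>
          sweedler A a scalars (\<lambda>x1 x2. sweedler A b scalars
            (\<lambda>y1 y2. \<tau> x1 y1 * \<sigma> a b x2 y2) y) x = cou A a x * cou A b y)"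
    and TCT1:
      "\<lbrakk>a \<in> carrier G; b \<in> carrier G; c \<in> carrier G;
        x \<in> carrier (comp A a); y \<in> carrier (comp A b); z \<in> carrier (comp A c)\<rbrakk> \<Longrightarrow>
      \<sigma> (a \<otimes> b) c (tmult A a b x y) z =
        sweedler A c scalars (\<lambda>z1 z2. \<sigma> a c x z2 * \<sigma> b c y z1) z"
    and TCT2:
      "\<lbrakk>a \<in> carrier G; b \<in> carrier G; c \<in> carrier G;
        x \<in> carrier (comp A a); y \<in> carrier (comp A b); z \<in> carrier (comp A c)\<rbrakk> \<Longrightarrow>
      \<sigma> a (b \<otimes> c) x (tmult A b c y z) =
        sweedler A a scalars
          (\<lambda>x1 x2. \<sigma> a b x1 y * \<sigma> (inv b \<otimes> a \<otimes> b) c (cross A (inv b) a x2) z) x"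
    and TCT3:
      "\<lbrakk>a \<in> carrier G; b \<in> carrier G; x \<in> carrier (comp A a); y \<in> carrier (comp A b)\<rbrakk> \<Longrightarrow>
      (let C = comp A (a \<otimes> b) in
        sweedler A a C (\<lambda>x1 x2. sweedler A b C (\<lambda>y1 y2.
          scal C (\<sigma> a b x1 y1) (tmult A b (inv b \<otimes> a \<otimes> b) y2 (cross A (inv b) a x2))) y) x =
        sweedler A a C (\<lambda>x1 x2. sweedler A b C (\<lambda>y1 y2.
          scal C (\<sigma> a b x2 y2) (tmult A a b x1 y1)) y) x)"
    and TCT4:
      "\<lbrakk>a \<in> carrier G; b \<in> carrier G; c \<in> carrier G;
        x \<in> carrier (comp A a); y \<in> carrier (comp A b)\<rbrakk> \<Longrightarrow>
      \<sigma> a b x y = \<sigma> (c \<otimes> a \<otimes> inv c) (c \<otimes> b \<otimes> inv c) (cross A c a x) (cross A c b y)"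


section \<open>The crossed Turaev group algebra of a finite-dimensional Hopf algebra\<close>

locale fd_hopf_algebra =
  hopf_algebra scale \<Delta> \<epsilon> S + finite_dimensional_vector_space scale Basis
  for scale :: "'k::field \<Rightarrow> 'h::ring_1 \<Rightarrow> 'h"
    and \<Delta> :: "'h \<Rightarrow> ('h, 'h, 'k) tensor"
    and \<epsilon> :: "'h \<Rightarrow> 'k"
    and S :: "'h \<Rightarrow> 'h"
    and Basis :: "'h set"
begin

text \<open>For \<open>i \<in> Basis\<close>, \<open>dual_basis i\<close> is the element \<open>h\<^sup>i\<close> of the dual basis.\<close>

definition dual_basis :: "'h \<Rightarrow> 'h \<Rightarrow> 'k"
  where "dual_basis i = (\<lambda>x. representation Basis x i)"

definition S_inv :: "'h \<Rightarrow> 'h"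
  where "S_inv = inv_into UNIV S"

text \<open>The underlying space \<open>H\<^sup>* \<otimes> H\<close> of every component, its elements \<open>p \<bowtie> h\<close>, and the map
  on \<open>H\<^sup>* \<otimes> H\<close> with prescribed values on the \<open>p \<bowtie> h\<close>.\<close>

definition CT_space :: "(('h \<Rightarrow> 'k, 'h, 'k) tensor, 'k) vspace"
  where "CT_space = tensor_space (dual_space H) H"

definition bow :: "('h \<Rightarrow> 'k) \<Rightarrow> 'h \<Rightarrow> ('h \<Rightarrow> 'k, 'h, 'k) tensor"  (infix \<open>\<bowtie>\<close> 50)
  where "p \<bowtie> h = pure (dual_space H) H p h"

definition CT_lift ::
    "('x::ab_group_add, 'k) vspace \<Rightarrow> (('h \<Rightarrow> 'k) \<Rightarrow> 'h \<Rightarrow> 'x) \<Rightarrow> ('h \<Rightarrow> 'k, 'h, 'k) tensor \<Rightarrow> 'x"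
  where "CT_lift X B = tensor_lift (dual_space H) H X B"

definition CT_cop ::
    "('h \<Rightarrow> 'h) \<times> ('h \<Rightarrow> 'h) \<Rightarrow> ('h \<Rightarrow> 'k, 'h, 'k) tensor
      \<Rightarrow> (('h \<Rightarrow> 'k, 'h, 'k) tensor, ('h \<Rightarrow> 'k, 'h, 'k) tensor, 'k) tensor"
  where "CT_cop = (\<lambda>(\<alpha>, \<beta>).
    let T = tensor_space CT_space CT_space in
    CT_lift T (\<lambda>p h. \<Sum>i\<in>Basis. \<Sum>j\<in>Basis.
      tensor_lift (dual_space H) (dual_space H) T (\<lambda>p1 p2. tensor_lift H H T (\<lambda>h1 h2.
        pure CT_space CT_space
          (p1 \<bowtie> \<beta> j * h1 * S_inv (\<alpha> i))
          (convol (convol (dual_basis i) p2) (dual_basis j) \<bowtie> h2)) (\<Delta> h)) (dual_comult p)))"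

definition CT_cou :: "('h \<Rightarrow> 'h) \<times> ('h \<Rightarrow> 'h) \<Rightarrow> ('h \<Rightarrow> 'k, 'h, 'k) tensor \<Rightarrow> 'k"
  where "CT_cou = (\<lambda>_. CT_lift scalars (\<lambda>p h. p 1 * \<epsilon> h))"

definition CT_mult ::
    "('h \<Rightarrow> 'h) \<times> ('h \<Rightarrow> 'h) \<Rightarrow> ('h \<Rightarrow> 'h) \<times> ('h \<Rightarrow> 'h) \<Rightarrow> ('h \<Rightarrow> 'k, 'h, 'k) tensor
      \<Rightarrow> ('h \<Rightarrow> 'k, 'h, 'k) tensor \<Rightarrow> ('h \<Rightarrow> 'k, 'h, 'k) tensor"
  where "CT_mult = (\<lambda>(\<alpha>, \<beta>) (\<gamma>, \<delta>) x y.
    CT_lift CT_space (\<lambda>p h. CT_lift CT_space (\<lambda>q h'.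
      convol q p \<bowtie> \<delta> h * (\<delta> \<circ> \<alpha> \<circ> inv_into UNIV \<delta>) h') y) x)"

definition CT_antip ::
    "('h \<Rightarrow> 'h) \<times> ('h \<Rightarrow> 'h) \<Rightarrow> ('h \<Rightarrow> 'k, 'h, 'k) tensor \<Rightarrow> ('h \<Rightarrow> 'k, 'h, 'k) tensor"
  where "CT_antip = (\<lambda>(\<alpha>, \<beta>).
    let \<alpha>' = inv_into UNIV \<alpha>; \<beta>' = inv_into UNIV \<beta> in
    CT_lift CT_space (\<lambda>p h. \<Sum>i\<in>Basis. \<Sum>j\<in>Basis.
      convol (convol (dual_basis i) (p \<circ> S_inv)) (dual_basis j \<circ> S_inv)
        \<bowtie> \<beta>' j * (\<beta>' \<circ> \<alpha>' \<circ> S) h * (\<beta>' \<circ> \<alpha>' \<circ> \<beta>) i))"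

definition CT_cross ::
    "('h \<Rightarrow> 'h) \<times> ('h \<Rightarrow> 'h) \<Rightarrow> ('h \<Rightarrow> 'h) \<times> ('h \<Rightarrow> 'h)
      \<Rightarrow> ('h \<Rightarrow> 'k, 'h, 'k) tensor \<Rightarrow> ('h \<Rightarrow> 'k, 'h, 'k) tensor"
  where "CT_cross = (\<lambda>(\<alpha>, \<beta>) (\<gamma>, \<delta>).
    CT_lift CT_space (\<lambda>p h.
      p \<circ> inv_into UNIV \<alpha> \<circ> \<beta> \<bowtie> (inv_into UNIV \<beta> \<circ> \<delta> \<circ> \<alpha> \<circ> inv_into UNIV \<delta>) h))"

definition CT ::
    "(('h \<Rightarrow> 'h) \<times> ('h \<Rightarrow> 'h), ('h \<Rightarrow> 'k, 'h, 'k) tensor, 'k) turaev"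
  where "CT = \<lparr>comp = (\<lambda>_. CT_space), cop = CT_cop, cou = CT_cou, tmult = CT_mult,
    tunit = (\<epsilon> \<bowtie> 1), antip = CT_antip, cross = CT_cross\<rparr>"

definition CT_sigma ::
    "('h \<Rightarrow> 'h) \<times> ('h \<Rightarrow> 'h) \<Rightarrow> ('h \<Rightarrow> 'h) \<times> ('h \<Rightarrow> 'h) \<Rightarrow> ('h \<Rightarrow> 'k, 'h, 'k) tensor
      \<Rightarrow> ('h \<Rightarrow> 'k, 'h, 'k) tensor \<Rightarrow> 'k"
  where "CT_sigma = (\<lambda>(\<alpha>, \<beta>) (\<gamma>, \<delta>) x y.
    CT_lift scalars (\<lambda>p h. CT_lift scalars (\<lambda>q h'.
      p (inv_into UNIV \<delta> h') * q 1 * \<epsilon> h) y) x)"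

end

end

theory Submission
  imports Defs
begin

text \<open>
  As \<open>H\<close> is finite-dimensional, \<open>p \<bowtie> h\<close> may be read as the endomorphism \<open>x \<mapsto> p(x) h\<close>, so that each
  component of \<open>CT(H)\<close> becomes the space of linear maps \<open>F : H \<rightarrow> H\<close>.  The sums over dual bases then
  disappear: on the component \<open>(\<alpha>, \<beta>)\<close> the coproduct sends \<open>F\<close> to
  \<open>(x, y) \<mapsto> \<beta>(y\<^sub>3) F(x y\<^sub>2)\<^sub>1 S\<^sup>-\<^sup>1\<alpha>(y\<^sub>1) \<otimes> F(x y\<^sub>2)\<^sub>2\<close>, the product of \<open>F\<close> and \<open>K\<close> is
  \<open>x \<mapsto> \<delta>(F(x\<^sub>2)) \<delta>\<alpha>\<delta>\<^sup>-\<^sup>1(K(x\<^sub>1))\<close>, and \<open>\<sigma>(F, K) = \<epsilon>(F(\<delta>\<^sup>-\<^sup>1(K(1))))\<close>, with convolution inverse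
  \<open>\<epsilon>(F(S\<delta>\<^sup>-\<^sup>1(K(1))))\<close>.  Every axiom turns into a short computation in \<open>H\<close>.  Bijectivity of \<open>S\<close> follows
  Larson and Sweedler: some coinvariant functional \<open>\<lambda>\<close> of the Hopf module \<open>H\<^sup>*\<close> is nonzero, and
  \<open>S h = 0\<close> forces \<open>\<lambda>(x) h = 0\<close> for all \<open>x\<close>.
\<close>

subsection \<open>Tensor products in coordinates\<close>

text \<open>In Sweedler notation an expression in x_1 and x_2 has a meaning only if it is bilinear
  in them. Here it becomes \<open>SW B x\<close>, a finite sum over one fixed expansion of \<Delta>
  x, and further legs become nested sums. Exchanging such sums is free, but coassociativity and
  cancellation require a multilinear summand. This is why linearity rules accompany nearly every
  step, and why neighbouring legs must be moved into one common sum before they can cancel. Tensors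
  are functionals on bilinear forms, so identities in H, in CT(H) and in tensor products are tested
  by scalar functionals. The coproduct formula comes from evaluating the second leg: (h^i p_2
  h^j)(y) = h^i(y_1) p_2(y_2) h^j(y_3). The sums over i and j put \<alpha>(y_1) and \<beta>(y_3)
  into the first leg, and p_1(x) p_2(y_2) = p(x y_2). \<open>S_inv\<close> is introduced as
  \<open>inv_into UNIV S\<close>, so nothing about it can be used before S is known to be bijective;
  finite dimension reduces this to injectivity.\<close>

lemma sum_fun_apply: "(\<Sum>i\<in>I. f i) x = (\<Sum>i\<in>I. f i x)"
  for f :: "'i \<Rightarrow> 'a \<Rightarrow> 'b::comm_monoid_add"
  by (induction I rule: infinite_finite_induct) auto

section \<open>Linear and bilinear maps between spaces with carriers\<close>

lemma carrier_scalars [simp]: "carrier scalars = UNIV" "scal scalars = (*)"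
  by (simp_all add: scalars_def)

lemma scal_tensor_space [simp]: "scal (tensor_space V W) = pscale"
  by (simp add: tensor_space_def)

lemma scal_dual_space [simp]: "scal (dual_space V) = pscale"
  by (simp add: dual_space_def)

lemma is_vspace_scalars: "is_vspace (scalars :: ('k::field, 'k) vspace)"
proof -
  interpret vector_space "(*) :: 'k \<Rightarrow> 'k \<Rightarrow> 'k" by (rule vector_space_mult)
  show ?thesis by (simp add: is_vspace_def vector_space_mult subspace_UNIV)
qed

lemma is_vspace_tensor_space:
  "is_vspace (tensor_space V W :: (('v::ab_group_add, 'w::ab_group_add, 'k::field) tensor, 'k) vspace)"
proof -
  interpret vector_space "pscale :: 'k \<Rightarrow> ('v, 'w, 'k) tensor \<Rightarrow> _" by (rule vector_space_pscale)
  show ?thesis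
    by (simp add: is_vspace_def vector_space_pscale tensor_space_def subspace_span)
qed

lemma
  assumes "is_vspace V"
  shows vs_zero: "0 \<in> carrier V"
    and vs_add: "x \<in> carrier V \<Longrightarrow> y \<in> carrier V \<Longrightarrow> x + y \<in> carrier V"
    and vs_scal: "x \<in> carrier V \<Longrightarrow> scal V c x \<in> carrier V"
    and vs_sum: "(\<And>i. i \<in> I \<Longrightarrow> f i \<in> carrier V) \<Longrightarrow> sum f I \<in> carrier V"
proof -
  interpret vector_space "scal V" using assms by (simp add: is_vspace_def)
  have V: "subspace (carrier V)" using assms by (simp add: is_vspace_def)
  show "0 \<in> carrier V" by (rule subspace_0[OF V])
  show "x \<in> carrier V \<Longrightarrow> y \<in> carrier V \<Longrightarrow> x + y \<in> carrier V" by (rule subspace_add[OF V])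
  show "x \<in> carrier V \<Longrightarrow> scal V c x \<in> carrier V" by (rule subspace_scale[OF V])
  show "(\<And>i. i \<in> I \<Longrightarrow> f i \<in> carrier V) \<Longrightarrow> sum f I \<in> carrier V" by (rule subspace_sum[OF V])
qed

lemma
  assumes "is_vspace V"
  shows vs_scal_add: "scal V c (x + y) = scal V c x + scal V c y"
    and vs_scal_add_left: "scal V (c + d) x = scal V c x + scal V d x"
    and vs_scal_scal: "scal V c (scal V d x) = scal V (c * d) x"
    and vs_scal_zero: "scal V c 0 = 0"
    and vs_scal_sum: "scal V c (sum f I) = (\<Sum>i\<in>I. scal V c (f i))"
proof -
  interpret vector_space "scal V" using assms by (simp add: is_vspace_def)
  show "scal V c (x + y) = scal V c x + scal V c y" by (rule scale_right_distrib)
  show "scal V (c + d) x = scal V c x + scal V d x" by (rule scale_left_distrib)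
  show "scal V c (scal V d x) = scal V (c * d) x" by simp
  show "scal V c 0 = 0" by simp
  show "scal V c (sum f I) = (\<Sum>i\<in>I. scal V c (f i))" by (rule scale_sum_right)
qed

lemma linear_mapI:
  assumes "\<And>x. x \<in> carrier V \<Longrightarrow> f x \<in> carrier W"
    and "\<And>x y. x \<in> carrier V \<Longrightarrow> y \<in> carrier V \<Longrightarrow> f (x + y) = f x + f y"
    and "\<And>c x. x \<in> carrier V \<Longrightarrow> f (scal V c x) = scal W c (f x)"
  shows "linear_map V W f"
  using assms by (auto simp: linear_map_def)

lemma
  assumes "linear_map V W f"
  shows linear_map_closed: "x \<in> carrier V \<Longrightarrow> f x \<in> carrier W"
    and linear_map_add: "x \<in> carrier V \<Longrightarrow> y \<in> carrier V \<Longrightarrow> f (x + y) = f x + f y"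
    and linear_map_scal: "x \<in> carrier V \<Longrightarrow> f (scal V c x) = scal W c (f x)"
  using assms by (auto simp: linear_map_def)

lemma linear_map_cong:
  assumes "linear_map V W g" "is_vspace V" "\<And>x. x \<in> carrier V \<Longrightarrow> f x = g x"
  shows "linear_map V W f"
  using assms by (auto simp: linear_map_def vs_add vs_scal)

lemma linear_map_zero:
  assumes "linear_map V W f" "is_vspace V"
  shows "f 0 = 0"
  using linear_map_add[OF assms(1) vs_zero[OF assms(2)] vs_zero[OF assms(2)]] by simp

lemma linear_map_sum:
  assumes "linear_map V W f" "is_vspace V" "\<And>i. i \<in> I \<Longrightarrow> g i \<in> carrier V"
  shows "f (sum g I) = (\<Sum>i\<in>I. f (g i))"
  using assms(3)
proof (induction I rule: infinite_finite_induct)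
  case (insert i I)
  then show ?case
    using linear_map_add[OF assms(1), of "g i" "sum g I"] vs_sum[OF assms(2), of I g] by simp
qed (simp_all add: linear_map_zero[OF assms(1,2)])

lemma linear_map_comp:
  assumes "linear_map V W f" "linear_map W X g"
  shows "linear_map V X (\<lambda>x. g (f x))"
  using assms by (auto simp: linear_map_def)

lemma linear_map_sum_fun:
  assumes "is_vspace W" "\<And>i. i \<in> I \<Longrightarrow> linear_map V W (f i)"
  shows "linear_map V W (\<lambda>x. \<Sum>i\<in>I. f i x)"
  using assms(2)
  by (intro linear_mapI)
    (auto intro!: vs_sum[OF assms(1)] sum.cong
      simp: linear_map_def sum.distrib[symmetric] vs_scal_sum[OF assms(1)])

lemma bilinear_mapI:
  assumes "\<And>v. v \<in> carrier V \<Longrightarrow> linear_map W X (\<lambda>w. B v w)"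
    and "\<And>w. w \<in> carrier W \<Longrightarrow> linear_map V X (\<lambda>v. B v w)"
  shows "bilinear_map V W X B"
  using assms by (auto simp: bilinear_map_def)

lemma
  assumes "bilinear_map V W X B"
  shows bilinear_map_right: "v \<in> carrier V \<Longrightarrow> linear_map W X (\<lambda>w. B v w)"
    and bilinear_map_left: "w \<in> carrier W \<Longrightarrow> linear_map V X (\<lambda>v. B v w)"
    and bilinear_map_closed: "v \<in> carrier V \<Longrightarrow> w \<in> carrier W \<Longrightarrow> B v w \<in> carrier X"
  using assms by (auto simp: bilinear_map_def linear_map_def)

lemma bilinear_map_linear:
  assumes "bilinear_map V W X B" "linear_map X Y L"
  shows "bilinear_map V W Y (\<lambda>v w. L (B v w))"
  using assms by (auto simp: bilinear_map_def intro: linear_map_comp)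

lemma bilinear_map_pre:
  assumes "bilinear_map V W X B" "linear_map V' V f" "linear_map W' W g"
  shows "bilinear_map V' W' X (\<lambda>v w. B (f v) (g w))"
  using assms by (auto simp: bilinear_map_def linear_map_def)

lemma bilinear_map_mult:
  assumes "linear_map V scalars f" "linear_map W scalars g"
  shows "bilinear_map V W scalars (\<lambda>v w. f v * g w)"
  using assms by (auto simp: bilinear_map_def linear_map_def algebra_simps)

lemma bilinear_map_cong:
  assumes "\<And>v w. v \<in> carrier V \<Longrightarrow> w \<in> carrier W \<Longrightarrow> B v w = C v w"
    and "is_vspace V" "is_vspace W" "bilinear_map V W X C"
  shows "bilinear_map V W X B"
  using assms(1,4) vs_add[OF assms(2)] vs_add[OF assms(3)] vs_scal[OF assms(2)] vs_scal[OF assms(3)]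
  by (auto simp: bilinear_map_def linear_map_def)

section \<open>Tensors as functionals on bilinear forms\<close>

lemma pure_apply: "bilinear_map V W scalars B \<Longrightarrow> pure V W v w B = B v w"
  by (simp add: pure_def)

lemma pure_closed:
  fixes V :: "('v::ab_group_add, 'k::field) vspace" and W :: "('w::ab_group_add, 'k) vspace"
  assumes "v \<in> carrier V" "w \<in> carrier W"
  shows "pure V W v w \<in> carrier (tensor_space V W)"
proof -
  interpret vector_space "pscale :: 'k \<Rightarrow> ('v, 'w, 'k) tensor \<Rightarrow> _" by (rule vector_space_pscale)
  show ?thesis using assms by (auto simp: tensor_space_def intro: span_base)
qed

lemma pure_bilinear: "bilinear_map V W (tensor_space V W) (pure V W)"
  by (intro bilinear_mapI linear_mapI)
    (auto simp: pure_closed, auto simp: pure_def pscale_def fun_eq_iff bilinear_map_def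
      linear_map_def)

lemma tensor_induct [consumes 1, case_names zero step]:
  fixes V :: "('v::ab_group_add, 'k::field) vspace" and W :: "('w::ab_group_add, 'k) vspace"
  assumes "t \<in> carrier (tensor_space V W)" "P 0"
    and "\<And>c v w t. v \<in> carrier V \<Longrightarrow> w \<in> carrier W \<Longrightarrow> t \<in> carrier (tensor_space V W) \<Longrightarrow> P t
      \<Longrightarrow> P (pscale c (pure V W v w) + t)"
  shows "P t"
proof -
  let ?P = "{pure V W v w | v w. v \<in> carrier V \<and> w \<in> carrier W}"
  interpret vector_space "pscale :: 'k \<Rightarrow> ('v, 'w, 'k) tensor \<Rightarrow> _" by (rule vector_space_pscale)
  have "t \<in> span ?P" using assms(1) by (simp add: tensor_space_def)
  then have "t \<in> span ?P \<and> P t"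
  proof (induction rule: span_induct_alt)
    case base
    show ?case using assms(2) span_zero by blast
  next
    case (step c x y)
    then obtain v w where vw: "x = pure V W v w" "v \<in> carrier V" "w \<in> carrier W" by blast
    have "pscale c x + y \<in> span ?P"
      using step by (blast intro: span_add span_scale span_base)
    moreover have "P (pscale c x + y)"
      unfolding vw(1) using step(2) vw by (intro assms(3)) (auto simp: tensor_space_def)
    ultimately show ?case by blast
  qed
  then show ?thesis ..
qed

lemma linear_map_tensor_eqI:
  assumes "is_vspace V" "is_vspace W"
    and "linear_map (tensor_space V W) X L" "linear_map (tensor_space V W) X M"
    and "\<And>v w. v \<in> carrier V \<Longrightarrow> w \<in> carrier W \<Longrightarrow> L (pure V W v w) = M (pure V W v w)"
    and "t \<in> carrier (tensor_space V W)"
  shows "L t = M t"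
  using assms(6)
proof (induction rule: tensor_induct)
  case zero
  show ?case
    unfolding linear_map_zero[OF assms(3) is_vspace_tensor_space]
      linear_map_zero[OF assms(4) is_vspace_tensor_space] ..
next
  case (step c v w t)
  have F: "F (pscale c (pure V W v w) + t) = scal X c (F (pure V W v w)) + F t"
    if F: "linear_map (tensor_space V W) X F" for F
    using linear_map_add[OF F vs_scal[OF is_vspace_tensor_space pure_closed[OF step(1,2)]] step(3)]
      linear_map_scal[OF F pure_closed[OF step(1,2)]] by simp
  show ?case unfolding F[OF assms(3)] F[OF assms(4)] step(4) assms(5)[OF step(1,2)] ..
qed

text \<open>Whether a function counts as a bilinear form depends only on its values on the carriers,
  so B and C also agree about the default value 0 that \<open>pure\<close> takes on other
  functions.\<close>

lemma tensor_cong: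
  assumes "t \<in> carrier (tensor_space V W)" "is_vspace V" "is_vspace W"
    and eq: "\<And>v w. v \<in> carrier V \<Longrightarrow> w \<in> carrier W \<Longrightarrow> B v w = C v w"
  shows "t B = t C"
  using assms(1)
proof (induction rule: tensor_induct)
  case (step c v w t)
  have "bilinear_map V W scalars B \<longleftrightarrow> bilinear_map V W scalars C"
    using bilinear_map_cong[of V W B C scalars] bilinear_map_cong[of V W C B scalars] assms(2,3) eq
    by metis
  with step show ?case by (simp add: pscale_def pure_def eq)
qed simp

lemma eval_linear: "linear_map (tensor_space V W) scalars (\<lambda>t. t B)"
  by (intro linear_mapI) (auto simp: pscale_def)

text \<open>A tensor is additive only on bilinear forms: two functions that are not bilinear may
  have a bilinear sum, while \<open>pure\<close> sends both of them to 0.\<close>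

lemma tensor_add:
  assumes "t \<in> carrier (tensor_space V W)" "bilinear_map V W scalars B" "bilinear_map V W scalars C"
  shows "t (\<lambda>v w. B v w + C v w) = t B + t C"
  using assms(1)
proof (induction rule: tensor_induct)
  case (step c v w t)
  have "bilinear_map V W scalars (\<lambda>v w. B v w + C v w)"
    using assms(2,3) by (auto simp: bilinear_map_def linear_map_def algebra_simps)
  with step assms show ?case by (simp add: pscale_def pure_apply algebra_simps)
qed simp

lemma tensor_scale:
  assumes "t \<in> carrier (tensor_space V W)" "bilinear_map V W scalars B"
  shows "t (\<lambda>v w. c * B v w) = c * t B"
  using assms(1)
proof (induction rule: tensor_induct)
  case (step d v w t)
  have "bilinear_map V W scalars (\<lambda>v w. c * B v w)"
    using assms(2) by (auto simp: bilinear_map_def linear_map_def algebra_simps)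
  with step assms show ?case by (simp add: pscale_def pure_apply algebra_simps)
qed simp

lemma bilinear_map_zero:
  "bilinear_map V W scalars (\<lambda>v w. 0 :: 'k::field)"
  by (auto simp: bilinear_map_def linear_map_def)

lemma bilinear_map_sum:
  fixes V :: "('v::ab_group_add, 'k::field) vspace"
  assumes "\<And>i. i \<in> I \<Longrightarrow> bilinear_map V W scalars (B i)"
  shows "bilinear_map V W scalars (\<lambda>v w. \<Sum>i\<in>I. B i v w)"
  using assms
  by (intro bilinear_mapI linear_map_sum_fun is_vspace_scalars)
    (auto dest: bilinear_map_right bilinear_map_left)

lemma tensor_sum:
  assumes "t \<in> carrier (tensor_space V W)" "\<And>i. i \<in> I \<Longrightarrow> bilinear_map V W scalars (B i)"
  shows "t (\<lambda>v w. \<Sum>i\<in>I. B i v w) = (\<Sum>i\<in>I. t (B i))"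
proof -
  have zero: "t (\<lambda>v w. 0) = 0"
    using tensor_scale[OF assms(1) bilinear_map_zero, of 0] by simp
  show ?thesis
    using assms(2)
    by (induction I rule: infinite_finite_induct)
      (auto simp: zero tensor_add[OF assms(1)] bilinear_map_sum)
qed

text \<open>Composing with a functional turns a lift into a single evaluation of the tensor. This
  removes \<open>tensor_lift\<close>, which is known only through a choice, from the computations in
  CT(H).\<close>

lemma linear_tensor_lift:
  assumes "is_vspace V" "is_vspace W" "is_vspace X" "bilinear_map V W X B" "linear_map X scalars L"
    and "t \<in> carrier (tensor_space V W)"
  shows "L (tensor_lift V W X B t) = t (\<lambda>v w. L (B v w))"
proof -
  have b: "bilinear_map V W scalars (\<lambda>v w. L (B v w))"
    by (rule bilinear_map_linear[OF assms(4,5)])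
  show ?thesis
    by (rule linear_map_tensor_eqI[OF assms(1,2)
          linear_map_comp[OF tensor_lift_linear[OF assms(3,4)] assms(5)] eval_linear _ assms(6)])
      (simp add: tensor_lift_pure[OF assms(3,4)] pure_apply[OF b])
qed

lemma tensor_lift_scalars:
  assumes "is_vspace V" "is_vspace W" "bilinear_map V W scalars B" "t \<in> carrier (tensor_space V W)"
  shows "tensor_lift V W scalars B t = t B"
  using linear_tensor_lift[OF assms(1,2) is_vspace_scalars assms(3), of "\<lambda>x. x"] assms(4)
  by (simp add: linear_map_def)

lemma tensor_lift_apply:
  assumes "is_vspace V" "is_vspace W" "bilinear_map V W (tensor_space X Y) B"
    and "t \<in> carrier (tensor_space V W)"
  shows "tensor_lift V W (tensor_space X Y) B t C = t (\<lambda>v w. B v w C)"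
  using linear_tensor_lift[OF assms(1,2) is_vspace_tensor_space assms(3) eval_linear assms(4)] .

text \<open>The lift is chosen anew for each u, so its linearity in u is not visible from the
  definition; it follows by induction on the fixed tensor t. Nested lifts need this, since their
  inner form depends on an outer variable.\<close>

lemma linear_tensor_lift_param:
  assumes "is_vspace V" "is_vspace W" "is_vspace X" "is_vspace U"
    and "\<And>u. u \<in> carrier U \<Longrightarrow> bilinear_map V W X (B u)"
    and "\<And>v w. v \<in> carrier V \<Longrightarrow> w \<in> carrier W \<Longrightarrow> linear_map U X (\<lambda>u. B u v w)"
    and "t \<in> carrier (tensor_space V W)"
  shows "linear_map U X (\<lambda>u. tensor_lift V W X (B u) t)"
  using assms(7)
proof (induction rule: tensor_induct)
  case zero
  have eq: "tensor_lift V W X (B u) 0 = 0" if "u \<in> carrier U" for u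
    by (rule linear_map_zero[OF tensor_lift_linear[OF assms(3) assms(5)[OF that]] is_vspace_tensor_space])
  have zero: "linear_map U X (\<lambda>_. 0)"
    by (simp add: linear_map_def vs_zero[OF assms(3)] vs_scal_zero[OF assms(3)])
  show ?case by (rule linear_map_cong[OF zero assms(4) eq])
next
  case (step c v w t)
  have eq: "tensor_lift V W X (B u) (pscale c (pure V W v w) + t) =
      scal X c (B u v w) + tensor_lift V W X (B u) t" if u: "u \<in> carrier U" for u
  proof -
    note L = tensor_lift_linear[OF assms(3) assms(5)[OF u]]
    have p: "pure V W v w \<in> carrier (tensor_space V W)" using step by (intro pure_closed)
    show ?thesis
      using linear_map_add[OF L vs_scal[OF is_vspace_tensor_space p, of c] step(3)]
        linear_map_scal[OF L p, of c] tensor_lift_pure[OF assms(3) assms(5)[OF u] step(1,2)] by simp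
  qed
  have "linear_map U X (\<lambda>u. scal X c (B u v w) + tensor_lift V W X (B u) t)"
    using assms(6)[OF step(1,2)] step(4)
    by (intro linear_mapI)
      (auto simp: linear_map_def vs_add[OF assms(3)] vs_scal[OF assms(3)]
        vs_scal_add[OF assms(3)] vs_scal_scal[OF assms(3)] mult.commute add_ac)
  then show ?case by (rule linear_map_cong[OF _ assms(4) eq])
qed

text \<open>A finite spanning family together with coordinate functions, not required to be independent.\<close>

definition coord_system ::
    "('v::ab_group_add, 'k::field) vspace \<Rightarrow> 'i set \<Rightarrow> ('i \<Rightarrow> 'v) \<Rightarrow> ('i \<Rightarrow> 'v \<Rightarrow> 'k) \<Rightarrow> bool"
  where "coord_system V I e e' \<longleftrightarrow> is_vspace V \<and> finite I \<and> (\<forall>i\<in>I. e i \<in> carrier V) \<and>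
    (\<forall>i\<in>I. linear_map V scalars (e' i)) \<and> (\<forall>v\<in>carrier V. v = (\<Sum>i\<in>I. scal V (e' i v) (e i)))"

lemma coord_system_eqI:
  assumes "coord_system V I e e'" "x \<in> carrier V" "y \<in> carrier V" "\<And>i. i \<in> I \<Longrightarrow> e' i x = e' i y"
  shows "x = y"
proof -
  have "x = (\<Sum>i\<in>I. scal V (e' i x) (e i))" using assms(1,2) by (auto simp: coord_system_def)
  also have "\<dots> = (\<Sum>i\<in>I. scal V (e' i y) (e i))" using assms(4) by simp
  also have "\<dots> = y" using assms(1,3) by (auto simp: coord_system_def)
  finally show ?thesis .
qed

text \<open>The coordinates of a tensor are its values on products of coordinate functions. Equality
  in a tensor product, also in an iterated one, is thereby reduced to evaluation on such product
  forms.\<close>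

lemma coord_system_tensor:
  assumes V: "coord_system V I e e'" and W: "coord_system W J f f'"
  shows "coord_system (tensor_space V W) (I \<times> J) (\<lambda>(i, j). pure V W (e i) (f j))
    (\<lambda>(i, j) t. t (\<lambda>v w. e' i v * f' j w))"
proof -
  let ?T = "tensor_space V W"
  let ?L = "\<lambda>t. \<Sum>ij\<in>I \<times> J. pscale (t (\<lambda>v w. e' (fst ij) v * f' (snd ij) w))
    (pure V W (e (fst ij)) (f (snd ij)))"
  have vs: "is_vspace V" "is_vspace W" using V W by (auto simp: coord_system_def)
  have mem: "\<And>i. i \<in> I \<Longrightarrow> e i \<in> carrier V" "\<And>j. j \<in> J \<Longrightarrow> f j \<in> carrier W"
    using V W by (auto simp: coord_system_def)
  have b: "bilinear_map V W scalars (\<lambda>v w. e' i v * f' j w)" if "i \<in> I" "j \<in> J" for i j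
    using V W that by (auto simp: coord_system_def intro: bilinear_map_mult)
  have L: "linear_map ?T ?T ?L"
    by (intro linear_map_sum_fun is_vspace_tensor_space linear_mapI)
      (auto intro!: pure_closed mem vs_scal[OF is_vspace_tensor_space[of V W], simplified],
        auto simp: pscale_def fun_eq_iff algebra_simps)
  have I: "linear_map ?T ?T (\<lambda>t. t)" by (simp add: linear_map_def)
  have "t = ?L t" if "t \<in> carrier ?T" for t
  proof (rule linear_map_tensor_eqI[OF vs I L _ that])
    fix v w assume v: "v \<in> carrier V" and w: "w \<in> carrier W"
    have p2: "pure V W v (\<Sum>j\<in>J. scal W (f' j w) (f j)) = (\<Sum>j\<in>J. pscale (f' j w) (pure V W v (f j)))"
      if "v \<in> carrier V" for v
      using bilinear_map_right[OF pure_bilinear that, of W]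
      by (simp add: linear_map_sum[OF _ vs(2)] linear_map_scal mem vs_scal[OF vs(2)])
    have p1: "pure V W (\<Sum>i\<in>I. scal V (e' i v) (e i)) w = (\<Sum>i\<in>I. pscale (e' i v) (pure V W (e i) w))"
      using bilinear_map_left[OF pure_bilinear w, of V]
      by (simp add: linear_map_sum[of _ _ "\<lambda>v. pure V W v w", OF _ vs(1)]
          linear_map_scal[of _ _ "\<lambda>v. pure V W v w"] mem vs_scal[OF vs(1)])
    have v': "v = (\<Sum>i\<in>I. scal V (e' i v) (e i))" using V v by (auto simp: coord_system_def)
    have w': "w = (\<Sum>j\<in>J. scal W (f' j w) (f j))" using W w by (auto simp: coord_system_def)
    have "pure V W v w = pure V W (\<Sum>i\<in>I. scal V (e' i v) (e i)) w" (is "?lhs = _")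
      by (rule arg_cong[where f="\<lambda>v. pure V W v w", OF v'])
    also have "\<dots> = (\<Sum>i\<in>I. pscale (e' i v) (pure V W (e i) w))" by (rule p1)
    also have "\<dots> = (\<Sum>i\<in>I. pscale (e' i v) (pure V W (e i) (\<Sum>j\<in>J. scal W (f' j w) (f j))))"
      by (rule sum.cong[OF refl]) (rule arg_cong[OF w'])
    also have "\<dots> = (\<Sum>i\<in>I. pscale (e' i v) (\<Sum>j\<in>J. pscale (f' j w) (pure V W (e i) (f j))))"
      by (simp add: p2 mem(1))
    also have "\<dots> = (\<Sum>i\<in>I. \<Sum>j\<in>J. pscale (e' i v * f' j w) (pure V W (e i) (f j)))"
      by (simp add: pscale_def fun_eq_iff sum_fun_apply sum_distrib_left mult.assoc)
    also have "\<dots> = ?L (pure V W v w)"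
      by (auto simp: sum.cartesian_product case_prod_unfold pure_apply[OF b] intro!: sum.cong)
    finally show "?lhs = \<dots>" .
  qed
  with V W show ?thesis
    by (auto simp: coord_system_def is_vspace_tensor_space eval_linear pure_closed case_prod_unfold)
qed

subsection \<open>Sweedler sums in a finite-dimensional Hopf algebra\<close>

text \<open>H fills its whole type, so linearity on H needs no carrier conditions. Taking the scalar
  action s of the target as a parameter lets one predicate serve functionals and endomorphisms
  alike.\<close>

definition (in vector_space) lin :: "('a \<Rightarrow> 'x \<Rightarrow> 'x) \<Rightarrow> ('b \<Rightarrow> 'x::ab_group_add) \<Rightarrow> bool"
  where "lin s f \<longleftrightarrow> (\<forall>x y. f (x + y) = f x + f y) \<and> (\<forall>c x. f (scale c x) = s c (f x))"

context fd_hopf_algebra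
begin

abbreviation "lk \<equiv> lin ((*) :: 'k \<Rightarrow> 'k \<Rightarrow> 'k)"
abbreviation "lh \<equiv> lin scale"

lemma linI:
  assumes "\<And>x y. f (x + y) = f x + f y" "\<And>c x. f (scale c x) = s c (f x)"
  shows "lin s f"
  using assms by (simp add: lin_def)

lemma lin_add: "lin s f \<Longrightarrow> f (x + y) = f x + f y"
  and lin_scale: "lin s f \<Longrightarrow> f (scale c x) = s c (f x)"
  by (simp_all add: lin_def)

lemma lin_zero: "lin s f \<Longrightarrow> f 0 = 0"
  using lin_add[of s f 0 0] by simp

lemma lin_sum: "lin s f \<Longrightarrow> f (sum g I) = (\<Sum>i\<in>I. f (g i))"
  by (induction I rule: infinite_finite_induct) (simp_all add: lin_zero lin_add)

lemma carrier_H [simp]: "carrier H = UNIV" "scal H = scale"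
  by (simp_all add: H_def)

lemma is_vspace_H: "is_vspace H"
  by (simp add: is_vspace_def vector_space_axioms subspace_UNIV)

lemma linear_map_iff_lin: "linear_map H X f \<longleftrightarrow> lin (scal X) f \<and> range f \<subseteq> carrier X"
  by (auto simp: linear_map_def lin_def)

lemma linear_map_scalars_iff_lk: "linear_map H scalars f \<longleftrightarrow> lk f"
  by (auto simp: linear_map_def lin_def)

lemma dual_space_iff_lk: "f \<in> carrier (dual_space H) \<longleftrightarrow> lk f"
  by (auto simp: dual_space_def linear_map_scalars_iff_lk)

lemma bilinear_map_iff_lk:
  "bilinear_map H H scalars B \<longleftrightarrow> (\<forall>a. lk (B a)) \<and> (\<forall>b. lk (\<lambda>a. B a b))"
  by (auto simp: bilinear_map_def linear_map_scalars_iff_lk)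

lemma bilinear_mapI_lk:
  assumes "\<And>a. lk (B a)" "\<And>b. lk (\<lambda>a. B a b)"
  shows "bilinear_map H H scalars B"
  using assms by (simp add: bilinear_map_iff_lk)

lemma lk_dual_basis: "lk (dual_basis i)"
  by (intro linI)
    (simp_all add: dual_basis_def representation_add representation_scale independent_Basis span_Basis)

lemma basis_expansion: "(\<Sum>i\<in>Basis. scale (dual_basis i x) i) = x"
  unfolding dual_basis_def
  by (rule sum_representation_eq[OF independent_Basis _ finite_Basis subset_refl])
    (simp add: span_Basis)

text \<open>This is the identity that makes sums over dual bases disappear: a sum over i of h^i(x)
  f(h_i) is replaced by f(x), for scalar and for H-valued f.\<close>

lemma lin_basis_expansion:
  assumes "lin s f"
  shows "(\<Sum>i\<in>Basis. s (dual_basis i x) (f i)) = f x"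
proof -
  have "f x = f (\<Sum>i\<in>Basis. scale (dual_basis i x) i)" by (simp only: basis_expansion)
  also have "\<dots> = (\<Sum>i\<in>Basis. s (dual_basis i x) (f i))"
    by (simp only: lin_sum[OF assms] lin_scale[OF assms])
  finally show ?thesis ..
qed

lemma dual_basis_Basis: "i \<in> Basis \<Longrightarrow> j \<in> Basis \<Longrightarrow> dual_basis i j = (if i = j then 1 else 0)"
  by (simp add: dual_basis_def representation_basis[OF independent_Basis])

text \<open>Coassociativity, the counit laws and the antipode laws are available below for scalar
  summands, so an equation in H is proved after applying an arbitrary functional to both
  sides.\<close>

lemma lk_separates:
  assumes "\<And>f. lk f \<Longrightarrow> f x = f y"
  shows "x = y"
proof -
  have "x = (\<Sum>i\<in>Basis. scale (dual_basis i x) i)" by (simp only: basis_expansion)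
  also have "\<dots> = (\<Sum>i\<in>Basis. scale (dual_basis i y) i)" by (simp only: assms[OF lk_dual_basis])
  also have "\<dots> = y" by (simp only: basis_expansion)
  finally show ?thesis .
qed

lemma coord_system_H: "coord_system H Basis (\<lambda>i. i) dual_basis"
  using is_vspace_H finite_Basis
  by (simp add: coord_system_def linear_map_scalars_iff_lk lk_dual_basis basis_expansion)

lemma coalgebra_H: "coalgebra H \<Delta> \<epsilon>"
  using coalgebra by (simp add: H_def)

lemma linear_Delta: "linear_map H (tensor_space H H) \<Delta>"
  and linear_counit: "linear_map H scalars \<epsilon>"
  using coalgebra_H by (simp_all add: coalgebra_def)

lemma Delta_closed: "\<Delta> x \<in> carrier (tensor_space H H)"
  using linear_map_closed[OF linear_Delta] by simp

text \<open>\<open>\<Delta> x\<close> is the sum of \<open>i \<otimes> comult_coeff i x\<close> over the basis elements \<open>i\<close>.\<close>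

definition comult_coeff :: "'h \<Rightarrow> 'h \<Rightarrow> 'h"
  where "comult_coeff i x = (\<Sum>j\<in>Basis. scale (\<Delta> x (\<lambda>u v. dual_basis i u * dual_basis j v)) j)"

text \<open>This is B(x_1, x_2), computed from a fixed expansion of \<Delta> x. It is defined for
  every B, so that exchanging nested sums and pulling out factors hold without any
  linearity.\<close>

definition SW :: "('h \<Rightarrow> 'h \<Rightarrow> 'x::comm_monoid_add) \<Rightarrow> 'h \<Rightarrow> 'x"
  where "SW B x = (\<Sum>i\<in>Basis. B i (comult_coeff i x))"

lemma lh_comult_coeff: "lh (comult_coeff i)"
  by (intro linI) (simp_all add: comult_coeff_def linear_map_add[OF linear_Delta]
    linear_map_scal[OF linear_Delta, simplified] pscale_def scale_left_distrib sum.distrib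
    scale_sum_right)

lemma Delta_eq: "\<Delta> x = (\<Sum>i\<in>Basis. pure H H i (comult_coeff i x))"
proof (rule coord_system_eqI[OF coord_system_tensor[OF coord_system_H coord_system_H] Delta_closed])
  show "(\<Sum>i\<in>Basis. pure H H i (comult_coeff i x)) \<in> carrier (tensor_space H H)"
    by (intro vs_sum[OF is_vspace_tensor_space] pure_closed) auto
  fix ij assume "ij \<in> Basis \<times> Basis"
  then obtain a b where ab: "ij = (a, b)" "a \<in> Basis" "b \<in> Basis" by auto
  have bil: "bilinear_map H H scalars (\<lambda>v w. dual_basis a v * dual_basis b w)"
    by (intro bilinear_map_mult) (auto simp: linear_map_scalars_iff_lk lk_dual_basis)
  have "(\<Sum>i\<in>Basis. pure H H i (comult_coeff i x)) (\<lambda>v w. dual_basis a v * dual_basis b w) =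
      (\<Sum>i\<in>Basis. dual_basis a i * dual_basis b (comult_coeff i x))"
    by (simp add: sum_fun_apply pure_apply[OF bil])
  also have "\<dots> = (\<Sum>i\<in>Basis. if a = i then dual_basis b (comult_coeff i x) else 0)"
    using ab by (intro sum.cong) (auto simp: dual_basis_Basis)
  also have "\<dots> = dual_basis b (comult_coeff a x)"
    using ab finite_Basis by simp
  also have "\<dots> = (\<Sum>j\<in>Basis. if b = j then \<Delta> x (\<lambda>u v. dual_basis a u * dual_basis j v) else 0)"
    using ab unfolding comult_coeff_def lin_sum[OF lk_dual_basis] lin_scale[OF lk_dual_basis]
    by (intro sum.cong) (auto simp: dual_basis_Basis)
  also have "\<dots> = \<Delta> x (\<lambda>v w. dual_basis a v * dual_basis b w)"
    using ab finite_Basis by simp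
  finally show "(case ij of (i, j) \<Rightarrow> \<lambda>t. t (\<lambda>v w. dual_basis i v * dual_basis j w)) (\<Delta> x) =
      (case ij of (i, j) \<Rightarrow> \<lambda>t. t (\<lambda>v w. dual_basis i v * dual_basis j w))
        (\<Sum>i\<in>Basis. pure H H i (comult_coeff i x))"
    using ab by simp
qed

lemma tensor_lift_Delta:
  assumes "is_vspace X" "bilinear_map H H X B"
  shows "tensor_lift H H X B (\<Delta> x) = SW B x"
proof -
  have "tensor_lift H H X B (\<Delta> x) =
      (\<Sum>i\<in>Basis. tensor_lift H H X B (pure H H i (comult_coeff i x)))"
    unfolding Delta_eq[of x]
    by (rule linear_map_sum[OF tensor_lift_linear[OF assms] is_vspace_tensor_space])
      (simp add: pure_closed)
  then show ?thesis by (simp add: SW_def tensor_lift_pure[OF assms])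
qed

lemma Delta_apply:
  assumes "\<And>a. lk (B a)" "\<And>b. lk (\<lambda>a. B a b)"
  shows "\<Delta> x B = SW B x"
  unfolding SW_def Delta_eq[of x]
  by (simp add: sum_fun_apply pure_apply[OF bilinear_mapI_lk[OF assms]])

section \<open>Linearity of Sweedler expressions in each variable\<close>

lemma lin_id: "lh (\<lambda>x. x)"
  by (simp add: lin_def)

lemma lin_comp: "lin s f \<Longrightarrow> lh g \<Longrightarrow> lin s (\<lambda>x. f (g x))"
  by (simp add: lin_def)

lemma lin_mult_left: "lh f \<Longrightarrow> lh (\<lambda>x. f x * c)"
  by (simp add: lin_def distrib_right scale_mult_left)

lemma lin_mult_right: "lh f \<Longrightarrow> lh (\<lambda>x. c * f x)"
  by (simp add: lin_def distrib_left scale_mult_right)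

lemma lin_scale_left: "lk f \<Longrightarrow> lh (\<lambda>x. scale (f x) c)"
  by (simp add: lin_def scale_left_distrib)

lemma lin_scale_right: "lh f \<Longrightarrow> lh (\<lambda>x. scale c (f x))"
  by (simp add: lin_def scale_right_distrib mult.commute)

lemma lk_mult_left: "lk f \<Longrightarrow> lk (\<lambda>x. f x * c)"
  by (simp add: lin_def algebra_simps)

lemma lk_mult_right: "lk f \<Longrightarrow> lk (\<lambda>x. c * f x)"
  by (simp add: lin_def algebra_simps)

lemma lk_sum: "(\<And>i. lk (f i)) \<Longrightarrow> lk (\<lambda>x. \<Sum>i\<in>I. f i x)"
  by (simp add: lin_def sum.distrib sum_distrib_left)

lemma lh_sum: "(\<And>i. lh (f i)) \<Longrightarrow> lh (\<lambda>x. \<Sum>i\<in>I. f i x)"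
  by (simp add: lin_def sum.distrib scale_sum_right)

lemma lk_SW: "(\<And>a b. lk (\<lambda>x. B x a b)) \<Longrightarrow> lk (\<lambda>x. SW (B x) y)"
  unfolding SW_def by (rule lk_sum)

lemma lh_SW: "(\<And>a b. lh (\<lambda>x. B x a b)) \<Longrightarrow> lh (\<lambda>x. SW (B x) y)"
  unfolding SW_def by (rule lh_sum)

lemma lk_SW_arg:
  assumes "\<And>a. lk (B a)" "lh f"
  shows "lk (\<lambda>x. SW B (f x))"
  unfolding SW_def
  by (rule lk_sum, rule lin_comp[OF assms(1) lin_comp[OF lh_comult_coeff assms(2)]])

lemma lh_SW_arg:
  assumes "\<And>a. lh (B a)" "lh f"
  shows "lh (\<lambda>x. SW B (f x))"
  unfolding SW_def
  by (rule lh_sum, rule lin_comp[OF assms(1) lin_comp[OF lh_comult_coeff assms(2)]])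

lemma lk_counit: "lk \<epsilon>"
  using linear_counit by (simp add: linear_map_scalars_iff_lk)

lemma lh_S: "lh S"
proof -
  interpret S: Vector_Spaces.linear scale scale S by (rule antipode_linear)
  show ?thesis by (intro linI) (simp_all add: S.add S.scale)
qed

text \<open>Linearity in one variable is derived along the structure of the term. The variable may
  occur in the summand of a Sweedler sum or in the element being split; the rules ending in
  \<open>_arg\<close> treat the second case.\<close>

lemmas lin_intros = lin_id lin_mult_left lin_mult_right lin_scale_left lin_scale_right
  lk_mult_left lk_mult_right lk_sum lh_sum lk_SW lh_SW lk_SW_arg lh_SW_arg
  lin_comp[OF lk_counit] lin_comp[OF lh_S] lin_comp[OF lk_dual_basis]

lemma lin_SW: "lin s f \<Longrightarrow> f (SW B x) = SW (\<lambda>a b. f (B a b)) x"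
  by (simp add: SW_def lin_sum)

lemma SW_mult_right: "c * SW B x = SW (\<lambda>a b. c * B a b) x"
  for c :: "'a::semiring_0"
  by (simp add: SW_def sum_distrib_left)

lemma SW_mult_left: "SW B x * c = SW (\<lambda>a b. B a b * c) x"
  for c :: "'a::semiring_0"
  by (simp add: SW_def sum_distrib_right)

lemma SW_sum: "SW (\<lambda>a b. \<Sum>i\<in>I. B i a b) x = (\<Sum>i\<in>I. SW (B i) x)"
  unfolding SW_def by (rule sum.swap)

lemma SW_cong: "(\<And>a b. B a b = C a b) \<Longrightarrow> SW B x = SW C x"
  by presburger

lemma SW_swap: "SW (\<lambda>a b. SW (\<lambda>c d. B a b c d) y) x = SW (\<lambda>c d. SW (\<lambda>a b. B a b c d) x) y"
  unfolding SW_def by (rule sum.swap)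

text \<open>The axiom is an equation in (H \<otimes> H) \<otimes> H. It is evaluated at the form
  that sends (t, w) to t applied to B with third argument w; this form is bilinear because B is
  trilinear.\<close>

lemma SW_coassoc:
  assumes "\<And>b c. lk (\<lambda>a. B a b c)" "\<And>a c. lk (\<lambda>b. B a b c)" "\<And>a b. lk (\<lambda>c. B a b c)"
  shows "SW (\<lambda>r c. SW (\<lambda>a b. B a b c) r) x = SW (\<lambda>a r. SW (\<lambda>b c. B a b c) r) x"
proof -
  note lin = assms assms[THEN lin_comp]
  let ?HH = "tensor_space H H" and ?HHH = "tensor_space (tensor_space H H) H"
  let ?C = "\<lambda>t w. t (\<lambda>u v. B u v w)"
  have bB: "bilinear_map H H scalars (\<lambda>u v. B u v w)" for w
    by (intro bilinear_mapI_lk lin)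
  have bC: "bilinear_map ?HH H scalars ?C"
  proof (intro bilinear_mapI linear_mapI)
    fix t :: "('h, 'h, 'k) tensor" and x y :: 'h and c :: 'k
    assume t: "t \<in> carrier ?HH"
    show "t (\<lambda>u v. B u v (x + y)) = t (\<lambda>u v. B u v x) + t (\<lambda>u v. B u v y)"
      using tensor_add[OF t bB bB, of x y] by (simp add: lin_add[OF assms(3)])
    show "t (\<lambda>u v. B u v (scal H c x)) = scal scalars c (t (\<lambda>u v. B u v x))"
      using tensor_scale[OF t bB, of c x] by (simp add: lin_scale[OF assms(3)])
  qed (simp_all add: pscale_def)
  have vs: "is_vspace ?HHH" by (rule is_vspace_tensor_space)
  have l1: "linear_map H ?HHH (\<lambda>w. pure ?HH H (pure H H u v) w)" for u v
    by (rule bilinear_map_right[OF pure_bilinear]) (simp add: pure_closed)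
  have l2: "linear_map H ?HHH (\<lambda>u. pure ?HH H (pure H H u v) w)" for v w
    by (rule linear_map_comp[where W="?HH" and f="\<lambda>u. pure H H u v"])
      (rule bilinear_map_left[OF pure_bilinear]; simp)+
  have l3: "linear_map H ?HHH (\<lambda>v. pure ?HH H (pure H H u v) w)" for u w
    by (rule linear_map_comp[where W="?HH" and f="\<lambda>v. pure H H u v"])
      (rule bilinear_map_right[OF pure_bilinear] bilinear_map_left[OF pure_bilinear]; simp)+
  have lift1: "tensor_lift H H ?HHH (\<lambda>u v. pure ?HH H (pure H H u v) w) (\<Delta> r) =
      SW (\<lambda>u v. pure ?HH H (pure H H u v) w) r" for w r
    by (intro tensor_lift_Delta vs bilinear_mapI l2 l3)
  have lift2: "tensor_lift H H ?HHH (\<lambda>u v. pure ?HH H (pure H H x1 u) v) (\<Delta> r) =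
      SW (\<lambda>u v. pure ?HH H (pure H H x1 u) v) r" for x1 r
    by (intro tensor_lift_Delta vs bilinear_mapI l1 l3)
  have SW_linear: "linear_map H ?HHH (SW (F :: 'h \<Rightarrow> 'h \<Rightarrow> (('h,'h,'k) tensor, 'h, 'k) tensor))"
    if "\<And>a. linear_map H ?HHH (F a)" for F
    unfolding SW_def
    by (intro linear_map_sum_fun vs linear_map_comp[OF _ that, where V=H])
      (simp add: linear_map_iff_lin lh_comult_coeff)
  have e1: "tensor_lift H H ?HHH (\<lambda>r c. tensor_lift H H ?HHH (\<lambda>u v. pure ?HH H (pure H H u v) c) (\<Delta> r))
      (\<Delta> x) = SW (\<lambda>r c. SW (\<lambda>a b. pure ?HH H (pure H H a b) c) r) x"
    unfolding lift1
    by (intro tensor_lift_Delta vs bilinear_mapI SW_linear l3) (unfold SW_def, intro linear_map_sum_fun vs l1)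
  have e2: "tensor_lift H H ?HHH (\<lambda>a r. tensor_lift H H ?HHH (\<lambda>u v. pure ?HH H (pure H H a u) v) (\<Delta> r))
      (\<Delta> x) = SW (\<lambda>a r. SW (\<lambda>b c. pure ?HH H (pure H H a b) c) r) x"
    unfolding lift2
    by (intro tensor_lift_Delta vs bilinear_mapI SW_linear l1) (unfold SW_def, intro linear_map_sum_fun vs l2)
  have "SW (\<lambda>r c. SW (\<lambda>a b. pure ?HH H (pure H H a b) c) r) x =
      SW (\<lambda>a r. SW (\<lambda>b c. pure ?HH H (pure H H a b) c) r) x"
    using coalgebra_H unfolding coalgebra_def Let_def e1[symmetric] e2[symmetric] by simp
  from fun_cong[OF this, of ?C] show ?thesis
    by (simp add: SW_def sum_fun_apply pure_apply[OF bC] pure_apply[OF bB])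
qed

lemma SW_counit_left:
  assumes "lk f"
  shows "SW (\<lambda>a b. \<epsilon> a * f b) x = f x"
proof -
  have "tensor_lift H H H (\<lambda>x1 x2. scale (\<epsilon> x1) x2) (\<Delta> x) = x"
    using coalgebra_H by (simp add: coalgebra_def)
  moreover have "bilinear_map H H H (\<lambda>x1 x2. scale (\<epsilon> x1) x2)"
    by (intro bilinear_mapI) (auto simp: linear_map_iff_lin intro!: lin_intros)
  ultimately have "SW (\<lambda>x1 x2. scale (\<epsilon> x1) x2) x = x"
    using tensor_lift_Delta[OF is_vspace_H] by simp
  then show ?thesis
    using lin_SW[OF assms, of "\<lambda>a b. scale (\<epsilon> a) b" x] by (simp add: lin_scale[OF assms])
qed

lemma SW_counit_right:
  assumes "lk f"
  shows "SW (\<lambda>a b. \<epsilon> b * f a) x = f x"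
proof -
  have "tensor_lift H H H (\<lambda>x1 x2. scale (\<epsilon> x2) x1) (\<Delta> x) = x"
    using coalgebra_H by (simp add: coalgebra_def)
  moreover have "bilinear_map H H H (\<lambda>x1 x2. scale (\<epsilon> x2) x1)"
    by (intro bilinear_mapI) (auto simp: linear_map_iff_lin intro!: lin_intros)
  ultimately have "SW (\<lambda>x1 x2. scale (\<epsilon> x2) x1) x = x"
    using tensor_lift_Delta[OF is_vspace_H] by simp
  then show ?thesis
    using lin_SW[OF assms, of "\<lambda>a b. scale (\<epsilon> b) a" x] by (simp add: lin_scale[OF assms])
qed

text \<open>Iterated coproducts are usually bracketed to the right. A pair that cancels in the last
  two places can be replaced where it stands, whereas the first two legs must be brought into one
  sum by coassociativity; hence the trilinearity conditions.\<close>

lemma SW_contract_left: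
  assumes "\<And>b c. lk (\<lambda>a. B a b c)" "\<And>a c. lk (\<lambda>b. B a b c)" "\<And>a b. lk (\<lambda>c. B a b c)" "lk B'"
    and "\<And>w c. SW (\<lambda>a b. B a b c) w = \<epsilon> w * B' c"
  shows "SW (\<lambda>a r. SW (\<lambda>b c. B a b c) r) x = B' x"
  unfolding SW_coassoc[OF assms(1-3), symmetric] assms(5) by (rule SW_counit_left[OF assms(4)])

lemma SW_contract_right:
  assumes "lk B'" "\<And>w a. SW (\<lambda>b c. B a b c) w = \<epsilon> w * B' a"
  shows "SW (\<lambda>a r. SW (\<lambda>b c. B a b c) r) x = B' x"
  unfolding assms(2) by (rule SW_counit_right[OF assms(1)])

lemma SW_antipode_left:
  assumes "lk f"
  shows "SW (\<lambda>a b. f (S a * b)) x = \<epsilon> x * f 1"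
proof -
  have "bilinear_map H H H (\<lambda>a b. S a * b)"
    by (intro bilinear_mapI) (auto simp: linear_map_iff_lin intro!: lin_intros)
  then have "SW (\<lambda>a b. S a * b) x = scale (\<epsilon> x) 1"
    using antipode_left[of x] tensor_lift_Delta[OF is_vspace_H] by (simp add: H_def)
  then show ?thesis using lin_SW[OF assms, of "\<lambda>a b. S a * b" x] by (simp add: lin_scale[OF assms])
qed

lemma SW_antipode_right:
  assumes "lk f"
  shows "SW (\<lambda>a b. f (a * S b)) x = \<epsilon> x * f 1"
proof -
  have "bilinear_map H H H (\<lambda>a b. a * S b)"
    by (intro bilinear_mapI) (auto simp: linear_map_iff_lin intro!: lin_intros)
  then have "SW (\<lambda>a b. a * S b) x = scale (\<epsilon> x) 1"
    using antipode_right[of x] tensor_lift_Delta[OF is_vspace_H] by (simp add: H_def)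
  then show ?thesis using lin_SW[OF assms, of "\<lambda>a b. a * S b" x] by (simp add: lin_scale[OF assms])
qed

lemma SW_one:
  assumes "\<And>a. lk (B a)" "\<And>b. lk (\<lambda>a. B a b)"
  shows "SW B 1 = B 1 1"
  using comult_one Delta_apply[OF assms, of 1] pure_apply[OF bilinear_mapI_lk[OF assms]]
  unfolding Let_def H_def[symmetric] by simp

lemma SW_mult:
  assumes "\<And>a. lk (B a)" "\<And>b. lk (\<lambda>a. B a b)"
  shows "SW B (x * y) = SW (\<lambda>x1 x2. SW (\<lambda>y1 y2. B (x1 * y1) (x2 * y2)) y) x"
proof -
  note lin = assms[THEN lin_comp] lin_intros
  let ?HH = "tensor_space H H"
  have vs: "is_vspace ?HH" by (rule is_vspace_tensor_space)
  note lm = linear_map_comp[OF _ bilinear_map_left[OF pure_bilinear], where V=H]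
    linear_map_comp[OF _ bilinear_map_right[OF pure_bilinear], where V=H]
  have mul: "linear_map H H (\<lambda>b. a * b)" "linear_map H H (\<lambda>b. b * a)" for a
    by (auto simp: linear_map_iff_lin intro!: lin_intros)
  have inner: "tensor_lift H H ?HH (\<lambda>y1 y2. pure H H (x1 * y1) (x2 * y2)) (\<Delta> y) =
      SW (\<lambda>y1 y2. pure H H (x1 * y1) (x2 * y2)) y" for x1 x2
    by (intro tensor_lift_Delta vs bilinear_mapI lm mul) auto
  have "\<Delta> (x * y) = SW (\<lambda>x1 x2. SW (\<lambda>y1 y2. pure H H (x1 * y1) (x2 * y2)) y) x"
    unfolding comult_mult[of x y, folded H_def, unfolded Let_def] inner
    by (intro tensor_lift_Delta vs bilinear_mapI) (unfold SW_def, (intro linear_map_sum_fun vs lm mul; simp)+)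
  then have "\<Delta> (x * y) B = SW (\<lambda>x1 x2. SW (\<lambda>y1 y2. B (x1 * y1) (x2 * y2)) y) x"
    by (simp add: SW_def sum_fun_apply pure_apply[OF bilinear_mapI_lk[OF assms]])
  then show ?thesis by (simp add: Delta_apply[OF assms])
qed

subsection \<open>The antipode\<close>

lemma S_one: "S 1 = 1"
proof (rule lk_separates)
  fix f :: "'h \<Rightarrow> 'k" assume f: "lk f"
  note L = lin_intros lin_comp[OF f]
  have "SW (\<lambda>a b. f (S a * b)) 1 = f (S 1 * 1)"
    by (rule SW_one) (intro L)+
  then show "f (S 1) = f 1"
    using SW_antipode_left[OF f, of 1] by (simp add: counit_one)
qed

lemma counit_S: "\<epsilon> (S x) = \<epsilon> x"
proof -
  have "\<epsilon> x = SW (\<lambda>a b. \<epsilon> (S a * b)) x"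
    by (simp add: SW_antipode_left[OF lk_counit] counit_one)
  also have "\<dots> = SW (\<lambda>a b. \<epsilon> b * \<epsilon> (S a)) x" by (simp add: counit_mult mult.commute)
  also have "\<dots> = \<epsilon> (S x)" by (rule SW_counit_right) (intro lin_intros)
  finally show ?thesis ..
qed

text \<open>Convolution inverses are unique: S(y) S(x) and S(x y), as maps from H \<otimes> H to H,
  both invert the multiplication. \<open>?E\<close> is the convolution of the three, contracted once
  from the right and once from the left.\<close>

lemma S_mult: "S (x * y) = S y * S x"
proof (rule lk_separates)
  fix f :: "'h \<Rightarrow> 'k" assume f: "lk f"
  note L = lin_intros lin_comp[OF f]
  let ?E = "SW (\<lambda>x1 xr. SW (\<lambda>x2 x3. SW (\<lambda>y1 yr. SW (\<lambda>y2 y3.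
    f (S y1 * S x1 * (x2 * y2) * S (x3 * y3))) yr) y) xr) x"
  have E: "?E = SW (\<lambda>x1 xr. SW (\<lambda>y1 yr. SW (\<lambda>x2 x3. SW (\<lambda>y2 y3.
    f (S y1 * S x1 * (x2 * y2) * S (x3 * y3))) yr) xr) y) x"
    by (subst SW_swap) rule
  have inner: "SW (\<lambda>x2 x3. SW (\<lambda>y2 y3. f (c * (x2 * y2) * S (x3 * y3))) yr) xr = \<epsilon> xr * \<epsilon> yr * f c"
    for c xr yr
  proof -
    have "SW (\<lambda>x2 x3. SW (\<lambda>y2 y3. f (c * (x2 * y2) * S (x3 * y3))) yr) xr =
        SW (\<lambda>a b. f (c * a * S b)) (xr * yr)"
      by (rule SW_mult[symmetric]) (intro L)+
    also have "\<dots> = SW (\<lambda>a b. f (c * (a * S b))) (xr * yr)" by (simp add: mult.assoc)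
    also have "\<dots> = \<epsilon> (xr * yr) * f (c * 1)" by (rule SW_antipode_right) (intro L)
    finally show ?thesis by (simp add: counit_mult)
  qed
  have y: "SW (\<lambda>y1 yr. \<epsilon> xr * \<epsilon> yr * f (S y1 * S x1)) y = \<epsilon> xr * f (S y * S x1)" for x1 xr
  proof -
    have "SW (\<lambda>y1 yr. \<epsilon> yr * f (S y1 * S x1)) y = f (S y * S x1)"
      by (rule SW_counit_right) (intro L)
    then show ?thesis by (simp add: mult.assoc SW_mult_right[symmetric])
  qed
  have "?E = f (S y * S x)"
    unfolding E inner y by (rule SW_counit_right) (intro L)
  moreover have "?E = SW (\<lambda>y1 yr. SW (\<lambda>y2 y3. f (S y1 * y2 * S (x * y3))) yr) y"
  proof (rule SW_contract_left)
    fix w x3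
    have *: "SW (\<lambda>x1 x2. f (S y1 * S x1 * (x2 * y2) * S (x3 * y3))) w =
        \<epsilon> w * f (S y1 * y2 * S (x3 * y3))" for y1 y2 y3
    proof -
      have "SW (\<lambda>x1 x2. f (S y1 * (S x1 * x2) * y2 * S (x3 * y3))) w =
          \<epsilon> w * f (S y1 * 1 * y2 * S (x3 * y3))"
        by (rule SW_antipode_left) (intro L)
      then show ?thesis by (simp add: mult.assoc)
    qed
    show "SW (\<lambda>x1 x2. SW (\<lambda>y1 yr. SW (\<lambda>y2 y3. f (S y1 * S x1 * (x2 * y2) * S (x3 * y3))) yr) y) w =
      \<epsilon> w * SW (\<lambda>y1 yr. SW (\<lambda>y2 y3. f (S y1 * y2 * S (x3 * y3))) yr) y"
      by (subst SW_swap, subst SW_swap) (simp only: * SW_mult_right)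
  qed (intro L)+
  moreover have "\<dots> = f (S (x * y))"
  proof (rule SW_contract_left)
    fix w y3
    have "SW (\<lambda>y1 y2. f (S y1 * y2 * S (x * y3))) w = \<epsilon> w * f (1 * S (x * y3))"
      by (rule SW_antipode_left) (intro L)
    then show "SW (\<lambda>y1 y2. f (S y1 * y2 * S (x * y3))) w = \<epsilon> w * f (S (x * y3))" by simp
  qed (intro L)+
  ultimately show "f (S (x * y)) = f (S y * S x)" by simp
qed

text \<open>S reverses the coproduct. Again this is uniqueness of convolution inverses, now for maps
  from H to H \<otimes> H: both \<Delta>(S x) and S(x_2) \<otimes> S(x_1) invert \<Delta>.\<close>

lemma SW_S:
  assumes "\<And>a. lk (B a)" "\<And>b. lk (\<lambda>a. B a b)"
  shows "SW B (S x) = SW (\<lambda>a b. B (S b) (S a)) x"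
proof -
  note L = lin_intros lin_comp[OF assms(1)] lin_comp[OF assms(2)]
  \<comment> \<open>\<open>?K\<close> tests \<Delta>(S x_1) \<Delta>(x_2) (S(x_4) \<otimes> S(x_3))
    by B, where r is split into x_3 and x_4. Cancelling the last two factors leaves \<Delta>(S x);
    cancelling the first two leaves S(x_2) \<otimes> S(x_1).\<close>
  let ?K = "\<lambda>x1 x2 r. SW (\<lambda>p q. SW (\<lambda>u v. SW (\<lambda>x3 x4. B (p * u * S x4) (q * v * S x3)) r) x2) (S x1)"
  have "SW (\<lambda>x2 r. ?K x1 x2 r) r' = \<epsilon> r' * SW B (S x1)" for x1 r'
  proof -
    have "SW (\<lambda>x2 r. SW (\<lambda>u v. SW (\<lambda>x3 x4. B (p * u * S x4) (q * v * S x3)) r) x2) r' =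
        \<epsilon> r' * B p q" for p q
    proof -
      have "SW (\<lambda>x2 r. SW (\<lambda>u v. SW (\<lambda>x3 x4. B (p * u * S x4) (q * v * S x3)) r) x2) r' =
          SW (\<lambda>u s. SW (\<lambda>v r. SW (\<lambda>x3 x4. B (p * u * S x4) (q * v * S x3)) r) s) r'"
        by (rule SW_coassoc) (intro L)+
      also have "\<dots> = SW (\<lambda>u s. B (p * u * S s) q) r'"
      proof -
        have "SW (\<lambda>v r. SW (\<lambda>x3 x4. B (p * u * S x4) (q * v * S x3)) r) s = B (p * u * S s) q"
          for u s
        proof (rule SW_contract_left)
          fix w x4
          have "SW (\<lambda>v x3. B (p * u * S x4) (q * (v * S x3))) w = \<epsilon> w * B (p * u * S x4) (q * 1)"
            by (rule SW_antipode_right) (intro L)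
          then show "SW (\<lambda>v x3. B (p * u * S x4) (q * v * S x3)) w = \<epsilon> w * B (p * u * S x4) q"
            by (simp add: mult.assoc)
        qed (intro L)+
        then show ?thesis by simp
      qed
      also have "\<dots> = SW (\<lambda>u s. B (p * (u * S s)) q) r'" by (simp add: mult.assoc)
      also have "\<dots> = \<epsilon> r' * B (p * 1) q"
        by (rule SW_antipode_right) (intro L)
      finally show ?thesis by simp
    qed
    note * = this
    show ?thesis by (subst SW_swap) (simp only: * SW_mult_right)
  qed
  then have "SW (\<lambda>x1 r'. SW (\<lambda>x2 r. ?K x1 x2 r) r') x = SW (\<lambda>x1 r'. \<epsilon> r' * SW B (S x1)) x"
    by simp
  also have "\<dots> = SW B (S x)"
    by (rule SW_counit_right) (intro L)
  finally have 1: "SW (\<lambda>x1 r'. SW (\<lambda>x2 r. ?K x1 x2 r) r') x = SW B (S x)" .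
  have "SW (\<lambda>x1 r'. SW (\<lambda>x2 r. ?K x1 x2 r) r') x = SW (\<lambda>a b. B (S b) (S a)) x"
  proof (rule SW_contract_left)
    fix w r
    let ?C = "\<lambda>a b. SW (\<lambda>x3 x4. B (a * S x4) (b * S x3)) r"
    have "SW (\<lambda>x1 x2. ?K x1 x2 r) w = SW (\<lambda>x1 x2. SW ?C (S x1 * x2)) w"
      by (subst SW_mult) (intro L | rule refl)+
    also have "\<dots> = \<epsilon> w * SW ?C 1"
      by (rule SW_antipode_left) (intro L)
    also have "SW ?C 1 = ?C 1 1"
      by (rule SW_one) (intro L)+
    finally show "SW (\<lambda>x1 x2. ?K x1 x2 r) w = \<epsilon> w * SW (\<lambda>a b. B (S b) (S a)) r" by simp
  qed (intro L)+
  with 1 show ?thesis by simp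
qed

section \<open>Left integrals on H and injectivity of the antipode\<close>

text \<open>\<open>integral_of f x\<close> is the trace of the operator \<open>y \<mapsto> x\<^sub>1 S\<^sup>2(y\<^sub>1) f(x\<^sub>2 S\<^sup>2(y\<^sub>2))\<close>; it is the
  projection of the Hopf module \<open>H\<^sup>*\<close> of Larson and Sweedler onto its coinvariants.\<close>

definition integral_of :: "('h \<Rightarrow> 'k) \<Rightarrow> 'h \<Rightarrow> 'k"
  where "integral_of f x = (\<Sum>i\<in>Basis. SW (\<lambda>u v. dual_basis i u * f v) (x * S (S i)))"

lemma lk_integral_of:
  assumes "lk f"
  shows "lk (integral_of f)"
  unfolding integral_of_def by (intro lin_intros lin_comp[OF assms])

text \<open>As an identity in H \<otimes> H: since S reverses the coproduct, the right side is x_1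
  S(y_2) y_3 \<otimes> x_2 S(y_1), and the pair S(y_2) y_3 cancels. It moves a factor S y from the
  second leg into the element that is split.\<close>

lemma SW_shift_S:
  assumes "lk g" "lk \<phi>"
  shows "SW (\<lambda>a b. g a * \<phi> (b * S y)) x = SW (\<lambda>y1 y2. SW (\<lambda>a b. g (a * y2) * \<phi> b) (x * S y1)) y"
proof -
  note L = lin_intros lin_comp[OF assms(1)] lin_comp[OF assms(2)]
  have "SW (\<lambda>a b. g (a * y2) * \<phi> b) (x * S y1) =
      SW (\<lambda>c d. SW (\<lambda>a b. g (a * S d * y2) * \<phi> (b * S c)) x) y1" for y1 y2
  proof -
    have "SW (\<lambda>a b. g (a * y2) * \<phi> b) (x * S y1) =
        SW (\<lambda>a b. SW (\<lambda>d c. g (a * d * y2) * \<phi> (b * c)) (S y1)) x"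
      by (rule SW_mult) (intro L)+
    also have "\<dots> = SW (\<lambda>a b. SW (\<lambda>c d. g (a * S d * y2) * \<phi> (b * S c)) y1) x"
      by (subst SW_S) (intro L | rule refl)+
    finally show ?thesis by (subst SW_swap)
  qed
  then have "SW (\<lambda>y1 y2. SW (\<lambda>a b. g (a * y2) * \<phi> b) (x * S y1)) y =
      SW (\<lambda>y1 y2. SW (\<lambda>c d. SW (\<lambda>a b. g (a * S d * y2) * \<phi> (b * S c)) x) y1) y"
    by simp
  also have "\<dots> = SW (\<lambda>c r. SW (\<lambda>d y2. SW (\<lambda>a b. g (a * S d * y2) * \<phi> (b * S c)) x) r) y"
    by (rule SW_coassoc) (intro L)+
  also have "\<dots> = SW (\<lambda>a b. g a * \<phi> (b * S y)) x"
  proof (rule SW_contract_right)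
    fix w c
    have *: "SW (\<lambda>d y2. g (a * S d * y2) * \<phi> (b * S c)) w = \<epsilon> w * (g a * \<phi> (b * S c))" for a b
    proof -
      have "SW (\<lambda>d y2. g (a * (S d * y2)) * \<phi> (b * S c)) w = \<epsilon> w * (g (a * 1) * \<phi> (b * S c))"
        by (rule SW_antipode_left) (intro L)
      then show ?thesis by (simp add: mult.assoc)
    qed
    show "SW (\<lambda>d y2. SW (\<lambda>a b. g (a * S d * y2) * \<phi> (b * S c)) x) w =
        \<epsilon> w * SW (\<lambda>a b. g a * \<phi> (b * S c)) x"
      by (subst SW_swap) (simp only: * SW_mult_right)
  qed (intro L)
  finally show ?thesis ..
qed

text \<open>In terms of convolution, g * I = g(1) I for I = \<open>integral_of f\<close>, so I is a
  left integral in the dual of H. After the shift by \<open>SW_shift_S\<close>, turning the trace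
  around produces a leg p for which a S(p) cancels.\<close>

lemma SW_integral_of:
  assumes "lk f" "lk g"
  shows "SW (\<lambda>a b. g a * integral_of f b) x = g 1 * integral_of f x"
proof -
  note L = lin_intros lin_comp[OF assms(1)] lin_comp[OF assms(2)]
  let ?\<phi> = "\<lambda>i z. SW (\<lambda>u v. dual_basis i u * f v) z"
  have "SW (\<lambda>a b. g a * integral_of f b) x = (\<Sum>i\<in>Basis. SW (\<lambda>a b. g a * ?\<phi> i (b * S (S i))) x)"
    by (simp add: integral_of_def sum_distrib_left SW_sum)
  also have "\<dots> = (\<Sum>i\<in>Basis. SW (\<lambda>p q. SW (\<lambda>a b. g (a * S p) * ?\<phi> i b) (x * S (S q))) i)"
  proof (rule sum.cong[OF refl])
    fix i
    have "SW (\<lambda>a b. g a * ?\<phi> i (b * S (S i))) x =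
        SW (\<lambda>y1 y2. SW (\<lambda>a b. g (a * y2) * ?\<phi> i b) (x * S y1)) (S i)" (is "?lhs = _")
      by (rule SW_shift_S) (intro L | rule assms)+
    also have "\<dots> = SW (\<lambda>p q. SW (\<lambda>a b. g (a * S p) * ?\<phi> i b) (x * S (S q))) i"
      by (rule SW_S) (intro L)+
    finally show "?lhs = \<dots>" .
  qed
  \<comment> \<open>Expanding the leg q in a second basis separates it from p. The sum over i can
    then be carried out, and i is replaced by the leg u of \<open>x * S (S j)\<close>. This is the
    cyclic invariance of the trace.\<close>
  also have "\<dots> = (\<Sum>i\<in>Basis. SW (\<lambda>p q. \<Sum>j\<in>Basis. dual_basis j q *
      SW (\<lambda>a b. g (a * S p) * ?\<phi> i b) (x * S (S j))) i)"
    by (subst lin_basis_expansion[where s="(*)"]) (intro L | rule refl)+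
  also have "\<dots> = (\<Sum>j\<in>Basis. \<Sum>i\<in>Basis. SW (\<lambda>p q. dual_basis j q *
      SW (\<lambda>a b. g (a * S p) * ?\<phi> i b) (x * S (S j))) i)"
    unfolding SW_sum by (rule sum.swap)
  also have "\<dots> = (\<Sum>j\<in>Basis. g 1 * ?\<phi> j (x * S (S j)))"
  proof (rule sum.cong[OF refl])
    fix j
    let ?z = "x * S (S j)"
    have "(\<Sum>i\<in>Basis. SW (\<lambda>p q. dual_basis j q * SW (\<lambda>a b. g (a * S p) * ?\<phi> i b) ?z) i) =
        SW (\<lambda>a b. SW (\<lambda>u v. \<Sum>i\<in>Basis. dual_basis i u *
          SW (\<lambda>p q. g (a * S p) * (dual_basis j q * f v)) i) b) ?z" (is "?lhs = _")
    proof -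
      have "SW (\<lambda>p q. dual_basis j q * SW (\<lambda>a b. g (a * S p) * ?\<phi> i b) ?z) i =
          SW (\<lambda>a b. SW (\<lambda>u v. dual_basis i u *
            SW (\<lambda>p q. g (a * S p) * (dual_basis j q * f v)) i) b) ?z" for i
        unfolding SW_mult_right
        by (rule trans[OF SW_swap], rule SW_cong, rule trans[OF SW_swap], intro SW_cong)
          (simp add: mult_ac)
      then show ?thesis by (simp add: SW_sum)
    qed
    also have "\<dots> = SW (\<lambda>a b. SW (\<lambda>u v. SW (\<lambda>p q. g (a * S p) * (dual_basis j q * f v)) u) b) ?z"
      by (subst lin_basis_expansion[where s="(*)"]) (intro L | rule refl)+
    also have "\<dots> = SW (\<lambda>a b. SW (\<lambda>p r. SW (\<lambda>q v. g (a * S p) * (dual_basis j q * f v)) r) b) ?z"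
      by (subst SW_coassoc) (intro L | rule refl)+
    also have "\<dots> = g 1 * ?\<phi> j ?z"
    proof (rule SW_contract_left)
      fix w r
      have *: "SW (\<lambda>a p. g (a * S p) * (dual_basis j q * f v)) w = \<epsilon> w * (g 1 * (dual_basis j q * f v))"
        for q v
        by (rule SW_antipode_right) (intro L)
      show "SW (\<lambda>a p. SW (\<lambda>q v. g (a * S p) * (dual_basis j q * f v)) r) w =
        \<epsilon> w * (g 1 * SW (\<lambda>q v. dual_basis j q * f v) r)"
        by (subst SW_swap) (simp only: * SW_mult_right)
    qed (intro L)+
    finally show "?lhs = \<dots>" .
  qed
  finally show ?thesis by (simp add: integral_of_def sum_distrib_left)
qed

text \<open>The generating half of the Larson-Sweedler decomposition of the dual of H: f is a sum of
  translates x -> I_j(x S(h_j)) of integrals, where I_j is the projection of the convolution h^j *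
  f. Hence a nonzero f yields a nonzero integral.\<close>

lemma integral_of_reconstruct:
  assumes "lk f"
  shows "(\<Sum>j\<in>Basis. integral_of (SW (\<lambda>c d. dual_basis j c * f d)) (x * S j)) = f x"
proof -
  note L = lin_intros lin_comp[OF assms(1)]
  let ?Q = "\<lambda>w i j. SW (\<lambda>r d. SW (\<lambda>u c. dual_basis i u * (dual_basis j c * f d)) r) (x * S w)"
  have "(\<Sum>j\<in>Basis. integral_of (SW (\<lambda>c d. dual_basis j c * f d)) (x * S j)) =
      (\<Sum>j\<in>Basis. \<Sum>i\<in>Basis. ?Q (S i * j) i j)"
    unfolding integral_of_def SW_mult_right
    by (subst SW_coassoc) (intro L | simp add: S_mult mult.assoc)+
  \<comment> \<open>Expanding \<open>S i * j\<close> in a further basis takes i and j out of the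
    element that is split. Their sums against h^i and h^j then turn them into the legs u and c, and
    S(u) c cancels.\<close>
  also have "\<dots> = (\<Sum>j\<in>Basis. \<Sum>i\<in>Basis. \<Sum>e\<in>Basis. dual_basis e (S i * j) * ?Q e i j)"
    by (subst lin_basis_expansion[where s="(*)"]) (intro L | rule refl)+
  also have "\<dots> = (\<Sum>e\<in>Basis. \<Sum>j\<in>Basis. \<Sum>i\<in>Basis. dual_basis e (S i * j) * ?Q e i j)"
    by (rule trans[OF sum.cong[OF refl sum.swap] sum.swap])
  also have "\<dots> = (\<Sum>e\<in>Basis. dual_basis e 1 * f (x * S e))"
  proof (rule sum.cong[OF refl])
    fix e
    have "(\<Sum>j\<in>Basis. \<Sum>i\<in>Basis. dual_basis e (S i * j) * ?Q e i j) =
        SW (\<lambda>r d. SW (\<lambda>u c. \<Sum>j\<in>Basis. dual_basis j c *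
          (\<Sum>i\<in>Basis. dual_basis i u * (dual_basis e (S i * j) * f d))) r) (x * S e)" (is "?lhs = _")
      by (simp add: SW_mult_right SW_sum[symmetric] sum_distrib_left mult_ac)
    also have "\<dots> = SW (\<lambda>r d. SW (\<lambda>u c. dual_basis e (S u * c) * f d) r) (x * S e)"
      by (subst lin_basis_expansion[where s="(*)"] | (intro L | rule refl))+
    also have "\<dots> = SW (\<lambda>r d. \<epsilon> r * (dual_basis e 1 * f d)) (x * S e)"
      by (subst SW_antipode_left) (intro L | rule refl)+
    also have "\<dots> = dual_basis e 1 * f (x * S e)"
      by (rule SW_counit_left) (intro L)
    finally show "?lhs = \<dots>" .
  qed
  also have "\<dots> = f (x * S 1)"
    by (rule lin_basis_expansion) (intro L)
  finally show ?thesis by (simp add: S_one)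
qed

lemma inj_S: "inj S"
proof (rule injI)
  have zero: "h = 0" if h: "S h = 0" for h
  proof (rule ccontr)
    assume "h \<noteq> 0"
    then obtain g where g: "lk g" "g h \<noteq> 0"
      using lk_separates[of h 0] lin_zero by metis
    \<comment> \<open>Were all integrals zero, reconstructing g from them would give g h =
      0.\<close>
    have "\<exists>f x. lk f \<and> integral_of f x \<noteq> 0"
    proof (rule ccontr)
      assume *: "\<nexists>f x. lk f \<and> integral_of f x \<noteq> 0"
      have "lk (SW (\<lambda>c d. dual_basis j c * g d))" for j
        by (intro lin_intros lin_comp[OF g(1)])
      with * have "g h = 0"
        using integral_of_reconstruct[OF g(1), of h] by simp
      with g(2) show False ..
    qed
    then obtain f x where f: "lk f" "integral_of f x \<noteq> 0" by blast
    let ?I = "integral_of f"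
    note L = lin_intros lin_comp[OF lk_integral_of[OF f(1)]] lin_comp[OF g(1)]
    \<comment> \<open>This is I(y S(h_1)) h_2 = 0, tested by k. In \<open>SW_shift_S\<close> the
      left side contains S h = 0, and left invariance of I reduces the right side to this
      sum.\<close>
    have zero: "SW (\<lambda>h1 h2. ?I (y * S h1) * k h2) h = 0" if k: "lk k" for y k
    proof -
      note L = L lin_comp[OF k]
      have "SW (\<lambda>a b. k a * ?I (b * S h)) y =
          SW (\<lambda>y1 y2. SW (\<lambda>a b. k (a * y2) * ?I b) (y * S y1)) h"
        by (intro SW_shift_S k lk_integral_of f(1))
      also have "\<dots> = SW (\<lambda>y1 y2. k (1 * y2) * ?I (y * S y1)) h"
        by (subst SW_integral_of[OF f(1)]) (intro L | rule refl)+
      finally show ?thesis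
        using lin_zero[OF lk_integral_of[OF f(1)]] by (simp add: h SW_def mult.commute)
    qed
    \<comment> \<open>The aim is to put x S^2(h_2) for y, because S^2(h_2) S(h_1) = S(h_1 S(h_2))
      cancels and leaves I(x) h. As y has to be constant, the leg h_2 is first expanded in the
      basis.\<close>
    let ?E = "SW (\<lambda>h1 r. SW (\<lambda>h2 h3. ?I (x * S (S h2) * S h1) * g h3) r) h"
    have "?E = SW (\<lambda>h1 r. SW (\<lambda>h2 h3. \<Sum>e\<in>Basis. dual_basis e h2 *
        (?I (x * S (S e) * S h1) * g h3)) r) h"
      by (subst lin_basis_expansion[where s="(*)"]) (intro L | rule refl)+
    also have "\<dots> = (\<Sum>e\<in>Basis. SW (\<lambda>h1 r. ?I (x * S (S e) * S h1) *
        SW (\<lambda>h2 h3. dual_basis e h2 * g h3) r) h)"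
      by (simp add: SW_sum SW_mult_right mult_ac)
    also have "\<dots> = 0"
      by (intro sum.neutral ballI zero L)
    finally have "?E = 0" .
    moreover have "?E = ?I x * g h"
    proof (rule SW_contract_left)
      fix w c
      have "SW (\<lambda>a b. ?I (x * S (a * S b)) * g c) w = \<epsilon> w * (?I (x * S 1) * g c)"
        by (rule SW_antipode_right) (intro L)
      then show "SW (\<lambda>a b. ?I (x * S (S b) * S a) * g c) w = \<epsilon> w * (?I x * g c)"
        by (simp add: S_mult S_one mult.assoc)
    qed (intro L)+
    ultimately show False using f(2) g(2) by simp
  qed
  fix x y assume "S x = S y"
  then have "S (x - y) = 0"
    using lin_add[OF lh_S, of "x - y" y] by simp
  then have "x - y = 0" by (rule zero)
  then show "x = y" by simp
qed

section \<open>The inverse of the antipode\<close>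

lemma bij_S: "bij S"
  using inj_S linear_inj_imp_surj[OF antipode_linear inj_S] by (simp add: bij_def)

lemma S_S_inv [simp]: "S (S_inv x) = x"
  and S_inv_S [simp]: "S_inv (S x) = x"
  using bij_S by (simp_all add: S_inv_def bij_def surj_f_inv_f)

lemma S_inv_eqI: "S y = x \<Longrightarrow> S_inv x = y"
  by auto

lemma lh_S_inv: "lh S_inv"
  by (intro linI S_inv_eqI) (simp_all add: lin_add[OF lh_S] lin_scale[OF lh_S])

lemmas lin_intros' = lin_intros lin_comp[OF lh_S_inv]

lemma S_inv_one: "S_inv 1 = 1"
  by (rule S_inv_eqI) (rule S_one)

lemma S_inv_mult: "S_inv (x * y) = S_inv y * S_inv x"
  by (rule S_inv_eqI) (simp add: S_mult)

lemma counit_S_inv: "\<epsilon> (S_inv x) = \<epsilon> x"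
  using counit_S[of "S_inv x"] by simp

lemma SW_S_inv:
  assumes "\<And>a. lk (B a)" "\<And>b. lk (\<lambda>a. B a b)"
  shows "SW B (S_inv x) = SW (\<lambda>a b. B (S_inv b) (S_inv a)) x"
proof -
  note L = lin_intros' lin_comp[OF assms(1)] lin_comp[OF assms(2)]
  have "SW (\<lambda>a b. B (S_inv b) (S_inv a)) (S (S_inv x)) = SW B (S_inv x)"
    by (subst SW_S) (intro L | simp)+
  then show ?thesis by simp
qed

text \<open>\<open>S_inv\<close> applied to the antipode axiom S(x_1) x_2 = \<epsilon>(x); being an
  antihomomorphism, it exchanges the two legs in the product.\<close>

lemma SW_S_inv_left:
  assumes "lk f"
  shows "SW (\<lambda>a b. f (S_inv b * a)) x = \<epsilon> x * f 1"
proof -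
  have "SW (\<lambda>a b. f (S_inv (S a * b))) x = \<epsilon> x * f (S_inv 1)"
    by (rule SW_antipode_left) (intro lin_intros' lin_comp[OF assms])
  then show ?thesis by (simp add: S_inv_mult S_inv_one)
qed

lemma SW_S_inv_right:
  assumes "lk f"
  shows "SW (\<lambda>a b. f (b * S_inv a)) x = \<epsilon> x * f 1"
proof -
  have "SW (\<lambda>a b. f (S_inv (a * S b))) x = \<epsilon> x * f (S_inv 1)"
    by (rule SW_antipode_right) (intro lin_intros' lin_comp[OF assms])
  then show ?thesis by (simp add: S_inv_mult S_inv_one)
qed

subsection \<open>Hopf algebra automorphisms\<close>

text \<open>Restates compatibility with \<Delta> as a rule for Sweedler sums. For the converse it
  suffices to test with products of dual basis functions, which are coordinates on H \<otimes>
  H.\<close>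

lemma comult_hom_iff:
  assumes "lh f"
  shows "\<Delta> (f x) = tensor_lift H H (tensor_space H H) (\<lambda>x1 x2. pure H H (f x1) (f x2)) (\<Delta> x) \<longleftrightarrow>
    (\<forall>B. (\<forall>a. lk (B a)) \<longrightarrow> (\<forall>b. lk (\<lambda>a. B a b)) \<longrightarrow> SW B (f x) = SW (\<lambda>a b. B (f a) (f b)) x)"
    (is "_ = ?R \<longleftrightarrow> ?E")
proof -
  have f: "linear_map H H f" using assms by (simp add: linear_map_iff_lin)
  have bil: "bilinear_map H H (tensor_space H H) (\<lambda>x1 x2. pure H H (f x1) (f x2))"
    by (rule bilinear_map_pre[OF pure_bilinear f f])
  have R: "?R B = SW (\<lambda>a b. B (f a) (f b)) x" if "\<And>a. lk (B a)" "\<And>b. lk (\<lambda>a. B a b)" for B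
    unfolding tensor_lift_Delta[OF is_vspace_tensor_space bil]
    by (simp add: SW_def sum_fun_apply pure_apply[OF bilinear_mapI_lk[OF that]])
  show ?thesis
  proof
    assume *: "\<Delta> (f x) = ?R"
    show ?E
      using R Delta_apply[of _ "f x"] unfolding * by fastforce
  next
    assume E: ?E
    show "\<Delta> (f x) = ?R"
    proof (rule coord_system_eqI[OF coord_system_tensor[OF coord_system_H coord_system_H] Delta_closed])
      show "?R \<in> carrier (tensor_space H H)"
        by (rule linear_map_closed[OF tensor_lift_linear[OF is_vspace_tensor_space bil] Delta_closed])
      fix ij
      have l: "lk (\<lambda>w. dual_basis i v * dual_basis j w)" "lk (\<lambda>v. dual_basis i v * dual_basis j w)"
        for i j v w by (intro lin_intros)+
      show "(case ij of (i, j) \<Rightarrow> \<lambda>t. t (\<lambda>v w. dual_basis i v * dual_basis j w)) (\<Delta> (f x)) =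
          (case ij of (i, j) \<Rightarrow> \<lambda>t. t (\<lambda>v w. dual_basis i v * dual_basis j w)) ?R"
        using E l by (simp add: Delta_apply R split: prod.split)
    qed
  qed
qed

lemma
  assumes "f \<in> Aut_Hopf"
  shows Aut_bij: "bij f" and lh_Aut: "lh f" and Aut_mult: "f (x * y) = f x * f y"
    and Aut_one: "f 1 = 1" and Aut_counit: "\<epsilon> (f x) = \<epsilon> x" and Aut_S: "f (S x) = S (f x)"
    and Aut_inv: "f (inv_into UNIV f x) = x" and Aut_inv': "inv_into UNIV f (f x) = x"
    and Aut_S_inv: "f (S_inv x) = S_inv (f x)"
    and SW_Aut: "\<lbrakk>\<And>a. lk (B a); \<And>b. lk (\<lambda>a. B a b)\<rbrakk> \<Longrightarrow> SW B (f x) = SW (\<lambda>a b. B (f a) (f b)) x"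
proof -
  interpret f: Vector_Spaces.linear scale scale f
    using assms by (simp add: Aut_Hopf_def)
  show lh: "lh f" by (intro linI) (simp_all add: f.add f.scale)
  show b: "bij f" "f (x * y) = f x * f y" "f 1 = 1" "\<epsilon> (f x) = \<epsilon> x" and S: "f (S x) = S (f x)" for x
    using assms by (simp_all add: Aut_Hopf_def)
  show "f (inv_into UNIV f x) = x" "inv_into UNIV f (f x) = x"
    using b(1) by (simp_all add: bij_def surj_f_inv_f)
  show "f (S_inv x) = S_inv (f x)"
    using S[of "S_inv x"] by (metis S_S_inv S_inv_S)
  show "\<lbrakk>\<And>a. lk (B a); \<And>b. lk (\<lambda>a. B a b)\<rbrakk> \<Longrightarrow> SW B (f x) = SW (\<lambda>a b. B (f a) (f b)) x"
    using assms comult_hom_iff[OF lh, of x] by (simp add: Aut_Hopf_def)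
qed

lemma Aut_HopfI:
  assumes "bij f" "lh f" "\<And>x y. f (x * y) = f x * f y" "f 1 = 1" "\<And>x. \<epsilon> (f x) = \<epsilon> x"
    "\<And>x. f (S x) = S (f x)"
    "\<And>B x. \<lbrakk>\<And>a. lk (B a); \<And>b. lk (\<lambda>a. B a b)\<rbrakk> \<Longrightarrow> SW B (f x) = SW (\<lambda>a b. B (f a) (f b)) x"
  shows "f \<in> Aut_Hopf"
proof -
  have "Vector_Spaces.linear scale scale f"
    by (intro Vector_Spaces.linear.intro module_hom.intro module_hom_axioms.intro vector_space_axioms
        module_axioms) (simp_all add: lin_add[OF assms(2)] lin_scale[OF assms(2)])
  with assms show ?thesis by (auto simp: Aut_Hopf_def comult_hom_iff)
qed

lemma id_Aut: "id \<in> Aut_Hopf"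
  by (rule Aut_HopfI) (auto simp: lin_def)

lemma comp_Aut:
  assumes "f \<in> Aut_Hopf" "g \<in> Aut_Hopf"
  shows "f \<circ> g \<in> Aut_Hopf"
proof (rule Aut_HopfI)
  fix B :: "'h \<Rightarrow> 'h \<Rightarrow> 'k" and x assume B: "\<And>a. lk (B a)" "\<And>b. lk (\<lambda>a. B a b)"
  note L = lin_intros lin_comp[OF B(1)] lin_comp[OF B(2)] lin_comp[OF lh_Aut[OF assms(1)]]
  show "SW B ((f \<circ> g) x) = SW (\<lambda>a b. B ((f \<circ> g) a) ((f \<circ> g) b)) x"
    unfolding o_apply
    by (subst SW_Aut[OF assms(1)], (intro L)+, subst SW_Aut[OF assms(2)], (intro L)+, rule refl)
next
  show "lh (f \<circ> g)"
    using lin_comp[OF lh_Aut[OF assms(1)] lh_Aut[OF assms(2)]] by (simp add: o_def)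
qed (use assms in \<open>simp_all add: bij_comp Aut_bij Aut_mult Aut_one Aut_counit Aut_S\<close>)

lemma inv_Aut:
  assumes "f \<in> Aut_Hopf"
  shows "inv_into UNIV f \<in> Aut_Hopf" (is "?g \<in> _")
proof (rule Aut_HopfI)
  note [simp] = Aut_inv[OF assms] Aut_inv'[OF assms]
  have eq: "?g x = y" if "x = f y" for x y
    using that by simp
  show lg: "lh ?g"
    by (intro linI eq) (simp_all add: lin_add[OF lh_Aut[OF assms]] lin_scale[OF lh_Aut[OF assms]])
  show "bij ?g" by (rule bij_imp_bij_inv[OF Aut_bij[OF assms]])
  show "?g 1 = 1" "?g (x * y) = ?g x * ?g y" "?g (S x) = S (?g x)" for x y
    by (auto intro: eq simp: Aut_one[OF assms] Aut_mult[OF assms] Aut_S[OF assms])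
  show "\<epsilon> (?g x) = \<epsilon> x" for x
    using Aut_counit[OF assms, of "?g x"] by simp
  fix B :: "'h \<Rightarrow> 'h \<Rightarrow> 'k" and x assume B: "\<And>a. lk (B a)" "\<And>b. lk (\<lambda>a. B a b)"
  have "SW (\<lambda>a b. B (?g a) (?g b)) (f (?g x)) = SW (\<lambda>a b. B (?g (f a)) (?g (f b))) (?g x)"
    by (rule SW_Aut[OF assms]) (intro lin_comp[OF B(1) lg] lin_comp[OF B(2) lg])+
  then show "SW B (?g x) = SW (\<lambda>a b. B (?g a) (?g b)) x" by simp
qed

lemma inv_comp_Aut:
  assumes "f \<in> Aut_Hopf" "g \<in> Aut_Hopf"
  shows "inv_into UNIV (f \<circ> g) = inv_into UNIV g \<circ> inv_into UNIV f"
  by (rule o_inv_distrib[OF Aut_bij[OF assms(1)] Aut_bij[OF assms(2)]])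

lemma inv_inv_Aut: "f \<in> Aut_Hopf \<Longrightarrow> inv_into UNIV (inv_into UNIV f) = f"
  by (rule inv_inv_eq[OF Aut_bij])

lemmas Aut_closed = id_Aut comp_Aut inv_Aut
lemmas Aut_simps = Aut_inv Aut_inv' inv_comp_Aut inv_inv_Aut

section \<open>The group of pairs of automorphisms\<close>

lemma carrier_G: "carrier G = Aut_Hopf \<times> Aut_Hopf"
  by (simp add: G_def)

lemma mult_G: "(\<alpha>, \<beta>) \<otimes>\<^bsub>G\<^esub> (\<gamma>, \<delta>) = (\<delta> \<circ> \<alpha> \<circ> inv_into UNIV \<delta> \<circ> \<gamma>, \<delta> \<circ> \<beta>)"
  by (simp add: G_def)

lemma one_G: "\<one>\<^bsub>G\<^esub> = (id, id)"
  by (simp add: G_def)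

lemma group_G: "group G"
proof (rule groupI)
  fix x y assume "x \<in> carrier G" "y \<in> carrier G"
  then show "x \<otimes>\<^bsub>G\<^esub> y \<in> carrier G"
    by (cases x; cases y) (simp add: carrier_G mult_G Aut_closed)
next
  fix x y z assume "x \<in> carrier G" "y \<in> carrier G" "z \<in> carrier G"
  then show "x \<otimes>\<^bsub>G\<^esub> y \<otimes>\<^bsub>G\<^esub> z = x \<otimes>\<^bsub>G\<^esub> (y \<otimes>\<^bsub>G\<^esub> z)"
    by (cases x; cases y; cases z) (simp add: carrier_G mult_G Aut_closed Aut_simps fun_eq_iff)
next
  fix x assume "x \<in> carrier G"
  then show "\<exists>y\<in>carrier G. y \<otimes>\<^bsub>G\<^esub> x = \<one>\<^bsub>G\<^esub>"
  proof (cases x)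
    case (Pair \<alpha> \<beta>)
    with \<open>x \<in> carrier G\<close> show ?thesis
      by (intro bexI[of _ "(inv_into UNIV \<beta> \<circ> inv_into UNIV \<alpha> \<circ> \<beta>, inv_into UNIV \<beta>)"])
        (simp_all add: carrier_G mult_G one_G Aut_closed Aut_simps fun_eq_iff)
  qed
qed (auto simp: carrier_G one_G mult_G Aut_closed Aut_simps fun_eq_iff)

lemma inv_G:
  assumes "\<alpha> \<in> Aut_Hopf" "\<beta> \<in> Aut_Hopf"
  shows "inv\<^bsub>G\<^esub> (\<alpha>, \<beta>) = (inv_into UNIV \<beta> \<circ> inv_into UNIV \<alpha> \<circ> \<beta>, inv_into UNIV \<beta>)"
  by (rule group.inv_equality[OF group_G])
    (use assms in \<open>simp_all add: carrier_G mult_G one_G Aut_closed Aut_simps fun_eq_iff\<close>)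

subsection \<open>The components of \<open>CT(H)\<close> as spaces of linear endomorphisms\<close>

abbreviation "D \<equiv> dual_space H"

lemma is_vspace_D: "is_vspace D"
proof -
  interpret P: vector_space "pscale :: 'k \<Rightarrow> ('h \<Rightarrow> 'k) \<Rightarrow> _" by (rule vector_space_pscale)
  have "P.subspace (carrier D)"
    by (rule P.subspaceI) (auto simp: dual_space_iff_lk lin_def pscale_def algebra_simps)
  then show ?thesis by (simp add: is_vspace_def vector_space_pscale)
qed

lemma dual_basis_D: "dual_basis i \<in> carrier D"
  by (simp add: dual_space_iff_lk lk_dual_basis)

lemma dual_expansion:
  assumes "lk p"
  shows "(\<Sum>i\<in>Basis. p i * dual_basis i x) = p x"
  using lin_basis_expansion[OF assms, of x] by (simp add: mult.commute)

lemma coord_system_D: "coord_system D Basis dual_basis (\<lambda>i p. p i)"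
  using finite_Basis is_vspace_D
  by (auto simp: coord_system_def dual_space_iff_lk lk_dual_basis linear_map_def fun_eq_iff
      pscale_def sum_fun_apply dual_expansion)

lemma convol_eq:
  assumes "lk p" "lk q"
  shows "convol p q x = SW (\<lambda>a b. p a * q b) x"
  unfolding convol_def
  by (rule tensor_lift_Delta[OF is_vspace_scalars bilinear_mapI_lk])
    (intro lin_intros lin_comp[OF assms(1)] lin_comp[OF assms(2)] assms)+

lemma lk_convol:
  assumes "lk p" "lk q"
  shows "lk (convol p q)"
proof -
  have "convol p q = (\<lambda>x. SW (\<lambda>a b. p a * q b) x)" by (intro ext convol_eq assms)
  then show ?thesis by (simp only:) (intro lin_intros lin_comp[OF assms(2)])
qed

text \<open>Expanding y in p(x y) gives the tensor on the right. It is the only one with the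
  required property because evaluation at pairs of basis elements is a coordinate system on the
  tensor square of the dual; this justifies the \<open>THE\<close> in
  \<open>dual_comult\<close>.\<close>

lemma dual_comult_eq:
  assumes "lk p"
  shows "dual_comult p = (\<Sum>i\<in>Basis. pure D D (\<lambda>x. p (x * i)) (dual_basis i))"
proof -
  let ?t = "\<Sum>i\<in>Basis. pure D D (\<lambda>x. p (x * i)) (dual_basis i)"
  let ?B = "\<lambda>x y p q. p x * q y :: 'k"
  have p: "(\<lambda>x. p (x * i)) \<in> carrier D" for i
    unfolding dual_space_iff_lk by (intro lin_intros lin_comp[OF assms])
  have t: "?t \<in> carrier (tensor_space D D)"
    by (intro vs_sum[OF is_vspace_tensor_space] pure_closed p dual_basis_D)
  have ev: "linear_map D scalars (\<lambda>p. p x)" for x :: 'h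
    by (simp add: linear_map_def pscale_def)
  have B: "bilinear_map D D scalars (?B x y)" for x y
    by (rule bilinear_map_mult[OF ev ev])
  have t_apply: "?t (?B x y) = p (x * y)" for x y
  proof -
    have "?t (?B x y) = (\<Sum>i\<in>Basis. dual_basis i y * p (x * i))"
      by (simp add: sum_fun_apply pure_apply[OF B] mult.commute)
    also have "\<dots> = p (x * y)"
      by (rule lin_basis_expansion) (intro lin_intros lin_comp[OF assms])
    finally show ?thesis .
  qed
  show ?thesis
    unfolding dual_comult_def
  proof (rule the_equality)
    show "?t \<in> carrier (tensor_space D D) \<and>
        (\<forall>x y. tensor_lift D D scalars (?B x y) ?t = p (x * y))"
      using t t_apply by (simp add: tensor_lift_scalars[OF is_vspace_D is_vspace_D B])
  next
    fix t assume *: "t \<in> carrier (tensor_space D D) \<and>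
        (\<forall>x y. tensor_lift D D scalars (?B x y) t = p (x * y))"
    then have "t (?B x y) = p (x * y)" for x y
      using tensor_lift_scalars[OF is_vspace_D is_vspace_D B] by metis
    with * t t_apply show "t = ?t"
      by (intro coord_system_eqI[OF coord_system_tensor[OF coord_system_D coord_system_D]]) auto
  qed
qed

lemma tensor_lift_dual_comult:
  assumes "is_vspace X" "bilinear_map D D X B" "lk p"
  shows "tensor_lift D D X B (dual_comult p) = (\<Sum>i\<in>Basis. B (\<lambda>x. p (x * i)) (dual_basis i))"
proof -
  have p: "(\<lambda>x. p (x * i)) \<in> carrier D" for i
    unfolding dual_space_iff_lk by (intro lin_intros lin_comp[OF assms(3)])
  have "tensor_lift D D X B (dual_comult p) =
      (\<Sum>i\<in>Basis. tensor_lift D D X B (pure D D (\<lambda>x. p (x * i)) (dual_basis i)))"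
    unfolding dual_comult_eq[OF assms(3)]
    by (rule linear_map_sum[OF tensor_lift_linear[OF assms(1,2)] is_vspace_tensor_space])
      (intro pure_closed p dual_basis_D)
  then show ?thesis by (simp add: tensor_lift_pure[OF assms(1,2) p dual_basis_D])
qed

abbreviation "CC \<equiv> tensor_space CT_space CT_space"

lemma is_vspace_CT: "is_vspace CT_space"
  unfolding CT_space_def by (rule is_vspace_tensor_space)

lemma is_vspace_CC: "is_vspace CC"
  by (rule is_vspace_tensor_space)

lemma scal_CT [simp]: "scal CT_space = pscale"
  by (simp add: CT_space_def)

text \<open>\<open>CT_fun\<close> sends \<open>p \<bowtie> h\<close> to the endomorphism \<open>x \<mapsto> p(x) h\<close>.\<close>

definition CT_fun :: "('h \<Rightarrow> 'k, 'h, 'k) tensor \<Rightarrow> 'h \<Rightarrow> 'h"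
  where "CT_fun t x = (\<Sum>j\<in>Basis. scale (t (\<lambda>p h. p x * dual_basis j h)) j)"

lemma bilinear_eval:
  assumes "lk f"
  shows "bilinear_map D H scalars (\<lambda>p h. p x * f h)"
  by (rule bilinear_map_mult) (auto simp: linear_map_def pscale_def linear_map_scalars_iff_lk[symmetric]
      assms[THEN lin_add] assms[THEN lin_scale])

text \<open>Relates the two readings of t: testing its endomorphism at x by f amounts to evaluating
  the functional t at one bilinear form.\<close>

lemma lk_CT_fun:
  assumes "t \<in> carrier CT_space" "lk f"
  shows "f (CT_fun t x) = t (\<lambda>p h. p x * f h)"
proof -
  have t: "t \<in> carrier (tensor_space D H)" using assms(1) by (simp add: CT_space_def)
  have "f (CT_fun t x) = (\<Sum>j\<in>Basis. f j * t (\<lambda>p h. p x * dual_basis j h))"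
    unfolding CT_fun_def lin_sum[OF assms(2)] lin_scale[OF assms(2)] by (simp add: mult.commute)
  also have "\<dots> = (\<Sum>j\<in>Basis. t (\<lambda>p h. f j * (p x * dual_basis j h)))"
    by (simp add: tensor_scale[OF t bilinear_eval[OF lk_dual_basis]])
  also have "\<dots> = t (\<lambda>p h. \<Sum>j\<in>Basis. f j * (p x * dual_basis j h))"
  proof (rule tensor_sum[OF t, symmetric])
    fix j
    have "bilinear_map D H scalars (\<lambda>p h. p x * (f j * dual_basis j h))"
      by (rule bilinear_eval) (intro lin_intros)
    then show "bilinear_map D H scalars (\<lambda>p h. f j * (p x * dual_basis j h))"
      by (simp add: mult.left_commute)
  qed
  also have "\<dots> = t (\<lambda>p h. p x * f h)"
  proof -
    have "(\<Sum>j\<in>Basis. f j * (p x * dual_basis j h)) = p x * f h" for p h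
      using dual_expansion[OF assms(2), of h]
      by (simp add: sum_distrib_left[symmetric] mult.left_commute[of _ "p x"])
    then show ?thesis by simp
  qed
  finally show ?thesis .
qed

lemma coord_system_CT:
  "coord_system CT_space (Basis \<times> Basis) (\<lambda>(i, j). pure D H (dual_basis i) j)
    (\<lambda>(i, j) t. t (\<lambda>p h. p i * dual_basis j h))"
  unfolding CT_space_def by (rule coord_system_tensor[OF coord_system_D coord_system_H])

lemma CT_eqI:
  assumes "s \<in> carrier CT_space" "t \<in> carrier CT_space" "\<And>x. CT_fun s x = CT_fun t x"
  shows "s = t"
  by (rule coord_system_eqI[OF coord_system_CT assms(1,2)])
    (use assms in \<open>auto simp: lk_CT_fun[OF _ lk_dual_basis, symmetric]\<close>)

lemma lh_CT_fun:
  assumes "t \<in> carrier CT_space"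
  shows "lh (CT_fun t)"
proof (intro linI lk_separates)
  have t: "t \<in> carrier (tensor_space D H)" using assms by (simp add: CT_space_def)
  fix f :: "'h \<Rightarrow> 'k" and x y and c :: 'k assume f: "lk f"
  have "t (\<lambda>p h. p (x + y) * f h) = t (\<lambda>p h. p x * f h + p y * f h)"
    by (rule tensor_cong[OF t is_vspace_D is_vspace_H])
      (simp add: dual_space_iff_lk lin_add distrib_right)
  then show "f (CT_fun t (x + y)) = f (CT_fun t x + CT_fun t y)"
    by (simp add: lin_add[OF f] lk_CT_fun[OF assms f] tensor_add[OF t bilinear_eval bilinear_eval] f)
  have "t (\<lambda>p h. p (scale c x) * f h) = t (\<lambda>p h. c * (p x * f h))"
    by (rule tensor_cong[OF t is_vspace_D is_vspace_H])
      (simp add: dual_space_iff_lk lin_scale mult.assoc)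
  then show "f (CT_fun t (scale c x)) = f (scale c (CT_fun t x))"
    by (simp add: lin_scale[OF f] lk_CT_fun[OF assms f] tensor_scale[OF t bilinear_eval] f)
qed

lemma linear_CT_fun: "linear_map CT_space H (\<lambda>t. CT_fun t x)"
  by (intro linear_mapI) (simp_all add: CT_fun_def scale_left_distrib sum.distrib scale_sum_right pscale_def)

lemma CT_fun_pscale [simp]: "CT_fun (pscale c t) x = scale c (CT_fun t x)"
  and CT_fun_sum [simp]: "CT_fun (sum g I) x = (\<Sum>i\<in>I. CT_fun (g i) x)"
  by (simp_all add: CT_fun_def scale_left_distrib sum.distrib scale_sum_right pscale_def
      sum_fun_apply scale_sum_left sum.swap[of _ I])

lemma bow_bilinear: "bilinear_map D H CT_space (\<bowtie>)"
  unfolding bow_def[abs_def] CT_space_def by (rule pure_bilinear)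

lemma bow_closed: "lk p \<Longrightarrow> (p \<bowtie> h) \<in> carrier CT_space"
  by (rule bilinear_map_closed[OF bow_bilinear]) (simp_all add: dual_space_iff_lk)

lemma CT_fun_bow: "lk p \<Longrightarrow> CT_fun (p \<bowtie> h) x = scale (p x) h"
proof (rule lk_separates)
  fix f :: "'h \<Rightarrow> 'k" assume p: "lk p" and f: "lk f"
  show "f (CT_fun (p \<bowtie> h) x) = f (scale (p x) h)"
    unfolding lk_CT_fun[OF bow_closed[OF p] f] lin_scale[OF f]
    by (simp add: bow_def pure_apply bilinear_eval[OF f])
qed

lemma CT_expansion:
  assumes "t \<in> carrier CT_space"
  shows "t = (\<Sum>i\<in>Basis. dual_basis i \<bowtie> CT_fun t i)"
proof (rule CT_eqI[OF assms])
  show "(\<Sum>i\<in>Basis. dual_basis i \<bowtie> CT_fun t i) \<in> carrier CT_space"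
    by (intro vs_sum[OF is_vspace_CT] bow_closed lk_dual_basis)
  show "CT_fun t x = CT_fun (\<Sum>i\<in>Basis. dual_basis i \<bowtie> CT_fun t i) x" for x
    using lin_basis_expansion[OF lh_CT_fun[OF assms], of x] by (simp add: CT_fun_bow lk_dual_basis)
qed

text \<open>An endomorphism F stands for the sum of all h^i \<bowtie> F(h_i). A map prescribed on
  the p \<bowtie> h therefore becomes a basis sum in F, which \<open>lin_basis_expansion\<close>
  later collapses.\<close>

lemma CT_lift_eq:
  assumes "is_vspace X" "bilinear_map D H X B" "t \<in> carrier CT_space"
  shows "CT_lift X B t = (\<Sum>i\<in>Basis. B (dual_basis i) (CT_fun t i))"
proof -
  have lin: "linear_map CT_space X (CT_lift X B)"
    using tensor_lift_linear[OF assms(1,2)] by (simp add: CT_lift_def[abs_def] CT_space_def)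
  have "CT_lift X B t = (\<Sum>i\<in>Basis. CT_lift X B (dual_basis i \<bowtie> CT_fun t i))"
    by (subst CT_expansion[OF assms(3)], rule linear_map_sum[OF lin is_vspace_CT])
      (intro bow_closed lk_dual_basis)
  then show ?thesis
    by (simp add: CT_lift_def bow_def tensor_lift_pure[OF assms(1,2)] dual_basis_D)
qed

lemma CT_lift_linear:
  assumes "is_vspace X" "bilinear_map D H X B"
  shows "linear_map CT_space X (CT_lift X B)"
  using tensor_lift_linear[OF assms] by (simp add: CT_lift_def[abs_def] CT_space_def)

section \<open>Linearity rules for maps into the components and their tensor products\<close>

lemma lm_id: "linear_map V V (\<lambda>x. x)"
  by (simp add: linear_map_def)

lemma lm_lh: "lh g \<Longrightarrow> linear_map V H f \<Longrightarrow> linear_map V H (\<lambda>v. g (f v))"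
  by (simp add: linear_map_def lin_def)

lemma lm_lk: "lk g \<Longrightarrow> linear_map V H f \<Longrightarrow> linear_map V scalars (\<lambda>v. g (f v))"
  by (simp add: linear_map_def lin_def)

lemma lm_mult_left: "linear_map V H f \<Longrightarrow> linear_map V H (\<lambda>v. f v * c)"
  by (rule lm_lh[of "\<lambda>x. x * c"]) (intro lin_intros)

lemma lm_mult_right: "linear_map V H f \<Longrightarrow> linear_map V H (\<lambda>v. c * f v)"
  by (rule lm_lh[of "\<lambda>x. c * x"]) (intro lin_intros)

lemma lm_kmult_left: "linear_map V scalars f \<Longrightarrow> linear_map V scalars (\<lambda>v. f v * c)"
  by (simp add: linear_map_def algebra_simps)

lemma lm_kmult_right: "linear_map V scalars f \<Longrightarrow> linear_map V scalars (\<lambda>v. c * f v)"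
  by (simp add: linear_map_def algebra_simps)

lemma lm_eval: "linear_map D scalars (\<lambda>p. p x)"
  by (simp add: linear_map_def pscale_def)

lemma lm_bow_left: "linear_map V D f \<Longrightarrow> linear_map V CT_space (\<lambda>v. f v \<bowtie> h)"
  using linear_map_comp[OF _ bilinear_map_left[OF bow_bilinear]] by simp

lemma lm_bow_right: "lk p \<Longrightarrow> linear_map V H f \<Longrightarrow> linear_map V CT_space (\<lambda>v. p \<bowtie> f v)"
  using linear_map_comp[OF _ bilinear_map_right[OF bow_bilinear]] by (simp add: dual_space_iff_lk)

lemma lm_pure_left:
  "w \<in> carrier W \<Longrightarrow> linear_map U V f \<Longrightarrow> linear_map U (tensor_space V W) (\<lambda>u. pure V W (f u) w)"
  using linear_map_comp[OF _ bilinear_map_left[OF pure_bilinear]] .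

lemma lm_pure_right:
  "v \<in> carrier V \<Longrightarrow> linear_map U W f \<Longrightarrow> linear_map U (tensor_space V W) (\<lambda>u. pure V W v (f u))"
  using linear_map_comp[OF _ bilinear_map_right[OF pure_bilinear]] .

lemma lm_convol_left:
  assumes "lk q" "linear_map V D f"
  shows "linear_map V D (\<lambda>v. convol (f v) q)"
proof (rule linear_map_comp[OF assms(2)], intro linear_mapI)
  fix x :: "'h \<Rightarrow> 'k" and y and c :: 'k assume "x \<in> carrier D" "y \<in> carrier D"
  then have "lk x" "lk y" by (simp_all add: dual_space_iff_lk)
  moreover from this have "lk (x + y)" "lk (pscale c x)"
    by (simp_all add: lin_def pscale_def algebra_simps)
  ultimately show "convol (x + y) q = convol x q + convol y q"
    "convol (scal D c x) q = scal D c (convol x q)"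
    using assms(1)
    by (simp_all add: fun_eq_iff convol_eq pscale_def SW_def sum.distrib sum_distrib_left algebra_simps)
qed (simp add: dual_space_iff_lk lk_convol assms(1))

lemma lm_convol_right:
  assumes "lk q" "linear_map V D f"
  shows "linear_map V D (\<lambda>v. convol q (f v))"
proof (rule linear_map_comp[OF assms(2)], intro linear_mapI)
  fix x :: "'h \<Rightarrow> 'k" and y and c :: 'k assume "x \<in> carrier D" "y \<in> carrier D"
  then have "lk x" "lk y" by (simp_all add: dual_space_iff_lk)
  moreover from this have "lk (x + y)" "lk (pscale c x)"
    by (simp_all add: lin_def pscale_def algebra_simps)
  ultimately show "convol q (x + y) = convol q x + convol q y"
    "convol q (scal D c x) = scal D c (convol q x)"
    using assms(1)
    by (simp_all add: fun_eq_iff convol_eq pscale_def SW_def sum.distrib sum_distrib_left algebra_simps)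
qed (simp add: dual_space_iff_lk lk_convol assms(1))

lemma lm_precomp:
  assumes "lh g" "linear_map V D f"
  shows "linear_map V D (\<lambda>v x. f v (g x))"
proof (rule linear_map_comp[OF assms(2)], intro linear_mapI)
  fix x :: "'h \<Rightarrow> 'k" and y and c :: 'k assume "x \<in> carrier D"
  then show "(\<lambda>z. x (g z)) \<in> carrier D"
    by (simp add: dual_space_iff_lk lin_comp[OF _ assms(1)])
qed (simp_all add: fun_eq_iff pscale_def)

lemma lm_SW:
  assumes "is_vspace X" "\<And>a b. linear_map V X (\<lambda>v. B v a b)"
  shows "linear_map V X (\<lambda>v. SW (B v) y)"
  unfolding SW_def using assms by (intro linear_map_sum_fun)

lemma lm_SW_arg:
  assumes "is_vspace X" "\<And>a. linear_map H X (B a)" "linear_map V H f"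
  shows "linear_map V X (\<lambda>v. SW B (f v))"
  unfolding SW_def
  by (rule linear_map_sum_fun[OF assms(1)],
      rule linear_map_comp[OF lm_lh[OF lh_comult_coeff assms(3)] assms(2)])

lemma lm_CT_fun: "linear_map V CT_space f \<Longrightarrow> linear_map V H (\<lambda>v. CT_fun (f v) x)"
  by (rule linear_map_comp[OF _ linear_CT_fun])

lemma lm_sum: "is_vspace W \<Longrightarrow> (\<And>i. linear_map V W (f i)) \<Longrightarrow> linear_map V W (\<lambda>x. \<Sum>i\<in>I. f i x)"
  by (rule linear_map_sum_fun)

lemmas lm_intros = lm_id lm_mult_left lm_mult_right lm_kmult_left lm_kmult_right
  lm_bow_left lm_bow_right lm_pure_left lm_pure_right lm_convol_left lm_convol_right lm_precomp
  lm_SW lm_SW_arg lm_sum lm_CT_fun is_vspace_CT is_vspace_CC is_vspace_scalars is_vspace_H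
  lm_lh[OF lh_S] lm_lh[OF lh_S_inv] lm_lk[OF lk_counit] lm_lk[OF lk_dual_basis]
  lk_dual_basis bow_closed lk_convol

section \<open>The structure maps as operations on endomorphisms\<close>

lemma CT_cou_eq:
  assumes "t \<in> carrier CT_space"
  shows "CT_cou \<alpha>\<beta> t = \<epsilon> (CT_fun t 1)"
proof -
  have b: "bilinear_map D H scalars (\<lambda>p h. p 1 * \<epsilon> h)" by (rule bilinear_eval[OF lk_counit])
  have "CT_cou \<alpha>\<beta> t = (\<Sum>i\<in>Basis. dual_basis i 1 * \<epsilon> (CT_fun t i))"
    by (simp add: CT_cou_def CT_lift_eq[OF is_vspace_scalars b assms])
  also have "\<dots> = \<epsilon> (CT_fun t 1)"
    by (rule lin_basis_expansion) (rule lin_comp[OF lk_counit lh_CT_fun[OF assms]])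
  finally show ?thesis .
qed

lemma
  assumes "\<alpha> \<in> Aut_Hopf" "\<beta> \<in> Aut_Hopf" "\<gamma> \<in> Aut_Hopf" "\<delta> \<in> Aut_Hopf"
  shows linear_CT_cross: "linear_map CT_space CT_space (CT_cross (\<alpha>, \<beta>) (\<gamma>, \<delta>))"
    and CT_fun_cross: "t \<in> carrier CT_space \<Longrightarrow> CT_fun (CT_cross (\<alpha>, \<beta>) (\<gamma>, \<delta>) t) x =
      inv_into UNIV \<beta> (\<delta> (\<alpha> (inv_into UNIV \<delta> (CT_fun t (inv_into UNIV \<alpha> (\<beta> x))))))"
proof -
  let ?\<theta> = "inv_into UNIV \<alpha> \<circ> \<beta>" and ?\<phi> = "inv_into UNIV \<beta> \<circ> \<delta> \<circ> \<alpha> \<circ> inv_into UNIV \<delta>"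
  have aut: "?\<theta> \<in> Aut_Hopf" "?\<phi> \<in> Aut_Hopf" using assms by (simp_all add: Aut_closed)
  have lk: "lk p \<Longrightarrow> lk (\<lambda>x. p (?\<theta> x))" for p
    by (rule lin_comp[OF _ lh_Aut[OF aut(1)]])
  have b: "bilinear_map D H CT_space (\<lambda>p h. (\<lambda>x. p (?\<theta> x)) \<bowtie> ?\<phi> h)"
    by (intro bilinear_mapI lm_intros lm_lh[OF lh_Aut[OF aut(2)]] lh_Aut[OF aut(1)] lk)
      (simp add: dual_space_iff_lk)
  have eq: "CT_cross (\<alpha>, \<beta>) (\<gamma>, \<delta>) = CT_lift CT_space (\<lambda>p h. (\<lambda>x. p (?\<theta> x)) \<bowtie> ?\<phi> h)"
    by (simp add: CT_cross_def o_def)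
  show "linear_map CT_space CT_space (CT_cross (\<alpha>, \<beta>) (\<gamma>, \<delta>))"
    unfolding eq by (rule CT_lift_linear[OF is_vspace_CT b])
  assume t: "t \<in> carrier CT_space"
  have "CT_fun (CT_cross (\<alpha>, \<beta>) (\<gamma>, \<delta>) t) x =
      (\<Sum>i\<in>Basis. scale (dual_basis i (?\<theta> x)) (?\<phi> (CT_fun t i)))"
    by (simp add: eq CT_lift_eq[OF is_vspace_CT b t] CT_fun_bow lk[OF lk_dual_basis] del: o_apply)
  also have "\<dots> = ?\<phi> (CT_fun t (?\<theta> x))"
    by (rule lin_basis_expansion) (rule lin_comp[OF lh_Aut[OF aut(2)] lh_CT_fun[OF t]])
  finally show "CT_fun (CT_cross (\<alpha>, \<beta>) (\<gamma>, \<delta>) t) x =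
      inv_into UNIV \<beta> (\<delta> (\<alpha> (inv_into UNIV \<delta> (CT_fun t (inv_into UNIV \<alpha> (\<beta> x))))))"
    by simp
qed

text \<open>The convolution is q p, in the order of the opposite algebra: q takes the first leg of x
  and p the second. Hence the left factor s is evaluated at the second leg.\<close>

lemma
  assumes "\<alpha> \<in> Aut_Hopf" "\<delta> \<in> Aut_Hopf"
  shows bilinear_CT_mult: "bilinear_map CT_space CT_space CT_space (CT_mult (\<alpha>, \<beta>) (\<gamma>, \<delta>))"
    and CT_fun_mult: "\<lbrakk>s \<in> carrier CT_space; t \<in> carrier CT_space\<rbrakk> \<Longrightarrow>
      CT_fun (CT_mult (\<alpha>, \<beta>) (\<gamma>, \<delta>) s t) x =
        SW (\<lambda>a b. \<delta> (CT_fun s b) * \<delta> (\<alpha> (inv_into UNIV \<delta> (CT_fun t a)))) x"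
proof -
  let ?c = "\<delta> \<circ> \<alpha> \<circ> inv_into UNIV \<delta>"
  let ?B = "\<lambda>p h q h'. convol q p \<bowtie> \<delta> h * ?c h'"
  let ?I = "\<lambda>t p h. CT_lift CT_space (?B p h) t"
  have c: "?c \<in> Aut_Hopf" using assms by (simp add: Aut_closed)
  note lmc = lm_intros lm_lh[OF lh_Aut[OF c]] lm_lh[OF lh_Aut[OF assms(2)]]
  have inner: "bilinear_map D H CT_space (?B p h)" if "lk p" for p h
    by (intro bilinear_mapI lmc that) (simp add: dual_space_iff_lk)
  have I: "?I t p h = (\<Sum>i\<in>Basis. ?B p h (dual_basis i) (CT_fun t i))"
    if "t \<in> carrier CT_space" "lk p" for t p h
    by (rule CT_lift_eq[OF is_vspace_CT inner[OF that(2)] that(1)])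
  \<comment> \<open>The closed form of the inner lift is established for linear p, so bilinearity of
    the outer map is transferred from it on the carriers only.\<close>
  have outer: "bilinear_map D H CT_space (?I t)" if t: "t \<in> carrier CT_space" for t
  proof (rule bilinear_map_cong[OF _ is_vspace_D is_vspace_H])
    show "bilinear_map D H CT_space (\<lambda>p h. \<Sum>i\<in>Basis. ?B p h (dual_basis i) (CT_fun t i))"
      by (intro bilinear_mapI lmc lm_lh[OF lin_mult_left] lin_id) (simp_all add: dual_space_iff_lk)
  qed (simp add: I[OF t] dual_space_iff_lk del: o_apply)
  have eq: "CT_mult (\<alpha>, \<beta>) (\<gamma>, \<delta>) s t = CT_lift CT_space (?I t) s" for s t
    by (simp add: CT_mult_def)
  have lift: "CT_lift CT_space (?I t) s = (\<Sum>i\<in>Basis. ?I t (dual_basis i) (CT_fun s i))"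
    if "s \<in> carrier CT_space" "t \<in> carrier CT_space" for s t
    by (rule CT_lift_eq[OF is_vspace_CT outer[OF that(2)] that(1)])
  show "bilinear_map CT_space CT_space CT_space (CT_mult (\<alpha>, \<beta>) (\<gamma>, \<delta>))"
  proof (rule bilinear_mapI)
    fix t assume "t \<in> carrier CT_space"
    from CT_lift_linear[OF is_vspace_CT outer[OF this]]
    show "linear_map CT_space CT_space (\<lambda>s. CT_mult (\<alpha>, \<beta>) (\<gamma>, \<delta>) s t)"
      unfolding eq .
  next
    fix s assume s: "s \<in> carrier CT_space"
    show "linear_map CT_space CT_space (CT_mult (\<alpha>, \<beta>) (\<gamma>, \<delta>) s)"
    proof (rule linear_map_cong[OF _ is_vspace_CT])
      show "linear_map CT_space CT_space (\<lambda>t. \<Sum>i\<in>Basis. ?I t (dual_basis i) (CT_fun s i))"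
        by (intro lm_sum is_vspace_CT CT_lift_linear inner lk_dual_basis)
    qed (simp add: eq lift[OF s] del: o_apply)
  qed
  assume s: "s \<in> carrier CT_space" and t: "t \<in> carrier CT_space"
  have "CT_fun (?I t p h) x = SW (\<lambda>a b. scale (p b) (\<delta> h * ?c (CT_fun t a))) x" if p: "lk p" for p h
  proof -
    have "CT_fun (?I t p h) x =
        (\<Sum>i\<in>Basis. scale (SW (\<lambda>a b. dual_basis i a * p b) x) (\<delta> h * ?c (CT_fun t i)))"
      by (simp add: I[OF t p] CT_fun_bow lk_convol lk_dual_basis p convol_eq del: o_apply)
    also have "\<dots> = (\<Sum>i\<in>Basis. SW (\<lambda>a b. scale (dual_basis i a * p b) (\<delta> h * ?c (CT_fun t i))) x)"
      by (simp only: SW_def scale_sum_left)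
    also have "\<dots> = SW (\<lambda>a b. scale (p b) (\<Sum>i\<in>Basis. scale (dual_basis i a) (\<delta> h * ?c (CT_fun t i)))) x"
      by (simp add: SW_sum[symmetric] scale_sum_right mult.commute)
    also have "\<dots> = SW (\<lambda>a b. scale (p b) (\<delta> h * ?c (CT_fun t a))) x"
      by (subst lin_basis_expansion[where s=scale])
        (intro lin_intros lin_comp[OF lh_Aut[OF c]] lh_CT_fun[OF t] | rule refl)+
    finally show ?thesis .
  qed
  then have "CT_fun (CT_mult (\<alpha>, \<beta>) (\<gamma>, \<delta>) s t) x =
      (\<Sum>i\<in>Basis. SW (\<lambda>a b. scale (dual_basis i b) (\<delta> (CT_fun s i) * ?c (CT_fun t a))) x)"
    by (simp add: eq lift[OF s t] lk_dual_basis del: o_apply)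
  also have "\<dots> = SW (\<lambda>a b. \<Sum>i\<in>Basis. scale (dual_basis i b) (\<delta> (CT_fun s i) * ?c (CT_fun t a))) x"
    by (simp only: SW_sum)
  also have "\<dots> = SW (\<lambda>a b. \<delta> (CT_fun s b) * ?c (CT_fun t a)) x"
    by (subst lin_basis_expansion[where s=scale])
      (intro lin_intros lin_comp[OF lh_Aut[OF assms(2)]] lh_CT_fun[OF s] | rule refl)+
  finally show "CT_fun (CT_mult (\<alpha>, \<beta>) (\<gamma>, \<delta>) s t) x =
      SW (\<lambda>a b. \<delta> (CT_fun s b) * \<delta> (\<alpha> (inv_into UNIV \<delta> (CT_fun t a)))) x"
    by simp
qed

lemma CT_sigma_eq:
  assumes "\<delta> \<in> Aut_Hopf" "s \<in> carrier CT_space" "t \<in> carrier CT_space"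
  shows "CT_sigma (\<alpha>, \<beta>) (\<gamma>, \<delta>) s t = \<epsilon> (CT_fun s (inv_into UNIV \<delta> (CT_fun t 1)))"
proof -
  let ?d = "inv_into UNIV \<delta>"
  let ?B = "\<lambda>p h q h'. p (?d h') * q 1 * \<epsilon> h"
  have d: "lh ?d" by (intro lh_Aut inv_Aut assms(1))
  have inner: "bilinear_map D H scalars (?B p h)" if "lk p" for p h
    by (intro bilinear_mapI lm_kmult_left lm_kmult_right lm_eval lm_lk[OF lin_comp[OF that d]] lm_id)
  have I: "CT_lift scalars (?B p h) t = p (?d (CT_fun t 1)) * \<epsilon> h" if p: "lk p" for p h
  proof -
    have "CT_lift scalars (?B p h) t =
        (\<Sum>i\<in>Basis. dual_basis i 1 * (p (?d (CT_fun t i)) * \<epsilon> h))"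
      unfolding CT_lift_eq[OF is_vspace_scalars inner[OF p] assms(3)] by (simp add: mult_ac)
    also have "\<dots> = p (?d (CT_fun t 1)) * \<epsilon> h"
      by (rule lin_basis_expansion)
        (intro lin_intros lin_comp[OF p] lin_comp[OF d] lh_CT_fun[OF assms(3)])
    finally show ?thesis .
  qed
  have outer: "bilinear_map D H scalars (\<lambda>p h. CT_lift scalars (?B p h) t)"
    by (rule bilinear_map_cong[OF _ is_vspace_D is_vspace_H bilinear_eval[OF lk_counit, of "?d (CT_fun t 1)"]])
      (simp add: I dual_space_iff_lk)
  have "CT_sigma (\<alpha>, \<beta>) (\<gamma>, \<delta>) s t = (\<Sum>i\<in>Basis. dual_basis i (?d (CT_fun t 1)) * \<epsilon> (CT_fun s i))"
    by (simp add: CT_sigma_def CT_lift_eq[OF is_vspace_scalars outer assms(2)] I lk_dual_basis)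
  also have "\<dots> = \<epsilon> (CT_fun s (?d (CT_fun t 1)))"
    by (rule lin_basis_expansion) (rule lin_comp[OF lk_counit lh_CT_fun[OF assms(2)]])
  finally show ?thesis .
qed

text \<open>The functionals h^i, p and h^j are evaluated at x_1, \<open>S_inv\<close> x_2 and
  \<open>S_inv\<close> x_3, and the sums over i and j put these legs in place of the basis elements.
  The bracketing is that of the nested convolution in the definition.\<close>

lemma
  assumes "\<alpha> \<in> Aut_Hopf" "\<beta> \<in> Aut_Hopf"
  defines "\<alpha>' \<equiv> inv_into UNIV \<alpha>" and "\<beta>' \<equiv> inv_into UNIV \<beta>"
  shows linear_CT_antip: "linear_map CT_space CT_space (CT_antip (\<alpha>, \<beta>))"
    and CT_fun_antip: "t \<in> carrier CT_space \<Longrightarrow> CT_fun (CT_antip (\<alpha>, \<beta>) t) x =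
      SW (\<lambda>r c. SW (\<lambda>a b. \<beta>' (S_inv c) * \<beta>' (\<alpha>' (S (CT_fun t (S_inv b)))) * \<beta>' (\<alpha>' (\<beta> a))) r) x"
proof -
  let ?m = "\<lambda>h. \<beta>' (\<alpha>' (S h))" and ?l = "\<lambda>h. \<beta>' (\<alpha>' (\<beta> h))"
  let ?B = "\<lambda>p h. \<Sum>i\<in>Basis. \<Sum>j\<in>Basis.
    convol (convol (dual_basis i) (\<lambda>x. p (S_inv x))) (\<lambda>x. dual_basis j (S_inv x)) \<bowtie> \<beta>' j * ?m h * ?l i"
  have lb: "lh \<beta>'" "lh \<alpha>'" "lh \<beta>" unfolding \<alpha>'_def \<beta>'_def by (intro lh_Aut inv_Aut assms)+
  have lm: "lh ?m" and ll: "lh ?l" by (intro lin_comp[OF lb(1)] lin_comp[OF lb(2)] lh_S lb)+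
  have li: "lk p \<Longrightarrow> lk (\<lambda>x. p (S_inv x))" for p by (rule lin_comp[OF _ lh_S_inv])
  have b: "bilinear_map D H CT_space ?B"
    by (intro bilinear_mapI lm_intros lm_lh[OF lm] li lh_S_inv) (simp add: dual_space_iff_lk)
  have eq: "CT_antip (\<alpha>, \<beta>) = CT_lift CT_space ?B"
    by (simp add: CT_antip_def \<alpha>'_def \<beta>'_def o_def Let_def)
  show "linear_map CT_space CT_space (CT_antip (\<alpha>, \<beta>))"
    unfolding eq by (rule CT_lift_linear[OF is_vspace_CT b])
  assume t: "t \<in> carrier CT_space"
  have B: "CT_fun (?B p h) x =
      SW (\<lambda>r c. SW (\<lambda>a b. scale (p (S_inv b)) (\<beta>' (S_inv c) * ?m h * ?l a)) r) x" if p: "lk p" for p h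
  proof -
    have "CT_fun (?B p h) x = (\<Sum>i\<in>Basis. \<Sum>j\<in>Basis.
        scale (SW (\<lambda>r c. SW (\<lambda>a b. dual_basis i a * p (S_inv b)) r * dual_basis j (S_inv c)) x)
          (\<beta>' j * ?m h * ?l i))"
      by (simp add: CT_fun_bow lk_convol lk_dual_basis p li convol_eq)
    also have "\<dots> = (\<Sum>i\<in>Basis. \<Sum>j\<in>Basis. SW (\<lambda>r c. SW (\<lambda>a b.
        scale (dual_basis i a * p (S_inv b) * dual_basis j (S_inv c)) (\<beta>' j * ?m h * ?l i)) r) x)"
      by (simp only: SW_def scale_sum_left sum_distrib_right)
    also have "\<dots> = SW (\<lambda>r c. SW (\<lambda>a b. scale (p (S_inv b)) (\<Sum>i\<in>Basis. scale (dual_basis i a)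
        (\<Sum>j\<in>Basis. scale (dual_basis j (S_inv c)) (\<beta>' j * ?m h * ?l i)))) r) x"
      by (simp add: SW_sum[symmetric] scale_sum_right mult_ac)
    also have "\<dots> = SW (\<lambda>r c. SW (\<lambda>a b. scale (p (S_inv b))
        (\<Sum>j\<in>Basis. scale (dual_basis j (S_inv c)) (\<beta>' j * ?m h * ?l a))) r) x"
      by (subst lin_basis_expansion[where s=scale]) (intro lin_intros lin_comp[OF ll] | rule refl)+
    also have "\<dots> = SW (\<lambda>r c. SW (\<lambda>a b. scale (p (S_inv b)) (\<beta>' (S_inv c) * ?m h * ?l a)) r) x"
      by (subst lin_basis_expansion[where s=scale]) (intro lin_intros lin_comp[OF lb(1)] | rule refl)+
    finally show ?thesis .
  qed
  have "CT_fun (CT_antip (\<alpha>, \<beta>) t) x = (\<Sum>n\<in>Basis. CT_fun (?B (dual_basis n) (CT_fun t n)) x)" (is "?lhs = _")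
    by (simp add: eq CT_lift_eq[OF is_vspace_CT b t])
  also have "\<dots> = SW (\<lambda>r c. SW (\<lambda>a b. \<Sum>n\<in>Basis. scale (dual_basis n (S_inv b))
      (\<beta>' (S_inv c) * ?m (CT_fun t n) * ?l a)) r) x"
    unfolding B[OF lk_dual_basis] by (simp only: SW_sum)
  also have "\<dots> = SW (\<lambda>r c. SW (\<lambda>a b. \<beta>' (S_inv c) * ?m (CT_fun t (S_inv b)) * ?l a) r) x"
    by (subst lin_basis_expansion[where s=scale])
      (intro lin_intros lin_comp[OF lm] lh_CT_fun[OF t] | rule refl)+
  finally show "?lhs = \<dots>" .
qed

text \<open>Collapses three dual basis sums at once, for a triple convolution evaluated at y. The
  order i, j, l of the sums is the one produced by \<open>CT_cop\<close>, where l comes from the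
  dual coproduct of p.\<close>

lemma SW3_expansion:
  assumes "\<And>b c. lk (\<lambda>a. V a b c)" "\<And>a c. lk (\<lambda>b. V a b c)" "\<And>a b. lk (\<lambda>c. V a b c)"
  shows "(\<Sum>i\<in>Basis. \<Sum>j\<in>Basis. \<Sum>l\<in>Basis.
      SW (\<lambda>r c. SW (\<lambda>a b. dual_basis i a * dual_basis l b) r * dual_basis j c) y * V i l j) =
    SW (\<lambda>r c. SW (\<lambda>a b. V a b c) r) y"
proof -
  have V: "(\<Sum>i\<in>Basis. \<Sum>j\<in>Basis. \<Sum>l\<in>Basis.
      dual_basis i a * dual_basis l b * dual_basis j c * V i l j) = V a b c" for a b c
  proof -
    have "(\<Sum>i\<in>Basis. \<Sum>j\<in>Basis. \<Sum>l\<in>Basis.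
        dual_basis i a * dual_basis l b * dual_basis j c * V i l j) =
      (\<Sum>i\<in>Basis. dual_basis i a * (\<Sum>j\<in>Basis. dual_basis j c * (\<Sum>l\<in>Basis. dual_basis l b * V i l j)))"
      by (simp add: sum_distrib_left mult_ac)
    also have "\<dots> = V a b c"
      by (simp only: lin_basis_expansion[where s="(*)", OF assms(1)]
          lin_basis_expansion[where s="(*)", OF assms(2)] lin_basis_expansion[where s="(*)", OF assms(3)])
    finally show ?thesis .
  qed
  show ?thesis
    by (simp only: SW_mult_left SW_sum[symmetric] V)
qed

text \<open>The forms \<Psi>(F(x), F'(y)) are enough to test an element of the tensor square. On
  them the coproduct is computed with the three legs y_1, y_2, y_3 described above, regrouped to the
  right.\<close>

lemma
  assumes "\<alpha> \<in> Aut_Hopf" "\<beta> \<in> Aut_Hopf"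
  shows linear_CT_cop: "linear_map CT_space CC (CT_cop (\<alpha>, \<beta>))"
    and CT_cop_apply: "\<lbrakk>t \<in> carrier CT_space; \<And>a. lk (\<Psi> a); \<And>b. lk (\<lambda>a. \<Psi> a b)\<rbrakk> \<Longrightarrow>
      CT_cop (\<alpha>, \<beta>) t (\<lambda>s s'. \<Psi> (CT_fun s x) (CT_fun s' y)) =
        SW (\<lambda>a r. SW (\<lambda>b c. SW (\<lambda>u v. \<Psi> (\<beta> c * u * S_inv (\<alpha> a)) v) (CT_fun t (x * b))) r) y"
proof -
  let ?P = "\<lambda>i j p1 p2 h1 h2. pure CT_space CT_space (p1 \<bowtie> \<beta> j * h1 * S_inv (\<alpha> i))
    (convol (convol (dual_basis i) p2) (dual_basis j) \<bowtie> h2)"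
  let ?I = "\<lambda>i j h p1 p2. tensor_lift H H CC (?P i j p1 p2) (\<Delta> h)"
  let ?B = "\<lambda>p h. \<Sum>i\<in>Basis. \<Sum>j\<in>Basis. tensor_lift D D CC (?I i j h) (dual_comult p)"
  let ?B' = "\<lambda>p h. \<Sum>i\<in>Basis. \<Sum>j\<in>Basis. \<Sum>l\<in>Basis. SW (?P i j (\<lambda>x. p (x * l)) (dual_basis l)) h"
  have I: "?I i j h p1 p2 = SW (?P i j p1 p2) h" if "lk p1" "lk p2" for i j h p1 p2
    by (rule tensor_lift_Delta[OF is_vspace_CC]) (intro bilinear_mapI lm_intros that)
  have I_bil: "bilinear_map D D CC (?I i j h)" for i j h
    by (rule bilinear_map_cong[OF _ is_vspace_D is_vspace_D, where C="\<lambda>p1 p2. SW (?P i j p1 p2) h"])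
      (intro I bilinear_mapI lm_intros | simp add: dual_space_iff_lk)+
  have lt: "lk p \<Longrightarrow> lk (\<lambda>x. p (x * l))" for p l
    by (rule lin_comp, assumption, intro lin_intros)
  have B: "?B p h = ?B' p h" if "lk p" for p h
    by (simp add: tensor_lift_dual_comult[OF is_vspace_CC I_bil that] I lt[OF that] lk_dual_basis)
  have B_bil: "bilinear_map D H CC ?B"
  proof (rule bilinear_map_cong[OF _ is_vspace_D is_vspace_H])
    show "bilinear_map D H CC ?B'"
      by (intro bilinear_mapI lm_intros lt lin_mult_left lin_id) (simp_all add: dual_space_iff_lk lt)
  qed (simp add: B dual_space_iff_lk)
  have eq: "CT_cop (\<alpha>, \<beta>) = CT_lift CC ?B"
    by (simp add: CT_cop_def Let_def)
  show "linear_map CT_space CC (CT_cop (\<alpha>, \<beta>))"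
    unfolding eq by (rule CT_lift_linear[OF is_vspace_CC B_bil])
  assume t: "t \<in> carrier CT_space" and \<Psi>: "\<And>a. lk (\<Psi> a)" "\<And>b. lk (\<lambda>a. \<Psi> a b)"
  note L = lin_intros' lin_comp[OF \<Psi>(1)] lin_comp[OF \<Psi>(2)] lin_comp[OF lh_Aut[OF assms(1)]]
    lin_comp[OF lh_Aut[OF assms(2)]] lin_comp[OF lh_CT_fun[OF t]]
  let ?C = "\<lambda>s s'. \<Psi> (CT_fun s x) (CT_fun s' y)"
  let ?W = "\<lambda>i j h. SW (\<lambda>u v. \<Psi> (\<beta> j * u * S_inv (\<alpha> i)) v) h"
  \<comment> \<open>This is (h^i h^l h^j)(y): the second dual leg p_2 has become h^l, and the
    matching p_1 sends x to p(x h_l).\<close>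
  let ?q = "\<lambda>i l j. SW (\<lambda>r c. SW (\<lambda>a b. dual_basis i a * dual_basis l b) r * dual_basis j c) y"
  have C: "bilinear_map CT_space CT_space scalars ?C"
    by (intro bilinear_mapI lm_lk[OF \<Psi>(1)] lm_lk[OF \<Psi>(2)] linear_CT_fun)
  have P: "?P i j (\<lambda>x. p (x * l)) (dual_basis l) h1 h2 ?C =
      p (x * l) * ?q i l j * \<Psi> (\<beta> j * h1 * S_inv (\<alpha> i)) h2" if "lk p" for i j l p h1 h2
    by (simp add: pure_apply[OF C] CT_fun_bow lt[OF that] lk_convol lk_dual_basis convol_eq
        lin_scale[OF \<Psi>(1)] lin_scale[OF \<Psi>(2)] mult_ac)
  have B_apply: "?B p h ?C = (\<Sum>i\<in>Basis. \<Sum>j\<in>Basis. \<Sum>l\<in>Basis. ?q i l j * (p (x * l) * ?W i j h))"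
    if p: "lk p" for p h
  proof -
    have "?B p h ?C = (\<Sum>i\<in>Basis. \<Sum>j\<in>Basis. \<Sum>l\<in>Basis.
        SW (\<lambda>h1 h2. ?P i j (\<lambda>x. p (x * l)) (dual_basis l) h1 h2 ?C) h)"
      unfolding B[OF p] by (simp only: SW_def sum_fun_apply)
    also have "\<dots> = (\<Sum>i\<in>Basis. \<Sum>j\<in>Basis. \<Sum>l\<in>Basis. p (x * l) * ?q i l j * ?W i j h)"
      unfolding P[OF p] SW_mult_right[symmetric] ..
    finally show ?thesis by (simp add: mult_ac)
  qed
  have "CT_cop (\<alpha>, \<beta>) t ?C = (\<Sum>n\<in>Basis. ?B (dual_basis n) (CT_fun t n) ?C)"
    unfolding eq CT_lift_eq[OF is_vspace_CC B_bil t] by (rule sum_fun_apply)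
  also have "\<dots> = (\<Sum>n\<in>Basis. \<Sum>i\<in>Basis. \<Sum>j\<in>Basis. \<Sum>l\<in>Basis.
      ?q i l j * (dual_basis n (x * l) * ?W i j (CT_fun t n)))"
    unfolding B_apply[OF lk_dual_basis] ..
  also have "\<dots> = (\<Sum>i\<in>Basis. \<Sum>j\<in>Basis. \<Sum>l\<in>Basis. \<Sum>n\<in>Basis.
      ?q i l j * (dual_basis n (x * l) * ?W i j (CT_fun t n)))"
    by (rule trans[OF sum.swap], rule sum.cong[OF refl], rule trans[OF sum.swap],
        rule sum.cong[OF refl], rule sum.swap)
  also have "\<dots> = (\<Sum>i\<in>Basis. \<Sum>j\<in>Basis. \<Sum>l\<in>Basis. ?q i l j * ?W i j (CT_fun t (x * l)))"
    unfolding sum_distrib_left[symmetric]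
    by (subst lin_basis_expansion[where s="(*)"]) (intro L | rule refl)+
  also have "\<dots> = SW (\<lambda>r c. SW (\<lambda>a b. ?W a c (CT_fun t (x * b))) r) y"
    by (rule SW3_expansion) (intro L)+
  also have "\<dots> = SW (\<lambda>a r. SW (\<lambda>b c. ?W a c (CT_fun t (x * b))) r) y"
    by (rule SW_coassoc) (intro L)+
  finally show "CT_cop (\<alpha>, \<beta>) t ?C =
    SW (\<lambda>a r. SW (\<lambda>b c. SW (\<lambda>u v. \<Psi> (\<beta> c * u * S_inv (\<alpha> a)) v) (CT_fun t (x * b))) r) y" .
qed

subsection \<open>Contractions of iterated Sweedler sums\<close>

text \<open>p_1, p_2, p_3, q_1, q_2, q_3 are the six consecutive legs of x. The neighbours p_3 and
  q_1 are to cancel, but they sit in different halves; rebracketing brings them into a common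
  sum.\<close>

lemma SW_contract_middle:
  assumes "\<And>p2 p3 q1 q2 q3. lk (\<lambda>p1. K p1 p2 p3 q1 q2 q3)" "\<And>p1 p3 q1 q2 q3. lk (\<lambda>p2. K p1 p2 p3 q1 q2 q3)"
    "\<And>p1 p2 q1 q2 q3. lk (\<lambda>p3. K p1 p2 p3 q1 q2 q3)" "\<And>p1 p2 p3 q2 q3. lk (\<lambda>q1. K p1 p2 p3 q1 q2 q3)"
    "\<And>p1 p2 p3 q1 q3. lk (\<lambda>q2. K p1 p2 p3 q1 q2 q3)" "\<And>p1 p2 p3 q1 q2. lk (\<lambda>q3. K p1 p2 p3 q1 q2 q3)"
    and "\<And>p2 q2 q3. lk (\<lambda>p1. K' p1 p2 q2 q3)" "\<And>p1 q2 q3. lk (\<lambda>p2. K' p1 p2 q2 q3)"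
    "\<And>p1 p2 q3. lk (\<lambda>q2. K' p1 p2 q2 q3)" "\<And>p1 p2 q2. lk (\<lambda>q3. K' p1 p2 q2 q3)"
    and contr: "\<And>p1 p2 q2 q3 w. SW (\<lambda>p3 q1. K p1 p2 p3 q1 q2 q3) w = \<epsilon> w * K' p1 p2 q2 q3"
  shows "SW (\<lambda>m n. SW (\<lambda>p1 r. SW (\<lambda>p2 p3. SW (\<lambda>q1 r'. SW (\<lambda>q2 q3. K p1 p2 p3 q1 q2 q3) r') n) r) m) x =
    SW (\<lambda>m n. SW (\<lambda>p1 p2. SW (\<lambda>q2 q3. K' p1 p2 q2 q3) n) m) x"
proof -
  note L = lin_intros assms(1-10)[THEN lin_comp]
  have "SW (\<lambda>m n. SW (\<lambda>p1 r. SW (\<lambda>p2 p3. SW (\<lambda>q1 r'. SW (\<lambda>q2 q3. K p1 p2 p3 q1 q2 q3) r') n) r) m) x =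
      SW (\<lambda>m n. SW (\<lambda>r p3. SW (\<lambda>p1 p2. SW (\<lambda>q1 r'. SW (\<lambda>q2 q3. K p1 p2 p3 q1 q2 q3) r') n) r) m) x"
    by (intro SW_cong SW_coassoc[symmetric]) (intro L)+
  also have "\<dots> =
      SW (\<lambda>r w. SW (\<lambda>p3 n. SW (\<lambda>p1 p2. SW (\<lambda>q1 r'. SW (\<lambda>q2 q3. K p1 p2 p3 q1 q2 q3) r') n) r) w) x"
    by (rule SW_coassoc) (intro L)+
  also have "\<dots> =
      SW (\<lambda>r w. SW (\<lambda>p3 n. SW (\<lambda>q1 r'. SW (\<lambda>p1 p2. SW (\<lambda>q2 q3. K p1 p2 p3 q1 q2 q3) r') r) n) w) x"
    by (intro SW_cong) (rule SW_swap)
  also have "\<dots> = SW (\<lambda>r w. SW (\<lambda>p1 p2. SW (\<lambda>q2 q3. K' p1 p2 q2 q3) w) r) x"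
  proof (intro SW_cong SW_contract_left)
    fix r w r'
    have "SW (\<lambda>p3 q1. SW (\<lambda>p1 p2. SW (\<lambda>q2 q3. K p1 p2 p3 q1 q2 q3) r') r) w =
        SW (\<lambda>p1 p2. SW (\<lambda>q2 q3. SW (\<lambda>p3 q1. K p1 p2 p3 q1 q2 q3) w) r') r"
      by (rule trans[OF SW_swap], rule SW_cong, rule SW_swap)
    then show "SW (\<lambda>p3 q1. SW (\<lambda>p1 p2. SW (\<lambda>q2 q3. K p1 p2 p3 q1 q2 q3) r') r) w =
        \<epsilon> w * SW (\<lambda>p1 p2. SW (\<lambda>q2 q3. K' p1 p2 q2 q3) r') r"
      by (simp only: contr SW_mult_right)
  qed (intro L)+
  finally show ?thesis .
qed

text \<open>The same with four legs p_1, p_2, q_1, q_2, of which the two in the middle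
  cancel.\<close>

lemma SW_contract_middle2:
  assumes "\<And>p2 q1 q2. lk (\<lambda>p1. K p1 p2 q1 q2)" "\<And>p1 q1 q2. lk (\<lambda>p2. K p1 p2 q1 q2)"
    "\<And>p1 p2 q2. lk (\<lambda>q1. K p1 p2 q1 q2)" "\<And>p1 p2 q1. lk (\<lambda>q2. K p1 p2 q1 q2)"
    and "\<And>p1. lk (K' p1)"
    and contr: "\<And>p1 q2 w. SW (\<lambda>p2 q1. K p1 p2 q1 q2) w = \<epsilon> w * K' p1 q2"
  shows "SW (\<lambda>m n. SW (\<lambda>p1 p2. SW (\<lambda>q1 q2. K p1 p2 q1 q2) n) m) x = SW K' x"
proof -
  note L = lin_intros assms(1-5)[THEN lin_comp]
  have "SW (\<lambda>m n. SW (\<lambda>p1 p2. SW (\<lambda>q1 q2. K p1 p2 q1 q2) n) m) x =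
      SW (\<lambda>p1 r. SW (\<lambda>p2 n. SW (\<lambda>q1 q2. K p1 p2 q1 q2) n) r) x"
    by (rule SW_coassoc) (intro L)+
  also have "\<dots> = SW K' x"
    by (intro SW_cong SW_contract_left contr assms)
  finally show ?thesis .
qed

text \<open>m, a, b, c are consecutive legs. The pair m, a cancels before the sum over b and c is
  formed, so that inner sum has to be moved outside.\<close>

lemma SW_contract_outer:
  assumes "\<And>a b c. lk (\<lambda>m. K m a b c)" "\<And>m b c. lk (\<lambda>a. K m a b c)"
    "\<And>m a c. lk (\<lambda>b. K m a b c)" "\<And>m a b. lk (\<lambda>c. K m a b c)" "\<And>b. lk (K' b)"
    and contr: "\<And>b c w. SW (\<lambda>m a. K m a b c) w = \<epsilon> w * K' b c"
  shows "SW (\<lambda>m n. SW (\<lambda>a r. SW (\<lambda>b c. K m a b c) r) n) x = SW K' x"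
proof -
  note L = lin_intros assms(1-5)[THEN lin_comp]
  show ?thesis
  proof (rule SW_contract_left)
    fix w r
    have "SW (\<lambda>m a. SW (\<lambda>b c. K m a b c) r) w = SW (\<lambda>b c. SW (\<lambda>m a. K m a b c) w) r"
      by (rule SW_swap)
    then show "SW (\<lambda>m a. SW (\<lambda>b c. K m a b c) r) w = \<epsilon> w * SW K' r"
      by (simp only: contr SW_mult_right)
  qed (intro L)+
qed

text \<open>a, b, c, d are consecutive legs, and c, d cancel although c arises in the innermost
  splitting and d in the outermost one.\<close>

lemma SW_contract_last:
  assumes "\<And>b c d. lk (\<lambda>a. K a b c d)" "\<And>a c d. lk (\<lambda>b. K a b c d)"
    "\<And>a b d. lk (\<lambda>c. K a b c d)" "\<And>a b c. lk (\<lambda>d. K a b c d)"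
    "\<And>b. lk (\<lambda>a. K' a b)" "\<And>a. lk (K' a)"
    and contr: "\<And>a b w. SW (\<lambda>c d. K a b c d) w = \<epsilon> w * K' a b"
  shows "SW (\<lambda>r d. SW (\<lambda>a s. SW (\<lambda>b c. K a b c d) s) r) x = SW K' x"
proof -
  note L = lin_intros assms(1-6)[THEN lin_comp]
  have "SW (\<lambda>r d. SW (\<lambda>a s. SW (\<lambda>b c. K a b c d) s) r) x =
      SW (\<lambda>r d. SW (\<lambda>s c. SW (\<lambda>a b. K a b c d) s) r) x"
    by (intro SW_cong SW_coassoc[symmetric]) (intro L)+
  also have "\<dots> = SW (\<lambda>s w. SW (\<lambda>c d. SW (\<lambda>a b. K a b c d) s) w) x"
    by (rule SW_coassoc) (intro L)+
  also have "\<dots> = SW (\<lambda>s w. \<epsilon> w * SW K' s) x"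
    by (rule SW_cong, subst SW_swap) (simp only: contr SW_mult_right)
  also have "\<dots> = SW K' x"
    by (rule SW_counit_right) (intro L)
  finally show ?thesis .
qed

text \<open>Regroups five legs from (a b), c, (d e) so that a and e stand outside and b, c, d are
  collected between them. Only in the second grouping are the three middle legs those of one
  element.\<close>

lemma SW_coassoc5:
  assumes "\<And>b c d e. lk (\<lambda>a. K a b c d e)" "\<And>a c d e. lk (\<lambda>b. K a b c d e)"
    "\<And>a b d e. lk (\<lambda>c. K a b c d e)" "\<And>a b c e. lk (\<lambda>d. K a b c d e)"
    "\<And>a b c d. lk (\<lambda>e. K a b c d e)"
  shows "SW (\<lambda>s r. SW (\<lambda>c r'. SW (\<lambda>d e. SW (\<lambda>a b. K a b c d e) s) r') r) x =
    SW (\<lambda>a r. SW (\<lambda>s e. SW (\<lambda>b r'. SW (\<lambda>c d. K a b c d e) r') s) r) x"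
proof -
  note L = lin_intros assms[THEN lin_comp]
  have "SW (\<lambda>s r. SW (\<lambda>c r'. SW (\<lambda>d e. SW (\<lambda>a b. K a b c d e) s) r') r) x =
      SW (\<lambda>s r. SW (\<lambda>a b. SW (\<lambda>c r'. SW (\<lambda>d e. K a b c d e) r') r) s) x"
    by (rule SW_cong, rule trans[OF _ SW_swap], rule SW_cong, rule SW_swap)
  also have "\<dots> = SW (\<lambda>a r0. SW (\<lambda>b r. SW (\<lambda>c r'. SW (\<lambda>d e. K a b c d e) r') r) r0) x"
    by (rule SW_coassoc) (intro L)+
  also have "\<dots> = SW (\<lambda>a r0. SW (\<lambda>b r. SW (\<lambda>r' e. SW (\<lambda>c d. K a b c d e) r') r) r0) x"
    by (intro SW_cong SW_coassoc[symmetric]) (intro L)+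
  also have "\<dots> = SW (\<lambda>a r0. SW (\<lambda>s e. SW (\<lambda>b r'. SW (\<lambda>c d. K a b c d e) r') s) r0) x"
    by (intro SW_cong SW_coassoc[symmetric]) (intro L)+
  finally show ?thesis .
qed

lemma SW3_mult:
  assumes "\<And>b c. lk (\<lambda>a. K a b c)" "\<And>a c. lk (\<lambda>b. K a b c)" "\<And>a b. lk (\<lambda>c. K a b c)"
  shows "SW (\<lambda>a r. SW (\<lambda>b c. K a b c) r) (x * y) =
    SW (\<lambda>x1 r. SW (\<lambda>y1 s. SW (\<lambda>x2 x3. SW (\<lambda>y2 y3. K (x1 * y1) (x2 * y2) (x3 * y3)) s) r) y) x"
proof -
  note L = lin_intros assms[THEN lin_comp]
  have "SW (\<lambda>a r. SW (\<lambda>b c. K a b c) r) (x * y) =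
    SW (\<lambda>x1 r. SW (\<lambda>y1 s. SW (\<lambda>b c. K (x1 * y1) b c) (r * s)) y) x"
    by (rule SW_mult) (intro L)+
  also have "\<dots> =
    SW (\<lambda>x1 r. SW (\<lambda>y1 s. SW (\<lambda>x2 x3. SW (\<lambda>y2 y3. K (x1 * y1) (x2 * y2) (x3 * y3)) s) r) y) x"
    by (intro SW_cong SW_mult) (intro L)+
  finally show ?thesis .
qed

subsection \<open>Sweedler sums in \<open>CT(H)\<close>\<close>

lemma comp_CT [simp]: "comp CT = (\<lambda>_. CT_space)" and cop_CT [simp]: "cop CT = CT_cop"
  and cou_CT [simp]: "cou CT = CT_cou" and tmult_CT [simp]: "tmult CT = CT_mult"
  and tunit_CT [simp]: "tunit CT = (\<epsilon> \<bowtie> 1)" and antip_CT [simp]: "antip CT = CT_antip"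
  and cross_CT [simp]: "cross CT = CT_cross"
  by (simp_all add: CT_def)

text \<open>Matrix entries of the endomorphism serve as coordinates. Tensored with themselves they
  show that products of values f(F(x)) determine elements of the tensor square and tensor
  cube.\<close>

lemma coord_system_CT_fun:
  "coord_system CT_space (Basis \<times> Basis) (\<lambda>(i, j). dual_basis i \<bowtie> j)
    (\<lambda>(i, j) t. dual_basis j (CT_fun t i))"
proof -
  have "v = (\<Sum>(i, j)\<in>Basis \<times> Basis. pscale (dual_basis j (CT_fun v i)) (dual_basis i \<bowtie> j))"
    if v: "v \<in> carrier CT_space" for v
  proof -
    have "v = (\<Sum>(i, j)\<in>Basis \<times> Basis. pscale (v (\<lambda>p h. p i * dual_basis j h)) (dual_basis i \<bowtie> j))"
      using coord_system_CT v by (simp add: coord_system_def bow_def case_prod_unfold)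
    then show ?thesis by (simp only: lk_CT_fun[OF v lk_dual_basis])
  qed
  then show ?thesis
    using finite_Basis is_vspace_CT
    by (auto simp: coord_system_def case_prod_unfold bow_closed[OF lk_dual_basis]
        lm_lk[OF lk_dual_basis linear_CT_fun])
qed

lemma CC_eqI:
  assumes "A \<in> carrier CC" "B \<in> carrier CC"
    and "\<And>x y f g. lk f \<Longrightarrow> lk g \<Longrightarrow>
      A (\<lambda>s s'. f (CT_fun s x) * g (CT_fun s' y)) = B (\<lambda>s s'. f (CT_fun s x) * g (CT_fun s' y))"
  shows "A = B"
  by (rule coord_system_eqI[OF coord_system_tensor[OF coord_system_CT_fun coord_system_CT_fun] assms(1,2)])
    (auto intro: assms(3) lk_dual_basis)

lemma CCC_eqI:
  assumes "A \<in> carrier (tensor_space CC CT_space)" "B \<in> carrier (tensor_space CC CT_space)"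
    and "\<And>x y z f g h. lk f \<Longrightarrow> lk g \<Longrightarrow> lk h \<Longrightarrow>
      A (\<lambda>t s. t (\<lambda>s s'. f (CT_fun s x) * g (CT_fun s' y)) * h (CT_fun s z)) =
      B (\<lambda>t s. t (\<lambda>s s'. f (CT_fun s x) * g (CT_fun s' y)) * h (CT_fun s z))"
  shows "A = B"
  by (rule coord_system_eqI[OF coord_system_tensor[OF coord_system_tensor[OF coord_system_CT_fun
          coord_system_CT_fun] coord_system_CT_fun] assms(1,2)])
    (auto intro: assms(3) lk_dual_basis)

lemma CT_cop_closed:
  assumes "a \<in> carrier G" "t \<in> carrier CT_space"
  shows "CT_cop a t \<in> carrier CC"
  using assms linear_map_closed[OF linear_CT_cop] by (cases a) (auto simp: carrier_G)

lemma CT_cop_cong: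
  assumes "a \<in> carrier G" "t \<in> carrier CT_space"
    and "\<And>s s'. s \<in> carrier CT_space \<Longrightarrow> s' \<in> carrier CT_space \<Longrightarrow> B s s' = C s s'"
  shows "CT_cop a t B = CT_cop a t C"
  by (rule tensor_cong[OF CT_cop_closed[OF assms(1,2)] is_vspace_CT is_vspace_CT assms(3)])

lemma CT_cop_SW:
  assumes "a \<in> carrier G" "t \<in> carrier CT_space"
    and "\<And>u v. bilinear_map CT_space CT_space scalars (\<lambda>s s'. B u v s s')"
  shows "CT_cop a t (\<lambda>s s'. SW (\<lambda>u v. B u v s s') z) = SW (\<lambda>u v. CT_cop a t (B u v)) z"
  unfolding SW_def by (rule tensor_sum[OF CT_cop_closed[OF assms(1,2)] assms(3)])

text \<open>At y = 1 all legs of y are 1 and the two outer factors of the first leg vanish. What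
  remains is the coproduct of H applied to F(x).\<close>

lemma CT_cop_apply_one:
  assumes "a \<in> carrier G" "t \<in> carrier CT_space" "\<And>a. lk (\<Psi> a)" "\<And>b. lk (\<lambda>a. \<Psi> a b)"
  shows "CT_cop a t (\<lambda>s s'. \<Psi> (CT_fun s x) (CT_fun s' 1)) = SW \<Psi> (CT_fun t x)"
proof (cases a)
  case (Pair \<alpha> \<beta>)
  then have aut: "\<alpha> \<in> Aut_Hopf" "\<beta> \<in> Aut_Hopf" using assms(1) by (auto simp: carrier_G)
  note L = lin_intros' lin_comp[OF assms(3)] lin_comp[OF assms(4)] lin_comp[OF lh_Aut[OF aut(1)]]
    lin_comp[OF lh_Aut[OF aut(2)]] lin_comp[OF lh_CT_fun[OF assms(2)]]
  show ?thesis
    unfolding Pair CT_cop_apply[OF aut assms(2-4)]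
    by (subst SW_one, (intro L)+, subst SW_one, (intro L)+)
      (simp add: Aut_one[OF aut(1)] Aut_one[OF aut(2)] S_inv_one)
qed

text \<open>Applying \<epsilon> to the first value removes both outer factors and leaves (x, y) ->
  F(x y). As \<sigma> only sees K(1) and \<epsilon> of F, this lemma and the preceding one supply
  the coproducts needed for its inverse, TCT1 and TCT2.\<close>

lemma CT_cop_apply_counit:
  assumes "a \<in> carrier G" "t \<in> carrier CT_space" "lk f"
  shows "CT_cop a t (\<lambda>s s'. \<epsilon> (CT_fun s x) * f (CT_fun s' y)) = f (CT_fun t (x * y))"
proof (cases a)
  case (Pair \<alpha> \<beta>)
  then have aut: "\<alpha> \<in> Aut_Hopf" "\<beta> \<in> Aut_Hopf" using assms(1) by (auto simp: carrier_G)
  note L = lin_intros' lin_comp[OF assms(3)] lin_comp[OF lh_Aut[OF aut(1)]]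
    lin_comp[OF lh_Aut[OF aut(2)]] lin_comp[OF lh_CT_fun[OF assms(2)]] lin_comp[OF lk_counit]
  have u: "SW (\<lambda>u v. \<epsilon> (\<beta> c * u * S_inv (\<alpha> a)) * f v) h = \<epsilon> a * (\<epsilon> c * f h)" for a c h
  proof -
    have "SW (\<lambda>u v. \<epsilon> (\<beta> c * u * S_inv (\<alpha> a)) * f v) h = \<epsilon> a * (\<epsilon> c * SW (\<lambda>u v. \<epsilon> u * f v) h)"
      by (simp add: counit_mult Aut_counit[OF aut(1)] Aut_counit[OF aut(2)] counit_S_inv SW_mult_right
          mult_ac)
    then show ?thesis by (simp add: SW_counit_left[OF assms(3)])
  qed
  have c: "SW (\<lambda>b c. \<epsilon> c * f (CT_fun t (x * b))) r = f (CT_fun t (x * r))" for r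
    by (rule SW_counit_right) (intro L)
  have a: "SW (\<lambda>a r. \<epsilon> a * f (CT_fun t (x * r))) y = f (CT_fun t (x * y))"
    by (rule SW_counit_left) (intro L)
  have "CT_cop (\<alpha>, \<beta>) t (\<lambda>s s'. \<epsilon> (CT_fun s x) * f (CT_fun s' y)) =
      SW (\<lambda>a r. SW (\<lambda>b c. SW (\<lambda>u v. \<epsilon> (\<beta> c * u * S_inv (\<alpha> a)) * f v) (CT_fun t (x * b))) r) y"
    by (rule CT_cop_apply[OF aut assms(2)]) (intro L)+
  also have "\<dots> = f (CT_fun t (x * y))"
    by (simp only: u SW_mult_right[symmetric] c a)
  finally show ?thesis by (simp add: Pair)
qed

lemma linear_sweedler:
  assumes "a \<in> carrier G" "t \<in> carrier CT_space" "is_vspace X"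
    "bilinear_map CT_space CT_space X B" "linear_map X scalars L"
  shows "L (sweedler CT a X B t) = CT_cop a t (\<lambda>s s'. L (B s s'))"
  unfolding sweedler_def comp_CT cop_CT
  by (rule linear_tensor_lift[OF is_vspace_CT is_vspace_CT assms(3-5) CT_cop_closed[OF assms(1,2)]])

lemma sweedler_closed:
  assumes "a \<in> carrier G" "t \<in> carrier CT_space" "is_vspace X" "bilinear_map CT_space CT_space X B"
  shows "sweedler CT a X B t \<in> carrier X"
  unfolding sweedler_def comp_CT cop_CT
  by (rule linear_map_closed[OF tensor_lift_linear[OF assms(3,4)] CT_cop_closed[OF assms(1,2)]])

lemma sweedler_scalars:
  assumes "a \<in> carrier G" "t \<in> carrier CT_space" "bilinear_map CT_space CT_space scalars B"
  shows "sweedler CT a scalars B t = CT_cop a t B"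
  using linear_sweedler[OF assms(1,2) is_vspace_scalars assms(3), of "\<lambda>x. x"]
  by (simp add: linear_map_def)

lemma sweedler2_bilinear:
  assumes "b \<in> carrier G" "t \<in> carrier CT_space" "is_vspace X"
    and "\<And>x1 x2. x1 \<in> carrier CT_space \<Longrightarrow> x2 \<in> carrier CT_space \<Longrightarrow>
      bilinear_map CT_space CT_space X (B x1 x2)"
    and "\<And>y1 y2. y1 \<in> carrier CT_space \<Longrightarrow> y2 \<in> carrier CT_space \<Longrightarrow>
      bilinear_map CT_space CT_space X (\<lambda>x1 x2. B x1 x2 y1 y2)"
  shows "bilinear_map CT_space CT_space X (\<lambda>x1 x2. sweedler CT b X (B x1 x2) t)"
  unfolding sweedler_def comp_CT cop_CT
  by (intro bilinear_mapI linear_tensor_lift_param[OF is_vspace_CT is_vspace_CT assms(3) is_vspace_CT _ _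
        CT_cop_closed[OF assms(1,2)]] assms(4) bilinear_map_left[OF assms(5)]
      bilinear_map_right[OF assms(5)])

lemma linear_sweedler2:
  assumes "a \<in> carrier G" "s \<in> carrier CT_space" "b \<in> carrier G" "t \<in> carrier CT_space" "is_vspace X"
    and "\<And>x1 x2. x1 \<in> carrier CT_space \<Longrightarrow> x2 \<in> carrier CT_space \<Longrightarrow>
      bilinear_map CT_space CT_space X (B x1 x2)"
    and "\<And>y1 y2. y1 \<in> carrier CT_space \<Longrightarrow> y2 \<in> carrier CT_space \<Longrightarrow>
      bilinear_map CT_space CT_space X (\<lambda>x1 x2. B x1 x2 y1 y2)"
    and "linear_map X scalars L"
  shows "L (sweedler CT a X (\<lambda>x1 x2. sweedler CT b X (B x1 x2) t) s) =
    CT_cop a s (\<lambda>x1 x2. CT_cop b t (\<lambda>y1 y2. L (B x1 x2 y1 y2)))"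
  by (rule trans[OF linear_sweedler[OF assms(1,2,5) sweedler2_bilinear[OF assms(3-7)] assms(8)]],
      assumption+, rule CT_cop_cong[OF assms(1,2)], rule linear_sweedler[OF assms(3,4,5) assms(6) assms(8)])

subsection \<open>The coalgebra structure of the components\<close>

lemma linear_CT_cou: "linear_map CT_space scalars (CT_cou a)"
  by (rule linear_map_cong[OF lm_lk[OF lk_counit linear_CT_fun[of 1]] is_vspace_CT CT_cou_eq])

lemma linear_CT_cop': "a \<in> carrier G \<Longrightarrow> linear_map CT_space CC (CT_cop a)"
  using linear_CT_cop by (cases a) (auto simp: carrier_G)

text \<open>The coproduct of the first leg of an element of CT(H). The legs of a occur in reversed
  order because \<open>S_inv\<close> reverses coproducts.\<close>

lemma SW_twist:
  assumes "\<alpha> \<in> Aut_Hopf" "\<beta> \<in> Aut_Hopf" "\<And>a. lk (M a)" "\<And>b. lk (\<lambda>a. M a b)"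
  shows "SW M (\<beta> c * p * S_inv (\<alpha> a)) = SW (\<lambda>d e. SW (\<lambda>p1 p2. SW (\<lambda>a1 a2.
    M (\<beta> d * p1 * S_inv (\<alpha> a2)) (\<beta> e * p2 * S_inv (\<alpha> a1))) a) p) c"
proof -
  note L = lin_intros' assms(3,4)[THEN lin_comp] assms(1,2)[THEN lh_Aut, THEN lin_comp]
  have "SW M (\<beta> c * p * S_inv (\<alpha> a)) = SW (\<lambda>x1 x2. SW (\<lambda>y1 y2. M (x1 * y1) (x2 * y2)) (S_inv (\<alpha> a))) (\<beta> c * p)"
    by (rule SW_mult) (intro L)+
  also have "\<dots> = SW (\<lambda>d e. SW (\<lambda>p1 p2. SW (\<lambda>y1 y2. M (d * p1 * y1) (e * p2 * y2)) (S_inv (\<alpha> a))) p) (\<beta> c)"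
    by (rule SW_mult) (intro L)+
  also have "\<dots> = SW (\<lambda>d e. SW (\<lambda>p1 p2. SW (\<lambda>y1 y2. M (\<beta> d * p1 * y1) (\<beta> e * p2 * y2)) (S_inv (\<alpha> a))) p) c"
    by (rule SW_Aut[OF assms(2)]) (intro L)+
  also have "\<dots> = SW (\<lambda>d e. SW (\<lambda>p1 p2. SW (\<lambda>a1 a2.
      M (\<beta> d * p1 * S_inv a2) (\<beta> e * p2 * S_inv a1)) (\<alpha> a)) p) c"
    by (intro SW_cong SW_S_inv) (intro L)+
  also have "\<dots> = SW (\<lambda>d e. SW (\<lambda>p1 p2. SW (\<lambda>a1 a2.
      M (\<beta> d * p1 * S_inv (\<alpha> a2)) (\<beta> e * p2 * S_inv (\<alpha> a1))) a) p) c"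
    by (intro SW_cong SW_Aut[OF assms(1)]) (intro L)+
  finally show ?thesis .
qed

text \<open>Both iterated coproducts send (x, y, z) to \<beta>(y_3 z_4) p_1 S^{-1}\<alpha>(y_1 z_2)
  \<otimes> \<beta>(z_5) p_2 S^{-1}\<alpha>(z_1) \<otimes> p_3, where p = F(x y_2 z_3). One
  bracketing obtains it by splitting the twisted first leg, the other by splitting the product y
  z_2.\<close>

lemma CT_coassoc:
  assumes a: "a \<in> carrier G" and t: "t \<in> carrier CT_space" and lk: "lk f" "lk g" "lk h"
  shows "CT_cop a t (\<lambda>x1 x2. CT_cop a x1 (\<lambda>u v. f (CT_fun u x) * g (CT_fun v y)) * h (CT_fun x2 z)) =
    CT_cop a t (\<lambda>x1 x2. CT_cop a x2 (\<lambda>u v. f (CT_fun x1 x) * g (CT_fun u y) * h (CT_fun v z)))"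
proof -
  obtain \<alpha> \<beta> where ab: "a = (\<alpha>, \<beta>)" and aut: "\<alpha> \<in> Aut_Hopf" "\<beta> \<in> Aut_Hopf"
    using a by (cases a) (auto simp: carrier_G)
  note L0 = lin_intros' lk[THEN lin_comp] lk aut[THEN lh_Aut, THEN lin_comp]
  note L = L0 lin_comp[OF lh_CT_fun[OF t]]
  note LM = bilinear_mapI lm_intros lk[THEN lm_lk] aut[THEN lh_Aut, THEN lm_lh]
  let ?M = "\<lambda>y1 y3 p. SW (\<lambda>u v. f (\<beta> y3 * u * S_inv (\<alpha> y1)) * g v) p"
  let ?K = "\<lambda>y1 y2 y3 z1 z2 z3 z4 z5. SW (\<lambda>p1 r. SW (\<lambda>p2 q.
    f (\<beta> y3 * (\<beta> z4 * p1 * S_inv (\<alpha> z2)) * S_inv (\<alpha> y1)) * g (\<beta> z5 * p2 * S_inv (\<alpha> z1)) * h q) r)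
      (CT_fun t (x * y2 * z3))"
  have "CT_cop a t (\<lambda>x1 x2. CT_cop a x1 (\<lambda>u v. f (CT_fun u x) * g (CT_fun v y)) * h (CT_fun x2 z)) =
      CT_cop a t (\<lambda>x1 x2. SW (\<lambda>y1 r. SW (\<lambda>y2 y3.
        ?M y1 y3 (CT_fun x1 (x * y2)) * h (CT_fun x2 z)) r) y)"
  proof (rule CT_cop_cong[OF a t])
    fix s s' assume s: "s \<in> carrier CT_space"
    have "CT_cop a s (\<lambda>u v. f (CT_fun u x) * g (CT_fun v y)) =
        SW (\<lambda>y1 r. SW (\<lambda>y2 y3. ?M y1 y3 (CT_fun s (x * y2))) r) y"
      unfolding ab by (rule CT_cop_apply[OF aut s]) (intro L0)+
    then show "CT_cop a s (\<lambda>u v. f (CT_fun u x) * g (CT_fun v y)) * h (CT_fun s' z) =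
        SW (\<lambda>y1 r. SW (\<lambda>y2 y3. ?M y1 y3 (CT_fun s (x * y2)) * h (CT_fun s' z)) r) y"
      by (simp only: SW_mult_left)
  qed
  also have "\<dots> = SW (\<lambda>y1 r. CT_cop a t (\<lambda>x1 x2. SW (\<lambda>y2 y3.
        ?M y1 y3 (CT_fun x1 (x * y2)) * h (CT_fun x2 z)) r)) y"
    by (rule CT_cop_SW[OF a t]) (intro LM linear_CT_fun lk[THEN lin_comp] L0)
  also have "\<dots> = SW (\<lambda>y1 r. SW (\<lambda>y2 y3. CT_cop a t (\<lambda>x1 x2.
        ?M y1 y3 (CT_fun x1 (x * y2)) * h (CT_fun x2 z))) r) y"
    by (intro SW_cong CT_cop_SW[OF a t]) (intro LM linear_CT_fun L0)
  also have "\<dots> = SW (\<lambda>y1 r1. SW (\<lambda>y2 y3. SW (\<lambda>s r. SW (\<lambda>z3 c.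
      SW (\<lambda>p q. ?M y1 y3 (\<beta> c * p * S_inv (\<alpha> s)) * h q) (CT_fun t (x * y2 * z3))) r) z) r1) y"
    unfolding ab by (intro SW_cong CT_cop_apply[OF aut t]) (intro L0)+
  also have "\<dots> = SW (\<lambda>y1 r1. SW (\<lambda>y2 y3. SW (\<lambda>s r. SW (\<lambda>z3 c.
      SW (\<lambda>z4 z5. SW (\<lambda>z1 z2. ?K y1 y2 y3 z1 z2 z3 z4 z5) s) c) r) z) r1) y"
  proof (intro SW_cong)
    fix y1 y2 y3 s z3 c
    let ?X = "\<lambda>z1 z2 z4 z5 p1 p2 q. f (\<beta> y3 * (\<beta> z4 * p1 * S_inv (\<alpha> z2)) * S_inv (\<alpha> y1)) *
      g (\<beta> z5 * p2 * S_inv (\<alpha> z1)) * h q"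
    let ?F = "CT_fun t (x * y2 * z3)"
    have "SW (\<lambda>p q. ?M y1 y3 (\<beta> c * p * S_inv (\<alpha> s)) * h q) ?F =
        SW (\<lambda>p q. SW (\<lambda>z4 z5. SW (\<lambda>p1 p2. SW (\<lambda>z1 z2. ?X z1 z2 z4 z5 p1 p2 q) s) p) c) ?F"
      unfolding SW_mult_left by (intro SW_cong SW_twist[OF aut]) (intro L0)+
    also have "\<dots> = SW (\<lambda>z4 z5. SW (\<lambda>p q. SW (\<lambda>z1 z2. SW (\<lambda>p1 p2. ?X z1 z2 z4 z5 p1 p2 q) p) s) ?F) c"
      by (rule trans[OF SW_swap], intro SW_cong, rule SW_swap)
    also have "\<dots> = SW (\<lambda>z4 z5. SW (\<lambda>z1 z2. SW (\<lambda>p q. SW (\<lambda>p1 p2. ?X z1 z2 z4 z5 p1 p2 q) p) ?F) s) c"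
      by (intro SW_cong, rule SW_swap)
    also have "\<dots> = SW (\<lambda>z4 z5. SW (\<lambda>z1 z2. SW (\<lambda>p1 r. SW (\<lambda>p2 q. ?X z1 z2 z4 z5 p1 p2 q) r) ?F) s) c"
      by (intro SW_cong SW_coassoc) (intro L0)+
    finally show "SW (\<lambda>p q. ?M y1 y3 (\<beta> c * p * S_inv (\<alpha> s)) * h q) ?F =
        SW (\<lambda>z4 z5. SW (\<lambda>z1 z2. ?K y1 y2 y3 z1 z2 z3 z4 z5) s) c" .
  qed
  \<comment> \<open>The legs z_2, z_3, z_4 are to become the legs of a single element b, as they do
    on the other side, where b multiplies y before the splitting.\<close>
  also have "\<dots> = SW (\<lambda>y1 r1. SW (\<lambda>y2 y3. SW (\<lambda>z1 r. SW (\<lambda>b z5.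
      SW (\<lambda>z2 s. SW (\<lambda>z3 z4. ?K y1 y2 y3 z1 z2 z3 z4 z5) s) b) r) z) r1) y"
    by (intro SW_cong SW_coassoc5) (intro L)+
  also have "\<dots> = SW (\<lambda>y1 r1. SW (\<lambda>z1 r. SW (\<lambda>b z5. SW (\<lambda>z2 s.
      SW (\<lambda>y2 y3. SW (\<lambda>z3 z4. ?K y1 y2 y3 z1 z2 z3 z4 z5) s) r1) b) r) z) y"
    by (rule SW_cong, rule trans[OF SW_swap], rule SW_cong, rule trans[OF SW_swap], rule SW_cong,
        rule SW_swap)
  also have "\<dots> = SW (\<lambda>z1 r. SW (\<lambda>b z5. SW (\<lambda>y1 r1. SW (\<lambda>z2 s.
      SW (\<lambda>y2 y3. SW (\<lambda>z3 z4. ?K y1 y2 y3 z1 z2 z3 z4 z5) s) r1) b) y) r) z"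
    by (rule trans[OF SW_swap], rule SW_cong, rule SW_swap)
  finally have 1: "CT_cop a t (\<lambda>x1 x2.
      CT_cop a x1 (\<lambda>u v. f (CT_fun u x) * g (CT_fun v y)) * h (CT_fun x2 z)) = \<dots>" .
  let ?N = "\<lambda>z1 z5 p q. SW (\<lambda>u v. f p * g (\<beta> z5 * u * S_inv (\<alpha> z1)) * h v) q"
  have "CT_cop a t (\<lambda>x1 x2. CT_cop a x2 (\<lambda>u v. f (CT_fun x1 x) * g (CT_fun u y) * h (CT_fun v z))) =
      CT_cop a t (\<lambda>x1 x2. SW (\<lambda>z1 r. SW (\<lambda>b z5. ?N z1 z5 (CT_fun x1 x) (CT_fun x2 (y * b))) r) z)"
  proof (rule CT_cop_cong[OF a t])
    fix s s' assume s': "s' \<in> carrier CT_space"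
    show "CT_cop a s' (\<lambda>u v. f (CT_fun s x) * g (CT_fun u y) * h (CT_fun v z)) =
        SW (\<lambda>z1 r. SW (\<lambda>b z5. ?N z1 z5 (CT_fun s x) (CT_fun s' (y * b))) r) z"
      unfolding ab by (rule CT_cop_apply[OF aut s']) (intro L0)+
  qed
  also have "\<dots> = SW (\<lambda>z1 r. CT_cop a t (\<lambda>x1 x2.
      SW (\<lambda>b z5. ?N z1 z5 (CT_fun x1 x) (CT_fun x2 (y * b))) r)) z"
    by (rule CT_cop_SW[OF a t]) (intro LM linear_CT_fun)
  also have "\<dots> = SW (\<lambda>z1 r. SW (\<lambda>b z5. CT_cop a t (\<lambda>x1 x2.
      ?N z1 z5 (CT_fun x1 x) (CT_fun x2 (y * b)))) r) z"
    by (intro SW_cong CT_cop_SW[OF a t]) (intro LM linear_CT_fun)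
  also have "\<dots> = SW (\<lambda>z1 r. SW (\<lambda>b z5. SW (\<lambda>a r'. SW (\<lambda>b' c'.
      SW (\<lambda>p q. ?N z1 z5 (\<beta> c' * p * S_inv (\<alpha> a)) q) (CT_fun t (x * b'))) r') (y * b)) r) z"
    unfolding ab by (intro SW_cong CT_cop_apply[OF aut t]) (intro L0)+
  \<comment> \<open>Here the coproduct is evaluated at y b, so its three legs are the products y_1
    z_2, y_2 z_3, y_3 z_4.\<close>
  also have "\<dots> = SW (\<lambda>z1 r. SW (\<lambda>b z5. SW (\<lambda>y1 r1. SW (\<lambda>z2 s. SW (\<lambda>y2 y3. SW (\<lambda>z3 z4.
      SW (\<lambda>p q. ?N z1 z5 (\<beta> (y3 * z4) * p * S_inv (\<alpha> (y1 * z2))) q) (CT_fun t (x * (y2 * z3)))) s) r1) b) y) r) z"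
    by (intro SW_cong SW3_mult) (intro L)+
  also have "\<dots> = SW (\<lambda>z1 r. SW (\<lambda>b z5. SW (\<lambda>y1 r1. SW (\<lambda>z2 s.
      SW (\<lambda>y2 y3. SW (\<lambda>z3 z4. ?K y1 y2 y3 z1 z2 z3 z4 z5) s) r1) b) y) r) z"
    by (simp only: aut[THEN Aut_mult] S_inv_mult mult.assoc)
  finally show ?thesis using 1 by simp
qed

lemma coalgebra_CT:
  assumes a: "a \<in> carrier G"
  shows "coalgebra CT_space (CT_cop a) (CT_cou a)"
proof -
  let ?X = "tensor_space CC CT_space"
  have vs: "is_vspace ?X" by (rule is_vspace_tensor_space)
  have coassoc: "tensor_lift CT_space CT_space ?X (\<lambda>x1 x2. tensor_lift CT_space CT_space ?X
      (\<lambda>u v. pure CC CT_space (pure CT_space CT_space u v) x2) (CT_cop a x1)) (CT_cop a t) =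
    tensor_lift CT_space CT_space ?X (\<lambda>x1 x2. tensor_lift CT_space CT_space ?X
      (\<lambda>u v. pure CC CT_space (pure CT_space CT_space x1 u) v) (CT_cop a x2)) (CT_cop a t)"
    (is "tensor_lift _ _ _ ?I1 _ = tensor_lift _ _ _ ?I2 _")
    if t: "t \<in> carrier CT_space" for t
  proof (rule CCC_eqI)
    note ct = CT_cop_closed[OF a t]
    have B1: "bilinear_map CT_space CT_space ?X (\<lambda>u v. pure CC CT_space (pure CT_space CT_space u v) x2)"
      if "x2 \<in> carrier CT_space" for x2
      by (intro bilinear_mapI lm_pure_left lm_pure_right lm_id that)
    have B2: "bilinear_map CT_space CT_space ?X (\<lambda>u v. pure CC CT_space (pure CT_space CT_space x1 u) v)"
      if "x1 \<in> carrier CT_space" for x1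
      by (intro bilinear_mapI lm_pure_left lm_pure_right lm_id that pure_closed)
    \<comment> \<open>The lift in \<open>?I1\<close> is a separate choice for each x2; that it
      varies linearly with x2 is supplied by \<open>linear_tensor_lift_param\<close>.\<close>
    have I1: "bilinear_map CT_space CT_space ?X ?I1"
    proof (rule bilinear_mapI)
      fix x1 assume "x1 \<in> carrier CT_space"
      then show "linear_map CT_space ?X (?I1 x1)"
        by (intro linear_tensor_lift_param[OF is_vspace_CT is_vspace_CT vs is_vspace_CT B1]
            CT_cop_closed[OF a] lm_pure_right lm_id pure_closed)
    next
      fix x2 assume "x2 \<in> carrier CT_space"
      then show "linear_map CT_space ?X (\<lambda>x1. ?I1 x1 x2)"
        by (intro linear_map_comp[OF linear_CT_cop'[OF a] tensor_lift_linear[OF vs B1]])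
    qed
    have I2: "bilinear_map CT_space CT_space ?X ?I2"
    proof (rule bilinear_mapI)
      fix x2 assume "x2 \<in> carrier CT_space"
      then show "linear_map CT_space ?X (\<lambda>x1. ?I2 x1 x2)"
        by (intro linear_tensor_lift_param[OF is_vspace_CT is_vspace_CT vs is_vspace_CT B2]
            CT_cop_closed[OF a] lm_pure_left lm_id)
    next
      fix x1 assume "x1 \<in> carrier CT_space"
      then show "linear_map CT_space ?X (?I2 x1)"
        by (intro linear_map_comp[OF linear_CT_cop'[OF a] tensor_lift_linear[OF vs B2]])
    qed
    show "tensor_lift CT_space CT_space ?X ?I1 (CT_cop a t) \<in> carrier ?X"
      "tensor_lift CT_space CT_space ?X ?I2 (CT_cop a t) \<in> carrier ?X"
      by (rule linear_map_closed[OF tensor_lift_linear[OF vs I1] ct],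
          rule linear_map_closed[OF tensor_lift_linear[OF vs I2] ct])
    fix x y z and f g h :: "'h \<Rightarrow> 'k" assume lk: "lk f" "lk g" "lk h"
    let ?D = "\<lambda>s s'. f (CT_fun s x) * g (CT_fun s' y)"
    let ?C = "\<lambda>t s. t ?D * h (CT_fun s z)"
    have D: "bilinear_map CT_space CT_space scalars ?D"
      by (intro bilinear_mapI lm_kmult_left lm_kmult_right lk[THEN lm_lk] linear_CT_fun)
    have C: "bilinear_map CC CT_space scalars ?C"
      by (intro bilinear_mapI lm_kmult_left lm_kmult_right lk[THEN lm_lk] linear_CT_fun eval_linear)
    have "tensor_lift CT_space CT_space ?X ?I1 (CT_cop a t) ?C =
        CT_cop a t (\<lambda>x1 x2. ?I1 x1 x2 ?C)" (is "?lhs = _")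
      by (rule tensor_lift_apply[OF is_vspace_CT is_vspace_CT I1 ct])
    also have "\<dots> = CT_cop a t (\<lambda>x1 x2. CT_cop a x1 ?D * h (CT_fun x2 z))"
    proof (rule CT_cop_cong[OF a t])
      fix x1 x2 assume x: "x1 \<in> carrier CT_space" "x2 \<in> carrier CT_space"
      note c1 = CT_cop_closed[OF a x(1)]
      have "?I1 x1 x2 ?C = CT_cop a x1 (\<lambda>u v. h (CT_fun x2 z) * ?D u v)"
        by (subst tensor_lift_apply[OF is_vspace_CT is_vspace_CT B1[OF x(2)] c1])
          (simp only: pure_apply[OF C] pure_apply[OF D], simp only: mult.commute)
      also have "\<dots> = h (CT_fun x2 z) * CT_cop a x1 ?D"
        by (rule tensor_scale[OF c1 D])
      finally show "?I1 x1 x2 ?C = CT_cop a x1 ?D * h (CT_fun x2 z)" by simp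
    qed
    also have "\<dots> = CT_cop a t (\<lambda>x1 x2.
        CT_cop a x2 (\<lambda>u v. f (CT_fun x1 x) * g (CT_fun u y) * h (CT_fun v z)))"
      by (rule CT_coassoc[OF a t lk])
    also have "\<dots> = CT_cop a t (\<lambda>x1 x2. ?I2 x1 x2 ?C)"
    proof (rule CT_cop_cong[OF a t])
      fix x1 x2 assume x: "x1 \<in> carrier CT_space" "x2 \<in> carrier CT_space"
      show "CT_cop a x2 (\<lambda>u v. f (CT_fun x1 x) * g (CT_fun u y) * h (CT_fun v z)) = ?I2 x1 x2 ?C"
        by (subst tensor_lift_apply[OF is_vspace_CT is_vspace_CT B2[OF x(1)] CT_cop_closed[OF a x(2)]])
          (simp add: pure_apply[OF C] pure_apply[OF D])
    qed
    also have "\<dots> = tensor_lift CT_space CT_space ?X ?I2 (CT_cop a t) ?C"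
      by (rule tensor_lift_apply[OF is_vspace_CT is_vspace_CT I2 ct, symmetric])
    finally show "?lhs = \<dots>" .
  qed
  have scal: "linear_map CT_space CT_space (\<lambda>x. scal CT_space c x)" for c
    by (intro linear_mapI vs_scal[OF is_vspace_CT] vs_scal_add[OF is_vspace_CT])
      (simp_all add: vs_scal_scal[OF is_vspace_CT, simplified] mult.commute)
  have scal': "linear_map CT_space CT_space (\<lambda>x. scal CT_space (CT_cou a x) y)"
    if "y \<in> carrier CT_space" for y
    by (intro linear_mapI vs_scal[OF is_vspace_CT] that)
      (simp_all add: linear_map_add[OF linear_CT_cou] linear_map_scal[OF linear_CT_cou, simplified]
        vs_scal_scal[OF is_vspace_CT, simplified] vs_scal_add_left[OF is_vspace_CT, simplified])
  \<comment> \<open>Both counit laws are identities of endomorphisms, so it is enough to compare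
    values at each x under each functional f.\<close>
  have fin: "sweedler CT a CT_space B t = t"
    if t: "t \<in> carrier CT_space" and B: "bilinear_map CT_space CT_space CT_space B"
      and eq: "\<And>f x. lk f \<Longrightarrow> CT_cop a t (\<lambda>s s'. f (CT_fun (B s s') x)) = f (CT_fun t x)" for t B
  proof (rule CT_eqI[OF sweedler_closed[OF a t is_vspace_CT B] t], rule lk_separates)
    fix x and f :: "'h \<Rightarrow> 'k" assume f: "lk f"
    show "f (CT_fun (sweedler CT a CT_space B t) x) = f (CT_fun t x)"
      using linear_sweedler[OF a t is_vspace_CT B lm_lk[OF f linear_CT_fun[of x]]] eq[OF f] by simp
  qed
  have counit1: "sweedler CT a CT_space (\<lambda>x1 x2. scal CT_space (CT_cou a x1) x2) t = t"
    if t: "t \<in> carrier CT_space" for t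
  proof (rule fin[OF t bilinear_mapI[OF scal scal']])
    fix x and f :: "'h \<Rightarrow> 'k" assume f: "lk f"
    have "CT_cop a t (\<lambda>s s'. f (CT_fun (scal CT_space (CT_cou a s) s') x)) =
        CT_cop a t (\<lambda>s s'. \<epsilon> (CT_fun s 1) * f (CT_fun s' x))"
      by (rule CT_cop_cong[OF a t]) (simp add: lin_scale[OF f] CT_cou_eq)
    also have "\<dots> = f (CT_fun t (1 * x))" by (rule CT_cop_apply_counit[OF a t f])
    finally show "CT_cop a t (\<lambda>s s'. f (CT_fun (scal CT_space (CT_cou a s) s') x)) = f (CT_fun t x)"
      by simp
  qed
  have counit2: "sweedler CT a CT_space (\<lambda>x1 x2. scal CT_space (CT_cou a x2) x1) t = t"
    if t: "t \<in> carrier CT_space" for t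
  proof (rule fin[OF t bilinear_mapI[OF scal' scal]])
    fix x and f :: "'h \<Rightarrow> 'k" assume f: "lk f"
    have "CT_cop a t (\<lambda>s s'. f (CT_fun (scal CT_space (CT_cou a s') s) x)) =
        CT_cop a t (\<lambda>s s'. \<epsilon> (CT_fun s' 1) * f (CT_fun s x))" (is "?lhs = _")
      by (rule CT_cop_cong[OF a t]) (simp add: lin_scale[OF f] CT_cou_eq)
    also have "\<dots> = SW (\<lambda>p q. \<epsilon> q * f p) (CT_fun t x)"
      by (rule CT_cop_apply_one[OF a t]) (intro lin_intros lin_comp[OF f] f)+
    also have "\<dots> = f (CT_fun t x)" by (rule SW_counit_right[OF f])
    finally show "?lhs = \<dots>" .
  qed
  show ?thesis
    unfolding coalgebra_def Let_def
    using is_vspace_CT linear_CT_cop'[OF a] linear_CT_cou coassoc counit1 counit2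
    by (simp add: sweedler_def)
qed

subsection \<open>Multiplication, antipode and crossing\<close>

lemma CT_mult_bilinear:
  assumes "a \<in> carrier G" "b \<in> carrier G"
  shows "bilinear_map CT_space CT_space CT_space (CT_mult a b)"
  using assms bilinear_CT_mult by (cases a; cases b) (auto simp: carrier_G)

lemma CT_mult_closed:
  assumes "a \<in> carrier G" "b \<in> carrier G" "s \<in> carrier CT_space" "t \<in> carrier CT_space"
  shows "CT_mult a b s t \<in> carrier CT_space"
  by (rule bilinear_map_closed[OF CT_mult_bilinear[OF assms(1,2)] assms(3,4)])

lemma lm_CT_mult_left:
  assumes "a \<in> carrier G" "b \<in> carrier G" "t \<in> carrier CT_space" "linear_map V CT_space f"
  shows "linear_map V CT_space (\<lambda>v. CT_mult a b (f v) t)"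
  by (rule linear_map_comp[OF assms(4) bilinear_map_left[OF CT_mult_bilinear[OF assms(1,2)] assms(3)]])

lemma lm_CT_mult_right:
  assumes "a \<in> carrier G" "b \<in> carrier G" "s \<in> carrier CT_space" "linear_map V CT_space f"
  shows "linear_map V CT_space (\<lambda>v. CT_mult a b s (f v))"
  by (rule linear_map_comp[OF assms(4) bilinear_map_right[OF CT_mult_bilinear[OF assms(1,2)] assms(3)]])

lemma CT_antip_linear: "a \<in> carrier G \<Longrightarrow> linear_map CT_space CT_space (CT_antip a)"
  using linear_CT_antip by (cases a) (auto simp: carrier_G)

lemma CT_cross_linear:
  "a \<in> carrier G \<Longrightarrow> b \<in> carrier G \<Longrightarrow> linear_map CT_space CT_space (CT_cross a b)"
  using linear_CT_cross by (cases a; cases b) (auto simp: carrier_G)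

lemmas CT_antip_closed = linear_map_closed[OF CT_antip_linear]
lemmas CT_cross_closed = linear_map_closed[OF CT_cross_linear]
lemmas lm_CT_antip = linear_map_comp[OF _ CT_antip_linear]
lemmas lm_CT_cross = linear_map_comp[OF _ CT_cross_linear]

lemma lk_CT_fun_mult:
  assumes "\<alpha> \<in> Aut_Hopf" "\<delta> \<in> Aut_Hopf" "s \<in> carrier CT_space" "t \<in> carrier CT_space" "lk f"
  shows "f (CT_fun (CT_mult (\<alpha>, \<beta>) (\<gamma>, \<delta>) s t) x) =
    SW (\<lambda>m n. f (\<delta> (CT_fun s n) * \<delta> (\<alpha> (inv_into UNIV \<delta> (CT_fun t m))))) x"
  unfolding CT_fun_mult[OF assms(1-4)] by (rule lin_SW[OF assms(5)])

lemma CT_fun_mult_one: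
  assumes "\<alpha> \<in> Aut_Hopf" "\<delta> \<in> Aut_Hopf" "s \<in> carrier CT_space" "t \<in> carrier CT_space"
  shows "CT_fun (CT_mult (\<alpha>, \<beta>) (\<gamma>, \<delta>) s t) 1 =
    \<delta> (CT_fun s 1) * \<delta> (\<alpha> (inv_into UNIV \<delta> (CT_fun t 1)))"
proof (rule lk_separates)
  fix f :: "'h \<Rightarrow> 'k" assume f: "lk f"
  show "f (CT_fun (CT_mult (\<alpha>, \<beta>) (\<gamma>, \<delta>) s t) 1) =
      f (\<delta> (CT_fun s 1) * \<delta> (\<alpha> (inv_into UNIV \<delta> (CT_fun t 1))))"
    unfolding lk_CT_fun_mult[OF assms f]
    by (rule SW_one) (intro lin_intros lin_comp[OF f] assms(1,2)[THEN lh_Aut, THEN lin_comp]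
        lin_comp[OF lh_Aut[OF inv_Aut[OF assms(2)]]] lh_CT_fun assms(3,4))+
qed

text \<open>Let F, K, L be the endomorphisms of x, y, z. At X both sides are \<nu>\<delta>(F(X_3))
  \<nu>\<delta>\<alpha>\<delta>^{-1}(K(X_2))
  \<nu>\<delta>\<alpha>\<delta>^{-1}\<gamma>\<nu>^{-1}(L(X_1)). The last automorphism shows why the
  first component of a product in G is \<delta>\<alpha>\<delta>^{-1}\<gamma>.\<close>

lemma CT_mult_assoc:
  assumes "a \<in> carrier G" "b \<in> carrier G" "c \<in> carrier G"
    "x \<in> carrier CT_space" "y \<in> carrier CT_space" "z \<in> carrier CT_space"
  shows "CT_mult (a \<otimes>\<^bsub>G\<^esub> b) c (CT_mult a b x y) z = CT_mult a (b \<otimes>\<^bsub>G\<^esub> c) x (CT_mult b c y z)"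
proof -
  interpret G: group G by (rule group_G)
  obtain \<alpha> \<beta> \<gamma> \<delta> \<mu> \<nu> where p: "a = (\<alpha>, \<beta>)" "b = (\<gamma>, \<delta>)" "c = (\<mu>, \<nu>)"
    and aut: "\<alpha> \<in> Aut_Hopf" "\<beta> \<in> Aut_Hopf" "\<gamma> \<in> Aut_Hopf" "\<delta> \<in> Aut_Hopf" "\<mu> \<in> Aut_Hopf" "\<nu> \<in> Aut_Hopf"
    using assms(1-3) by (cases a; cases b; cases c) (auto simp: carrier_G)
  note xy = CT_mult_closed[OF assms(1,2,4,5), unfolded p] CT_mult_closed[OF assms(2,3,5,6), unfolded p]
  let ?\<alpha>1 = "\<delta> \<circ> \<alpha> \<circ> inv_into UNIV \<delta> \<circ> \<gamma>"
  have aut': "?\<alpha>1 \<in> Aut_Hopf" "\<nu> \<circ> \<delta> \<in> Aut_Hopf" using aut by (simp_all add: Aut_closed)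
  note L = lin_intros aut[THEN lh_Aut, THEN lin_comp] aut[THEN inv_Aut, THEN lh_Aut, THEN lin_comp]
    assms(4-6)[THEN lh_CT_fun, THEN lin_comp]
  show ?thesis
  proof (rule CT_eqI[OF _ _ lk_separates])
    show "CT_mult (a \<otimes>\<^bsub>G\<^esub> b) c (CT_mult a b x y) z \<in> carrier CT_space"
      "CT_mult a (b \<otimes>\<^bsub>G\<^esub> c) x (CT_mult b c y z) \<in> carrier CT_space"
      using assms by (auto intro!: CT_mult_closed)
    fix X and f :: "'h \<Rightarrow> 'k" assume f: "lk f"
    note Lf = L lin_comp[OF f]
    have "f (CT_fun (CT_mult (a \<otimes>\<^bsub>G\<^esub> b) c (CT_mult a b x y) z) X) =
        SW (\<lambda>m n. SW (\<lambda>m' n'. f (\<nu> (\<delta> (CT_fun x n') * \<delta> (\<alpha> (inv_into UNIV \<delta> (CT_fun y m')))) *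
          \<nu> (?\<alpha>1 (inv_into UNIV \<nu> (CT_fun z m))))) n) X" (is "?lhs = _")
      unfolding p mult_G lk_CT_fun_mult[OF aut'(1) aut(6) xy(1) assms(6) f]
      by (rule SW_cong, rule lk_CT_fun_mult[OF aut(1,4) assms(4,5)]) (intro Lf)
    also have "\<dots> = SW (\<lambda>m n. SW (\<lambda>m' n'. f ((\<nu> \<circ> \<delta>) (CT_fun x n') *
          (\<nu> \<circ> \<delta>) (\<alpha> (inv_into UNIV (\<nu> \<circ> \<delta>) (\<nu> (CT_fun y m') * \<nu> (\<gamma> (inv_into UNIV \<nu> (CT_fun z m)))))))) n) X"
      using aut by (simp add: Aut_simps Aut_closed Aut_mult mult.assoc)
    also have "\<dots> = SW (\<lambda>r n. SW (\<lambda>m m'. f ((\<nu> \<circ> \<delta>) (CT_fun x n) *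
          (\<nu> \<circ> \<delta>) (\<alpha> (inv_into UNIV (\<nu> \<circ> \<delta>) (\<nu> (CT_fun y m') * \<nu> (\<gamma> (inv_into UNIV \<nu> (CT_fun z m)))))))) r) X"
      by (rule SW_coassoc[symmetric])
        (intro Lf lin_comp[OF lh_Aut[OF aut'(2)]] lin_comp[OF lh_Aut[OF inv_Aut[OF aut'(2)]]])+
    also have "\<dots> = f (CT_fun (CT_mult a (b \<otimes>\<^bsub>G\<^esub> c) x (CT_mult b c y z)) X)"
      unfolding p mult_G lk_CT_fun_mult[OF aut(1) aut'(2) assms(4) xy(2) f]
      by (rule SW_cong, rule lk_CT_fun_mult[OF aut(3,6) assms(5,6), symmetric])
        (intro Lf lin_comp[OF lh_Aut[OF aut'(2)]] lin_comp[OF lh_Aut[OF inv_Aut[OF aut'(2)]]])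
    finally show "?lhs = \<dots>" .
  qed
qed

lemma CT_mult_cou:
  assumes "a \<in> carrier G" "b \<in> carrier G" "x \<in> carrier CT_space" "y \<in> carrier CT_space"
  shows "CT_cou c (CT_mult a b x y) = CT_cou a x * CT_cou b y"
proof -
  obtain \<alpha> \<beta> \<gamma> \<delta> where p: "a = (\<alpha>, \<beta>)" "b = (\<gamma>, \<delta>)"
    and aut: "\<alpha> \<in> Aut_Hopf" "\<beta> \<in> Aut_Hopf" "\<gamma> \<in> Aut_Hopf" "\<delta> \<in> Aut_Hopf"
    using assms(1,2) by (cases a; cases b) (auto simp: carrier_G)
  show ?thesis
    unfolding CT_cou_eq[OF CT_mult_closed[OF assms]] CT_cou_eq[OF assms(3)] CT_cou_eq[OF assms(4)] unfolding p
    using aut by (simp add: CT_fun_mult_one assms counit_mult Aut_counit inv_Aut)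
qed

lemma CT_unit_closed: "(\<epsilon> \<bowtie> 1) \<in> carrier CT_space"
  by (rule bow_closed[OF lk_counit])

lemma CT_fun_unit: "CT_fun (\<epsilon> \<bowtie> 1) x = scale (\<epsilon> x) 1"
  by (rule CT_fun_bow[OF lk_counit])

lemma CT_unit_cou: "CT_cou a (\<epsilon> \<bowtie> 1) = 1"
  by (simp add: CT_cou_eq CT_unit_closed CT_fun_unit counit_one)

lemma CT_unit_left:
  assumes "a \<in> carrier G" "x \<in> carrier CT_space"
  shows "CT_mult \<one>\<^bsub>G\<^esub> a (\<epsilon> \<bowtie> 1) x = x"
proof (rule CT_eqI[OF CT_mult_closed assms(2) lk_separates])
  fix X and f :: "'h \<Rightarrow> 'k" assume f: "lk f"
  obtain \<alpha> \<beta> where p: "a = (\<alpha>, \<beta>)" and aut: "\<alpha> \<in> Aut_Hopf" "\<beta> \<in> Aut_Hopf"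
    using assms(1) by (cases a) (auto simp: carrier_G)
  have "f (CT_fun (CT_mult \<one>\<^bsub>G\<^esub> a (\<epsilon> \<bowtie> 1) x) X) = SW (\<lambda>m n. \<epsilon> n * f (CT_fun x m)) X" (is "?lhs = _")
    unfolding p one_G lk_CT_fun_mult[OF id_Aut aut(2) CT_unit_closed assms(2) f]
    using aut by (simp add: CT_fun_unit lin_scale[OF lh_Aut] lin_scale[OF f] Aut_one Aut_simps
      scale_mult_left[symmetric])
  also have "\<dots> = f (CT_fun x X)"
    by (rule SW_counit_right) (intro lin_comp[OF f] lh_CT_fun assms(2))
  finally show "?lhs = \<dots>" .
qed (use assms in \<open>auto simp: CT_unit_closed group.is_monoid[OF group_G] monoid.one_closed\<close>)

lemma CT_unit_right:
  assumes "a \<in> carrier G" "x \<in> carrier CT_space"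
  shows "CT_mult a \<one>\<^bsub>G\<^esub> x (\<epsilon> \<bowtie> 1) = x"
proof (rule CT_eqI[OF CT_mult_closed assms(2) lk_separates])
  fix X and f :: "'h \<Rightarrow> 'k" assume f: "lk f"
  obtain \<alpha> \<beta> where p: "a = (\<alpha>, \<beta>)" and aut: "\<alpha> \<in> Aut_Hopf" "\<beta> \<in> Aut_Hopf"
    using assms(1) by (cases a) (auto simp: carrier_G)
  have "f (CT_fun (CT_mult a \<one>\<^bsub>G\<^esub> x (\<epsilon> \<bowtie> 1)) X) = SW (\<lambda>m n. \<epsilon> m * f (CT_fun x n)) X" (is "?lhs = _")
    unfolding p one_G lk_CT_fun_mult[OF aut(1) id_Aut assms(2) CT_unit_closed f]
    using aut by (simp add: CT_fun_unit lin_scale[OF lh_Aut] lin_scale[OF f] Aut_one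
      scale_mult_right[symmetric])
  also have "\<dots> = f (CT_fun x X)"
    by (rule SW_counit_left) (intro lin_comp[OF f] lh_CT_fun assms(2))
  finally show "?lhs = \<dots>" .
qed (use assms in \<open>auto simp: CT_unit_closed group.is_monoid[OF group_G] monoid.one_closed\<close>)

text \<open>The unit takes scalar multiples of 1 as values, and on the unit component both
  automorphisms are the identity. The two outer factors therefore meet and cancel as y_2
  S^{-1}(y_1).\<close>

lemma CT_unit_cop:
  "CT_cop \<one>\<^bsub>G\<^esub> (\<epsilon> \<bowtie> 1) = pure CT_space CT_space (\<epsilon> \<bowtie> 1) (\<epsilon> \<bowtie> 1)"
proof (rule CC_eqI)
  have one: "\<one>\<^bsub>G\<^esub> \<in> carrier G" by (simp add: one_G carrier_G id_Aut)
  show "CT_cop \<one>\<^bsub>G\<^esub> (\<epsilon> \<bowtie> 1) \<in> carrier CC" by (rule CT_cop_closed[OF one CT_unit_closed])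
  show "pure CT_space CT_space (\<epsilon> \<bowtie> 1) (\<epsilon> \<bowtie> 1) \<in> carrier CC"
    by (intro pure_closed CT_unit_closed)
  fix x y and f g :: "'h \<Rightarrow> 'k" assume lk: "lk f" "lk g"
  note L = lin_intros' lk[THEN lin_comp] lk
  have D: "bilinear_map CT_space CT_space scalars (\<lambda>s s'. f (CT_fun s x) * g (CT_fun s' y))"
    by (intro bilinear_mapI lm_kmult_left lm_kmult_right lk[THEN lm_lk] linear_CT_fun)
  have u: "SW (\<lambda>u v. f (c * u * S_inv a) * g v) (scale k 1) = k * (f (c * S_inv a) * g 1)" for a c k
  proof -
    have "SW (\<lambda>u v. f (c * u * S_inv a) * g v) (scale k 1) = k * SW (\<lambda>u v. f (c * u * S_inv a) * g v) 1"
      by (rule lin_scale) (intro L)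
    also have "SW (\<lambda>u v. f (c * u * S_inv a) * g v) 1 = f (c * 1 * S_inv a) * g 1"
      by (rule SW_one) (intro L)+
    finally show ?thesis by simp
  qed
  have "CT_cop \<one>\<^bsub>G\<^esub> (\<epsilon> \<bowtie> 1) (\<lambda>s s'. f (CT_fun s x) * g (CT_fun s' y)) =
      SW (\<lambda>a r. SW (\<lambda>b c. SW (\<lambda>u v. f (id c * u * S_inv (id a)) * g v) (CT_fun (\<epsilon> \<bowtie> 1) (x * b))) r) y" (is "?lhs = _")
    unfolding one_G by (rule CT_cop_apply[OF id_Aut id_Aut CT_unit_closed]) (intro L)+
  also have "\<dots> = SW (\<lambda>a r. SW (\<lambda>b c. \<epsilon> b * (\<epsilon> x * (f (c * S_inv a) * g 1))) r) y"
    by (simp only: id_apply CT_fun_unit u) (simp only: counit_mult mult_ac)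
  also have "\<dots> = SW (\<lambda>a r. \<epsilon> x * (f (r * S_inv a) * g 1)) y"
    by (intro SW_cong SW_counit_left) (intro L)
  also have "\<dots> = \<epsilon> y * (\<epsilon> x * (f 1 * g 1))"
    by (rule SW_S_inv_right) (intro L)
  also have "\<dots> = pure CT_space CT_space (\<epsilon> \<bowtie> 1) (\<epsilon> \<bowtie> 1) (\<lambda>s s'. f (CT_fun s x) * g (CT_fun s' y))"
    by (simp add: pure_apply[OF D] CT_fun_unit lin_scale[OF lk(1)] lin_scale[OF lk(2)])
  finally show "?lhs = \<dots>" .
qed

text \<open>In the product of the coproducts, the right outer factor of the first element meets the
  left outer factor of the second. After applying \<delta> to the one and
  \<delta>\<alpha>\<delta>^{-1} to the other they read \<delta>\<alpha>(S^{-1}(q_1) p_3), and these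
  neighbouring legs of Y cancel.\<close>

lemma CT_mult_cop:
  assumes G: "a \<in> carrier G" "b \<in> carrier G" and st: "s \<in> carrier CT_space" "t \<in> carrier CT_space"
  shows "CT_cop (a \<otimes>\<^bsub>G\<^esub> b) (CT_mult a b s t) =
    sweedler CT a CC (\<lambda>x1 x2. sweedler CT b CC
      (\<lambda>y1 y2. pure CT_space CT_space (CT_mult a b x1 y1) (CT_mult a b x2 y2)) t) s"
proof -
  interpret G: group G by (rule group_G)
  obtain \<alpha> \<beta> \<gamma> \<delta> where p: "a = (\<alpha>, \<beta>)" "b = (\<gamma>, \<delta>)"
    and aut: "\<alpha> \<in> Aut_Hopf" "\<beta> \<in> Aut_Hopf" "\<gamma> \<in> Aut_Hopf" "\<delta> \<in> Aut_Hopf"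
    using G by (cases a; cases b) (auto simp: carrier_G)
  define c where "c = \<delta> \<circ> \<alpha> \<circ> inv_into UNIV \<delta>"
  have c: "c \<in> Aut_Hopf" unfolding c_def using aut by (intro Aut_closed)
  have c_apply: "\<delta> (\<alpha> (inv_into UNIV \<delta> h)) = c h" for h by (simp add: c_def)
  have aut': "c \<circ> \<gamma> \<in> Aut_Hopf" "\<delta> \<circ> \<beta> \<in> Aut_Hopf" using aut c by (simp_all add: Aut_closed)
  have ab: "a \<otimes>\<^bsub>G\<^esub> b = (c \<circ> \<gamma>, \<delta> \<circ> \<beta>)" by (simp add: p mult_G c_def)
  have st_closed: "CT_mult a b s t \<in> carrier CT_space" by (rule CT_mult_closed[OF G st])
  have bil1: "bilinear_map CT_space CT_space CC
      (\<lambda>y1 y2. pure CT_space CT_space (CT_mult a b x1 y1) (CT_mult a b x2 y2))"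
    if "x1 \<in> carrier CT_space" "x2 \<in> carrier CT_space" for x1 x2
    by (intro bilinear_mapI lm_pure_left lm_pure_right lm_CT_mult_right lm_CT_mult_left CT_mult_closed
        G that lm_id)
  have bil2: "bilinear_map CT_space CT_space CC
      (\<lambda>x1 x2. pure CT_space CT_space (CT_mult a b x1 y1) (CT_mult a b x2 y2))"
    if "y1 \<in> carrier CT_space" "y2 \<in> carrier CT_space" for y1 y2
    by (intro bilinear_mapI lm_pure_left lm_pure_right lm_CT_mult_right lm_CT_mult_left CT_mult_closed
        G that lm_id)
  show ?thesis
  proof (rule CC_eqI)
    show "CT_cop (a \<otimes>\<^bsub>G\<^esub> b) (CT_mult a b s t) \<in> carrier CC"
      using G by (intro CT_cop_closed st_closed) simp
    show "sweedler CT a CC (\<lambda>x1 x2. sweedler CT b CC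
        (\<lambda>y1 y2. pure CT_space CT_space (CT_mult a b x1 y1) (CT_mult a b x2 y2)) t) s \<in> carrier CC"
      (is "?R \<in> _")
      by (rule sweedler_closed[OF G(1) st(1) is_vspace_CC
            sweedler2_bilinear[OF G(2) st(2) is_vspace_CC bil1 bil2]])
    fix X Y and f g :: "'h \<Rightarrow> 'k" assume lk: "lk f" "lk g"
    let ?D = "\<lambda>s s'. f (CT_fun s X) * g (CT_fun s' Y)"
    note L0 = lin_intros' lk[THEN lin_comp] lk aut[THEN lh_Aut, THEN lin_comp] lin_comp[OF lh_Aut[OF c]]
    note L = L0 st[THEN lh_CT_fun, THEN lin_comp] aut'[THEN lh_Aut, THEN lin_comp]
    note LM = bilinear_mapI lm_intros lk[THEN lm_lk] aut[THEN lh_Aut, THEN lm_lh] lm_lh[OF lh_Aut[OF c]]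
      linear_CT_fun
    have D: "bilinear_map CT_space CT_space scalars ?D"
      by (intro LM)
    let ?M = "\<lambda>p1 q3 u v. f (\<delta> (\<beta> q3) * u * S_inv (c (\<gamma> p1))) * g v"
    \<comment> \<open>The form reached from both sides: m_1, m_2 are the legs of X, and p_1, p_2,
      q_2, q_3 are the legs of Y. The outer factors in \<open>?M\<close> are those of the component
      with automorphisms c\<gamma> and \<delta>\<beta>.\<close>
    let ?K' = "\<lambda>m1 m2 p1 p2 q2 q3. SW (\<lambda>w z. SW (\<lambda>u v. ?M p1 q3 (\<delta> w * c u) (\<delta> z * c v))
      (CT_fun t (m1 * p2))) (CT_fun s (m2 * q2))"
    have left: "CT_cop (a \<otimes>\<^bsub>G\<^esub> b) (CT_mult a b s t) ?D =
        SW (\<lambda>m1 m2. SW (\<lambda>m n. SW (\<lambda>p1 p2. SW (\<lambda>q2 q3. ?K' m1 m2 p1 p2 q2 q3) n) m) Y) X"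
    proof -
      have "CT_cop (a \<otimes>\<^bsub>G\<^esub> b) (CT_mult a b s t) ?D =
          SW (\<lambda>p1 r. SW (\<lambda>b' q3. SW (?M p1 q3) (CT_fun (CT_mult a b s t) (X * b'))) r) Y"
        unfolding ab
        by (subst CT_cop_apply[OF aut' st_closed]) (intro L | simp)+
      also have "\<dots> = SW (\<lambda>p1 r. SW (\<lambda>b' q3. SW (\<lambda>m1 m2. SW (\<lambda>p2 q2. ?K' m1 m2 p1 p2 q2 q3) b') X) r) Y"
      proof (intro SW_cong)
        fix p1 b' q3
        have "SW (?M p1 q3) (CT_fun (CT_mult a b s t) (X * b')) =
            SW (\<lambda>m n. SW (?M p1 q3) (\<delta> (CT_fun s n) * c (CT_fun t m))) (X * b')" (is "?lhs = _")
          unfolding p c_apply[symmetric]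
          by (rule lk_CT_fun_mult[OF aut(1,4) st]) (intro L)
        also have "\<dots> = SW (\<lambda>m1 m2. SW (\<lambda>p2 q2.
            SW (?M p1 q3) (\<delta> (CT_fun s (m2 * q2)) * c (CT_fun t (m1 * p2)))) b') X"
          by (rule SW_mult) (intro L)+
        also have "\<dots> = SW (\<lambda>m1 m2. SW (\<lambda>p2 q2. SW (\<lambda>w z. SW (\<lambda>u v.
            ?M p1 q3 (w * u) (z * v)) (c (CT_fun t (m1 * p2)))) (\<delta> (CT_fun s (m2 * q2)))) b') X"
          by (intro SW_cong SW_mult) (intro L)+
        also have "\<dots> = SW (\<lambda>m1 m2. SW (\<lambda>p2 q2. SW (\<lambda>w z. SW (\<lambda>u v.
            ?M p1 q3 (\<delta> w * u) (\<delta> z * v)) (c (CT_fun t (m1 * p2)))) (CT_fun s (m2 * q2))) b') X"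
          by (intro SW_cong SW_Aut[OF aut(4)]) (intro L)+
        also have "\<dots> = SW (\<lambda>m1 m2. SW (\<lambda>p2 q2. ?K' m1 m2 p1 p2 q2 q3) b') X"
          by (intro SW_cong SW_Aut[OF c]) (intro L)+
        finally show "?lhs = \<dots>" .
      qed
      also have "\<dots> = SW (\<lambda>p1 r. SW (\<lambda>m1 m2. SW (\<lambda>b' q3. SW (\<lambda>p2 q2. ?K' m1 m2 p1 p2 q2 q3) b') r) X) Y"
        by (intro SW_cong SW_swap)
      also have "\<dots> = SW (\<lambda>m1 m2. SW (\<lambda>p1 r. SW (\<lambda>b' q3. SW (\<lambda>p2 q2. ?K' m1 m2 p1 p2 q2 q3) b') r) Y) X"
        by (rule SW_swap)
      also have "\<dots> = SW (\<lambda>m1 m2. SW (\<lambda>p1 r. SW (\<lambda>p2 n. SW (\<lambda>q2 q3. ?K' m1 m2 p1 p2 q2 q3) n) r) Y) X"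
        by (intro SW_cong SW_coassoc) (intro L)+
      also have "\<dots> = SW (\<lambda>m1 m2. SW (\<lambda>m n. SW (\<lambda>p1 p2. SW (\<lambda>q2 q3. ?K' m1 m2 p1 p2 q2 q3) n) m) Y) X"
        by (intro SW_cong SW_coassoc[symmetric]) (intro L)+
      finally show ?thesis .
    qed
    let ?E = "\<lambda>h k h' k'. f (\<delta> h * c k) * g (\<delta> h' * c k')"
    have "?R ?D = CT_cop a s (\<lambda>x1 x2. CT_cop b t (\<lambda>y1 y2.
        pure CT_space CT_space (CT_mult a b x1 y1) (CT_mult a b x2 y2) ?D))"
      by (rule linear_sweedler2[OF G(1) st(1) G(2) st(2) is_vspace_CC bil1 bil2 eval_linear])
    also have "\<dots> = CT_cop a s (\<lambda>x1 x2. SW (\<lambda>m1 m2. SW (\<lambda>n1 n2. SW (\<lambda>p1 r. SW (\<lambda>p2 p3. SW (\<lambda>u v.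
        ?E (CT_fun x1 m2) (\<delta> p3 * u * S_inv (\<gamma> p1)) (CT_fun x2 n2) v) (CT_fun t (m1 * p2))) r) n1) Y) X)"
    proof (rule CT_cop_cong[OF G(1) st(1)])
      fix x1 x2 assume x: "x1 \<in> carrier CT_space" "x2 \<in> carrier CT_space"
      have "CT_cop b t (\<lambda>y1 y2. pure CT_space CT_space (CT_mult a b x1 y1) (CT_mult a b x2 y2) ?D) =
          CT_cop b t (\<lambda>y1 y2. SW (\<lambda>m1 m2. SW (\<lambda>n1 n2.
            ?E (CT_fun x1 m2) (CT_fun y1 m1) (CT_fun x2 n2) (CT_fun y2 n1)) Y) X)" (is "?lhs = _")
      proof (rule CT_cop_cong[OF G(2) st(2)])
        fix y1 y2 assume y: "y1 \<in> carrier CT_space" "y2 \<in> carrier CT_space"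
        show "pure CT_space CT_space (CT_mult a b x1 y1) (CT_mult a b x2 y2) ?D =
            SW (\<lambda>m1 m2. SW (\<lambda>n1 n2.
              ?E (CT_fun x1 m2) (CT_fun y1 m1) (CT_fun x2 n2) (CT_fun y2 n1)) Y) X"
          unfolding pure_apply[OF D] p lk_CT_fun_mult[OF aut(1,4) x(1) y(1) lk(1)]
            lk_CT_fun_mult[OF aut(1,4) x(2) y(2) lk(2)] c_apply
          by (simp only: SW_mult_left SW_mult_right) (rule SW_swap)
      qed
      also have "\<dots> = SW (\<lambda>m1 m2. CT_cop b t (\<lambda>y1 y2. SW (\<lambda>n1 n2.
            ?E (CT_fun x1 m2) (CT_fun y1 m1) (CT_fun x2 n2) (CT_fun y2 n1)) Y)) X"
        by (rule CT_cop_SW[OF G(2) st(2)]) (intro LM)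
      also have "\<dots> = SW (\<lambda>m1 m2. SW (\<lambda>n1 n2. CT_cop b t (\<lambda>y1 y2.
            ?E (CT_fun x1 m2) (CT_fun y1 m1) (CT_fun x2 n2) (CT_fun y2 n1))) Y) X"
        by (intro SW_cong CT_cop_SW[OF G(2) st(2)]) (intro LM)
      also have "\<dots> = SW (\<lambda>m1 m2. SW (\<lambda>n1 n2. SW (\<lambda>p1 r. SW (\<lambda>p2 p3. SW (\<lambda>u v.
        ?E (CT_fun x1 m2) (\<delta> p3 * u * S_inv (\<gamma> p1)) (CT_fun x2 n2) v) (CT_fun t (m1 * p2))) r) n1) Y) X"
        unfolding p by (intro SW_cong CT_cop_apply[OF aut(3,4) st(2)]) (intro L0)+
      finally show "?lhs = \<dots>" .
    qed
    also have "\<dots> = SW (\<lambda>m1 m2. SW (\<lambda>n1 n2. SW (\<lambda>p1 r. SW (\<lambda>p2 p3. SW (\<lambda>u v. CT_cop a s (\<lambda>x1 x2.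
        ?E (CT_fun x1 m2) (\<delta> p3 * u * S_inv (\<gamma> p1)) (CT_fun x2 n2) v)) (CT_fun t (m1 * p2))) r) n1) Y) X"
      by (rule trans[OF CT_cop_SW[OF G(1) st(1)]], (intro LM),
          (rule SW_cong, rule trans[OF CT_cop_SW[OF G(1) st(1)]], (intro LM))+, rule refl)
    also have "\<dots> = SW (\<lambda>m1 m2. SW (\<lambda>n1 n2. SW (\<lambda>p1 r. SW (\<lambda>p2 p3. SW (\<lambda>u v.
        SW (\<lambda>q1 r'. SW (\<lambda>q2 q3. SW (\<lambda>w z.
          ?E (\<beta> q3 * w * S_inv (\<alpha> q1)) (\<delta> p3 * u * S_inv (\<gamma> p1)) z v) (CT_fun s (m2 * q2))) r') n2)
            (CT_fun t (m1 * p2))) r) n1) Y) X"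
      unfolding p by (intro SW_cong CT_cop_apply[OF aut(1,2) st(1)]) (intro L0)+
    also have "\<dots> = SW (\<lambda>m1 m2. SW (\<lambda>n1 n2. SW (\<lambda>p1 r. SW (\<lambda>p2 p3.
        SW (\<lambda>q1 r'. SW (\<lambda>q2 q3. SW (\<lambda>w z. SW (\<lambda>u v.
          ?E (\<beta> q3 * w * S_inv (\<alpha> q1)) (\<delta> p3 * u * S_inv (\<gamma> p1)) z v)
            (CT_fun t (m1 * p2))) (CT_fun s (m2 * q2))) r') n2) r) n1) Y) X"
      by (intro SW_cong, rule trans[OF SW_swap], rule SW_cong, rule trans[OF SW_swap], rule SW_cong,
          rule SW_swap)
    also have "\<dots> = SW (\<lambda>m1 m2. SW (\<lambda>m n. SW (\<lambda>p1 p2. SW (\<lambda>q2 q3. ?K' m1 m2 p1 p2 q2 q3) n) m) Y) X"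
    proof (rule SW_cong, rule SW_contract_middle)
      fix m1 m2 p1 p2 q2 q3 W
      have contr: "SW (\<lambda>p3 q1. ?E (\<beta> q3 * w * S_inv (\<alpha> q1)) (\<delta> p3 * u * S_inv (\<gamma> p1)) z v) W =
          \<epsilon> W * ?M p1 q3 (\<delta> w * c u) (\<delta> z * c v)" for u v w z
      proof -
        have "SW (\<lambda>p3 q1. f (\<delta> (\<beta> q3) * \<delta> w * \<delta> (\<alpha> (S_inv q1 * p3)) * c u * S_inv (c (\<gamma> p1))) *
            g (\<delta> z * c v)) W =
          \<epsilon> W * (f (\<delta> (\<beta> q3) * \<delta> w * \<delta> (\<alpha> 1) * c u * S_inv (c (\<gamma> p1))) * g (\<delta> z * c v))"
          by (rule SW_S_inv_left) (intro L)
        then show ?thesis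
          using aut c by (simp add: Aut_mult Aut_S_inv Aut_one mult.assoc c_def Aut_simps inv_Aut)
      qed
      show "SW (\<lambda>p3 q1. SW (\<lambda>w z. SW (\<lambda>u v.
            ?E (\<beta> q3 * w * S_inv (\<alpha> q1)) (\<delta> p3 * u * S_inv (\<gamma> p1)) z v)
              (CT_fun t (m1 * p2))) (CT_fun s (m2 * q2))) W =
          \<epsilon> W * ?K' m1 m2 p1 p2 q2 q3"
        unfolding SW_mult_right contr[symmetric]
        by (rule trans[OF SW_swap], rule SW_cong, rule SW_swap)
    qed (intro L)+
    finally show "CT_cop (a \<otimes>\<^bsub>G\<^esub> b) (CT_mult a b s t) ?D = ?R ?D"
      using left by simp
  qed
qed

text \<open>The cancellations run from the inside outwards: S(p_3) q_1 first, then S(u) v for the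
  legs of the value of F, then S^{-1}(q_2) p_2 in its argument, and finally S^{-1}(q_3) p_1. What
  survives is \<epsilon>(F(1)).\<close>

lemma CT_antip_left:
  assumes a: "a \<in> carrier G" and t: "t \<in> carrier CT_space"
  shows "sweedler CT a CT_space (\<lambda>x1 x2. CT_mult (inv\<^bsub>G\<^esub> a) a (CT_antip a x1) x2) t =
    pscale (CT_cou a t) (\<epsilon> \<bowtie> 1)"
proof -
  interpret G: group G by (rule group_G)
  obtain \<alpha> \<beta> where p: "a = (\<alpha>, \<beta>)" and aut: "\<alpha> \<in> Aut_Hopf" "\<beta> \<in> Aut_Hopf"
    using a by (cases a) (auto simp: carrier_G)
  define \<alpha>' \<beta>' where "\<alpha>' = inv_into UNIV \<alpha>" and "\<beta>' = inv_into UNIV \<beta>"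
  have aut': "\<alpha>' \<in> Aut_Hopf" "\<beta>' \<in> Aut_Hopf" unfolding \<alpha>'_def \<beta>'_def by (intro Aut_closed aut)+
  have inv_simps: "\<alpha>' (\<alpha> x) = x" "\<beta> (\<beta>' x) = x" for x
    using aut by (simp_all add: \<alpha>'_def \<beta>'_def Aut_simps)
  have inv_a: "inv\<^bsub>G\<^esub> a = (\<beta>' \<circ> \<alpha>' \<circ> \<beta>, \<beta>')" by (simp add: p inv_G aut \<alpha>'_def \<beta>'_def)
  have ia: "inv\<^bsub>G\<^esub> a \<in> carrier G" using a by simp
  have aut1: "\<beta>' \<circ> \<alpha>' \<circ> \<beta> \<in> Aut_Hopf" by (intro Aut_closed aut aut')
  have B: "bilinear_map CT_space CT_space CT_space (\<lambda>x1 x2. CT_mult (inv\<^bsub>G\<^esub> a) a (CT_antip a x1) x2)"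
    by (intro bilinear_mapI lm_CT_mult_left lm_CT_mult_right lm_CT_antip lm_id a ia CT_antip_closed[OF a])
  show ?thesis
  proof (rule CT_eqI[OF sweedler_closed[OF a t is_vspace_CT B] _ lk_separates])
    show "pscale (CT_cou a t) (\<epsilon> \<bowtie> 1) \<in> carrier CT_space"
      using vs_scal[OF is_vspace_CT CT_unit_closed] by simp
    fix X and f :: "'h \<Rightarrow> 'k" assume f: "lk f"
    note L0 = lin_intros' f f[THEN lin_comp] aut[THEN lh_Aut, THEN lin_comp] aut'[THEN lh_Aut, THEN lin_comp]
    note L = L0 lin_comp[OF lh_CT_fun[OF t]]
    note LM = bilinear_mapI lm_intros lm_lk[OF f] lm_lh[OF lh_Aut[OF aut'(1)]] linear_CT_fun
    let ?E = "\<lambda>h h' a c. f (S_inv c * \<alpha>' (S h) * \<alpha>' (\<beta> a) * \<alpha>' h')"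
    have "f (CT_fun (sweedler CT a CT_space (\<lambda>x1 x2. CT_mult (inv\<^bsub>G\<^esub> a) a (CT_antip a x1) x2) t) X) =
        CT_cop a t (\<lambda>x1 x2. f (CT_fun (CT_mult (inv\<^bsub>G\<^esub> a) a (CT_antip a x1) x2) X))" (is "?lhs = _")
      by (rule linear_sweedler[OF a t is_vspace_CT B lm_lk[OF f linear_CT_fun]])
    also have "\<dots> = CT_cop a t (\<lambda>x1 x2. SW (\<lambda>m n. SW (\<lambda>q1 r. SW (\<lambda>q2 q3.
        ?E (CT_fun x1 (S_inv q2)) (CT_fun x2 m) q1 q3) r) n) X)"
    proof (rule CT_cop_cong[OF a t])
      fix x1 x2 assume x: "x1 \<in> carrier CT_space" "x2 \<in> carrier CT_space"
      note Lx = L0 x[THEN lh_CT_fun, THEN lin_comp]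
      have "f (CT_fun (CT_mult (inv\<^bsub>G\<^esub> a) a (CT_antip a x1) x2) X) =
          SW (\<lambda>m n. f (\<beta> (CT_fun (CT_antip a x1) n) * \<alpha>' (CT_fun x2 m))) X" (is "?lhs = _")
        using lk_CT_fun_mult[OF aut1 aut(2) CT_antip_closed[OF a x(1)] x(2) f, of \<beta>' \<alpha> X]
        by (simp add: inv_a[unfolded p] p inv_simps \<beta>'_def[symmetric])
      also have "\<dots> = SW (\<lambda>m n. SW (\<lambda>r q3. SW (\<lambda>q1 q2.
          f (\<beta> (\<beta>' (S_inv q3) * \<beta>' (\<alpha>' (S (CT_fun x1 (S_inv q2)))) * \<beta>' (\<alpha>' (\<beta> q1))) * \<alpha>' (CT_fun x2 m))) r) n) X"
      proof (rule SW_cong)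
        fix m n
        have lf: "lk (\<lambda>z. f (\<beta> z * \<alpha>' (CT_fun x2 m)))" by (intro L0)
        show "f (\<beta> (CT_fun (CT_antip a x1) n) * \<alpha>' (CT_fun x2 m)) = SW (\<lambda>r q3. SW (\<lambda>q1 q2.
          f (\<beta> (\<beta>' (S_inv q3) * \<beta>' (\<alpha>' (S (CT_fun x1 (S_inv q2)))) * \<beta>' (\<alpha>' (\<beta> q1))) * \<alpha>' (CT_fun x2 m))) r) n"
          unfolding p CT_fun_antip[OF aut x(1), folded \<alpha>'_def \<beta>'_def] lin_SW[OF lf] ..
      qed
      also have "\<dots> = SW (\<lambda>m n. SW (\<lambda>r q3. SW (\<lambda>q1 q2. ?E (CT_fun x1 (S_inv q2)) (CT_fun x2 m) q1 q3) r) n) X"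
        by (simp add: Aut_mult[OF aut(2)] inv_simps)
      also have "\<dots> = SW (\<lambda>m n. SW (\<lambda>q1 r. SW (\<lambda>q2 q3. ?E (CT_fun x1 (S_inv q2)) (CT_fun x2 m) q1 q3) r) n) X"
        by (intro SW_cong SW_coassoc) (intro Lx)+
      finally show "?lhs = \<dots>" .
    qed
    also have "\<dots> = SW (\<lambda>m n. SW (\<lambda>q1 r. SW (\<lambda>q2 q3. CT_cop a t (\<lambda>x1 x2.
        ?E (CT_fun x1 (S_inv q2)) (CT_fun x2 m) q1 q3)) r) n) X"
      by (rule trans[OF CT_cop_SW[OF a t]], (intro LM),
          (rule SW_cong, rule trans[OF CT_cop_SW[OF a t]], (intro LM))+, rule refl)
    also have "\<dots> = SW (\<lambda>m n. SW (\<lambda>q1 r'. SW (\<lambda>q2 q3. SW (\<lambda>p1 r. SW (\<lambda>p2 p3.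
        SW (\<lambda>u v. ?E (\<beta> p3 * u * S_inv (\<alpha> p1)) v q1 q3) (CT_fun t (S_inv q2 * p2))) r) m) r') n) X"
      unfolding p by (intro SW_cong CT_cop_apply[OF aut t]) (intro L0)+
    also have "\<dots> = SW (\<lambda>m n. SW (\<lambda>p1 r. SW (\<lambda>p2 p3. SW (\<lambda>q1 r'. SW (\<lambda>q2 q3.
        SW (\<lambda>u v. ?E (\<beta> p3 * u * S_inv (\<alpha> p1)) v q1 q3) (CT_fun t (S_inv q2 * p2))) r') n) r) m) X"
    proof (rule SW_cong)
      fix m n
      let ?N = "\<lambda>q1 q2 q3 p1 p2 p3. SW (\<lambda>u v. ?E (\<beta> p3 * u * S_inv (\<alpha> p1)) v q1 q3) (CT_fun t (S_inv q2 * p2))"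
      have "SW (\<lambda>q1 r'. SW (\<lambda>q2 q3. SW (\<lambda>p1 r. SW (\<lambda>p2 p3. ?N q1 q2 q3 p1 p2 p3) r) m) r') n =
          SW (\<lambda>q1 r'. SW (\<lambda>p1 r. SW (\<lambda>p2 p3. SW (\<lambda>q2 q3. ?N q1 q2 q3 p1 p2 p3) r') r) m) n" (is "?lhs = _")
        by (rule SW_cong, rule trans[OF SW_swap], rule SW_cong, rule SW_swap)
      also have "\<dots> = SW (\<lambda>p1 r. SW (\<lambda>p2 p3. SW (\<lambda>q1 r'. SW (\<lambda>q2 q3. ?N q1 q2 q3 p1 p2 p3) r') n) r) m"
        by (rule trans[OF SW_swap], rule SW_cong, rule SW_swap)
      finally show "?lhs = \<dots>" .
    qed
    also have "\<dots> = SW (\<lambda>m n. SW (\<lambda>p1 p2. SW (\<lambda>q2 q3.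
        \<epsilon> (CT_fun t (S_inv q2 * p2)) * f (S_inv q3 * p1)) n) m) X"
    proof (rule SW_contract_middle)
      fix p1 p2 q2 q3 w
      have contr: "SW (\<lambda>p3 q1. ?E (\<beta> p3 * u * S_inv (\<alpha> p1)) v q1 q3) w =
          \<epsilon> w * f (S_inv q3 * p1 * \<alpha>' (S u * v))" for u v
      proof -
        have "SW (\<lambda>p3 q1. f (S_inv q3 * p1 * \<alpha>' (S u) * \<alpha>' (\<beta> (S p3 * q1)) * \<alpha>' v)) w =
            \<epsilon> w * f (S_inv q3 * p1 * \<alpha>' (S u) * \<alpha>' (\<beta> 1) * \<alpha>' v)"
          by (rule SW_antipode_left) (intro L0)
        then show ?thesis
          using aut aut'
          by (simp add: S_mult Aut_mult Aut_S[symmetric] Aut_S_inv[symmetric] Aut_one inv_simps mult.assoc)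
      qed
      have "SW (\<lambda>u v. f (S_inv q3 * p1 * \<alpha>' (S u * v))) (CT_fun t (S_inv q2 * p2)) =
          \<epsilon> (CT_fun t (S_inv q2 * p2)) * f (S_inv q3 * p1 * \<alpha>' 1)"
        by (rule SW_antipode_left) (intro L0)
      then have "\<epsilon> w * (\<epsilon> (CT_fun t (S_inv q2 * p2)) * f (S_inv q3 * p1)) =
          SW (\<lambda>u v. \<epsilon> w * f (S_inv q3 * p1 * \<alpha>' (S u * v))) (CT_fun t (S_inv q2 * p2))"
        by (simp add: SW_mult_right[symmetric] Aut_one[OF aut'(1)])
      also have "\<dots> = SW (\<lambda>p3 q1. SW (\<lambda>u v. ?E (\<beta> p3 * u * S_inv (\<alpha> p1)) v q1 q3) (CT_fun t (S_inv q2 * p2))) w"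
        unfolding contr[symmetric] by (rule SW_swap)
      finally show "SW (\<lambda>p3 q1. SW (\<lambda>u v. ?E (\<beta> p3 * u * S_inv (\<alpha> p1)) v q1 q3) (CT_fun t (S_inv q2 * p2))) w =
          \<epsilon> w * (\<epsilon> (CT_fun t (S_inv q2 * p2)) * f (S_inv q3 * p1))" ..
    qed (intro L)+
    also have "\<dots> = SW (\<lambda>p1 q3. \<epsilon> (CT_fun t 1) * f (S_inv q3 * p1)) X"
    proof (rule SW_contract_middle2)
      fix p1 q3 w
      show "SW (\<lambda>p2 q2. \<epsilon> (CT_fun t (S_inv q2 * p2)) * f (S_inv q3 * p1)) w =
          \<epsilon> w * (\<epsilon> (CT_fun t 1) * f (S_inv q3 * p1))"
        by (rule SW_S_inv_left) (intro L)
    qed (intro L)+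
    also have "\<dots> = \<epsilon> X * (\<epsilon> (CT_fun t 1) * f 1)"
      by (rule SW_S_inv_left) (intro L)
    also have "\<dots> = f (CT_fun (pscale (CT_cou a t) (\<epsilon> \<bowtie> 1)) X)"
      by (simp add: CT_fun_unit CT_cou_eq[OF t] lin_scale[OF f])
    finally show "?lhs = \<dots>" .
  qed
qed

text \<open>Now the second leg of the coproduct is evaluated at S^{-1}(q_2), so new legs b_i arise
  inside q_2. The cancellations are b_3 with q_3, then u S(v) for the value of F, then b_2 with n,
  and finally b_1 with q_1.\<close>

lemma CT_antip_right:
  assumes a: "a \<in> carrier G" and t: "t \<in> carrier CT_space"
  shows "sweedler CT a CT_space (\<lambda>x1 x2. CT_mult a (inv\<^bsub>G\<^esub> a) x1 (CT_antip a x2)) t =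
    pscale (CT_cou a t) (\<epsilon> \<bowtie> 1)"
proof -
  interpret G: group G by (rule group_G)
  obtain \<alpha> \<beta> where p: "a = (\<alpha>, \<beta>)" and aut: "\<alpha> \<in> Aut_Hopf" "\<beta> \<in> Aut_Hopf"
    using a by (cases a) (auto simp: carrier_G)
  define \<alpha>' \<beta>' where "\<alpha>' = inv_into UNIV \<alpha>" and "\<beta>' = inv_into UNIV \<beta>"
  have aut': "\<alpha>' \<in> Aut_Hopf" "\<beta>' \<in> Aut_Hopf" unfolding \<alpha>'_def \<beta>'_def by (intro Aut_closed aut)+
  have inv_simps: "\<alpha> (\<alpha>' x) = x" "\<beta> (\<beta>' x) = x" "\<beta>' (\<beta> x) = x" "inv_into UNIV \<beta>' = \<beta>" for x
    using aut by (simp_all add: \<alpha>'_def \<beta>'_def Aut_simps)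
  have inv_a: "inv\<^bsub>G\<^esub> a = (\<beta>' \<circ> \<alpha>' \<circ> \<beta>, \<beta>')" by (simp add: p inv_G aut \<alpha>'_def \<beta>'_def)
  have ia: "inv\<^bsub>G\<^esub> a \<in> carrier G" using a by simp
  have B: "bilinear_map CT_space CT_space CT_space (\<lambda>x1 x2. CT_mult a (inv\<^bsub>G\<^esub> a) x1 (CT_antip a x2))"
    by (intro bilinear_mapI lm_CT_mult_left lm_CT_mult_right lm_CT_antip lm_id a ia CT_antip_closed[OF a])
  show ?thesis
  proof (rule CT_eqI[OF sweedler_closed[OF a t is_vspace_CT B] _ lk_separates])
    show "pscale (CT_cou a t) (\<epsilon> \<bowtie> 1) \<in> carrier CT_space"
      using vs_scal[OF is_vspace_CT CT_unit_closed] by simp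
    fix X and f :: "'h \<Rightarrow> 'k" assume f: "lk f"
    note L0 = lin_intros' f f[THEN lin_comp] aut[THEN lh_Aut, THEN lin_comp] aut'[THEN lh_Aut, THEN lin_comp]
    note L = L0 lin_comp[OF lh_CT_fun[OF t]]
    note LM = bilinear_mapI lm_intros lm_lk[OF f] lm_lh[OF lh_Aut[OF aut'(2)]] linear_CT_fun
    let ?E = "\<lambda>h h' q1 q3. f (\<beta>' h * \<beta>' (\<alpha> (S_inv q3)) * \<beta>' (S h') * q1)"
    have "f (CT_fun (sweedler CT a CT_space (\<lambda>x1 x2. CT_mult a (inv\<^bsub>G\<^esub> a) x1 (CT_antip a x2)) t) X) =
        CT_cop a t (\<lambda>x1 x2. f (CT_fun (CT_mult a (inv\<^bsub>G\<^esub> a) x1 (CT_antip a x2)) X))" (is "?lhs = _")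
      by (rule linear_sweedler[OF a t is_vspace_CT B lm_lk[OF f linear_CT_fun]])
    also have "\<dots> = CT_cop a t (\<lambda>x1 x2. SW (\<lambda>m n. SW (\<lambda>r q3. SW (\<lambda>q1 q2.
        ?E (CT_fun x1 n) (CT_fun x2 (S_inv q2)) q1 q3) r) m) X)"
    proof (rule CT_cop_cong[OF a t])
      fix x1 x2 assume x: "x1 \<in> carrier CT_space" "x2 \<in> carrier CT_space"
      have "f (CT_fun (CT_mult a (inv\<^bsub>G\<^esub> a) x1 (CT_antip a x2)) X) =
          SW (\<lambda>m n. f (\<beta>' (CT_fun x1 n) * \<beta>' (\<alpha> (\<beta> (CT_fun (CT_antip a x2) m))))) X" (is "?lhs = _")
        using lk_CT_fun_mult[OF aut(1) aut'(2) x(1) CT_antip_closed[OF a x(2)] f, of \<beta> "\<beta>' \<circ> \<alpha>' \<circ> \<beta>" X]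
        by (simp add: inv_a[unfolded p] p inv_simps)
      also have "\<dots> = SW (\<lambda>m n. SW (\<lambda>r q3. SW (\<lambda>q1 q2.
          f (\<beta>' (CT_fun x1 n) * \<beta>' (\<alpha> (\<beta>
            (\<beta>' (S_inv q3) * \<beta>' (\<alpha>' (S (CT_fun x2 (S_inv q2)))) * \<beta>' (\<alpha>' (\<beta> q1))))))) r) m) X"
      proof (rule SW_cong)
        fix m n
        have lf: "lk (\<lambda>z. f (\<beta>' (CT_fun x1 n) * \<beta>' (\<alpha> (\<beta> z))))" by (intro L0)
        show "f (\<beta>' (CT_fun x1 n) * \<beta>' (\<alpha> (\<beta> (CT_fun (CT_antip a x2) m)))) = SW (\<lambda>r q3. SW (\<lambda>q1 q2.
          f (\<beta>' (CT_fun x1 n) * \<beta>' (\<alpha> (\<beta>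
            (\<beta>' (S_inv q3) * \<beta>' (\<alpha>' (S (CT_fun x2 (S_inv q2)))) * \<beta>' (\<alpha>' (\<beta> q1))))))) r) m"
          unfolding p CT_fun_antip[OF aut x(2), folded \<alpha>'_def \<beta>'_def] lin_SW[OF lf] ..
      qed
      also have "\<dots> = SW (\<lambda>m n. SW (\<lambda>r q3. SW (\<lambda>q1 q2. ?E (CT_fun x1 n) (CT_fun x2 (S_inv q2)) q1 q3) r) m) X"
        using aut aut' by (simp add: Aut_mult inv_simps mult.assoc)
      finally show "?lhs = \<dots>" .
    qed
    also have "\<dots> = SW (\<lambda>m n. SW (\<lambda>r q3. SW (\<lambda>q1 q2. CT_cop a t (\<lambda>x1 x2.
        ?E (CT_fun x1 n) (CT_fun x2 (S_inv q2)) q1 q3)) r) m) X"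
      by (rule trans[OF CT_cop_SW[OF a t]], (intro LM),
          (rule SW_cong, rule trans[OF CT_cop_SW[OF a t]], (intro LM))+, rule refl)
    also have "\<dots> = SW (\<lambda>m n. SW (\<lambda>r q3. SW (\<lambda>q1 q2. SW (\<lambda>y1 r'. SW (\<lambda>y2 y3.
        SW (\<lambda>u v. ?E (\<beta> y3 * u * S_inv (\<alpha> y1)) v q1 q3) (CT_fun t (n * y2))) r') (S_inv q2)) r) m) X"
      unfolding p by (intro SW_cong CT_cop_apply[OF aut t]) (intro L0)+
    \<comment> \<open>The three legs of S^{-1}(q_2) are S^{-1}(b_3), S^{-1}(b_2), S^{-1}(b_1), in
      reversed order; two applications of \<open>SW_S_inv\<close> expose them.\<close>
    also have "\<dots> = SW (\<lambda>m n. SW (\<lambda>r q3. SW (\<lambda>q1 q2. SW (\<lambda>s b3. SW (\<lambda>y2 y3.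
        SW (\<lambda>u v. ?E (\<beta> y3 * u * S_inv (\<alpha> (S_inv b3))) v q1 q3) (CT_fun t (n * y2))) (S_inv s)) q2) r) m) X"
      by (intro SW_cong SW_S_inv) (intro L)+
    also have "\<dots> = SW (\<lambda>m n. SW (\<lambda>r q3. SW (\<lambda>q1 q2. SW (\<lambda>s b3. SW (\<lambda>b1 b2.
        SW (\<lambda>u v. ?E (\<beta> (S_inv b1) * u * S_inv (\<alpha> (S_inv b3))) v q1 q3) (CT_fun t (n * S_inv b2))) s) q2) r) m) X"
      by (intro SW_cong SW_S_inv) (intro L)+
    also have "\<dots> = SW (\<lambda>m n. SW (\<lambda>q1 s. SW (\<lambda>b1 b2.
        \<epsilon> (CT_fun t (n * S_inv b2)) * f (S_inv b1 * q1)) s) m) X"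
    proof (rule SW_cong, rule SW_contract_last)
      fix n q1 s w
      have contr: "SW (\<lambda>b3 q3. ?E (\<beta> (S_inv b1) * u * S_inv (\<alpha> (S_inv b3))) v q1 q3) w =
          \<epsilon> w * f (S_inv b1 * \<beta>' (u * S v) * q1)" for b1 u v
      proof -
        have "SW (\<lambda>b3 q3. f (S_inv b1 * \<beta>' u * \<beta>' (\<alpha> (S_inv (q3 * S_inv b3))) * \<beta>' (S v) * q1)) w =
            \<epsilon> w * f (S_inv b1 * \<beta>' u * \<beta>' (\<alpha> (S_inv 1)) * \<beta>' (S v) * q1)"
          by (rule SW_S_inv_right) (intro L0)
        then show ?thesis
          using aut aut' by (simp add: S_inv_mult S_inv_one Aut_mult Aut_S_inv Aut_one inv_simps mult.assoc)
      qed
      have u: "SW (\<lambda>u v. f (S_inv b1 * \<beta>' (u * S v) * q1)) (CT_fun t (n * S_inv b2)) =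
          \<epsilon> (CT_fun t (n * S_inv b2)) * f (S_inv b1 * q1)" for b1 b2
      proof -
        have "SW (\<lambda>u v. f (S_inv b1 * \<beta>' (u * S v) * q1)) (CT_fun t (n * S_inv b2)) =
            \<epsilon> (CT_fun t (n * S_inv b2)) * f (S_inv b1 * \<beta>' 1 * q1)"
          by (rule SW_antipode_right) (intro L0)
        then show ?thesis by (simp add: Aut_one[OF aut'(2)])
      qed
      have "SW (\<lambda>b3 q3. SW (\<lambda>b1 b2. SW (\<lambda>u v. ?E (\<beta> (S_inv b1) * u * S_inv (\<alpha> (S_inv b3))) v q1 q3)
            (CT_fun t (n * S_inv b2))) s) w =
          SW (\<lambda>b1 b2. SW (\<lambda>u v. \<epsilon> w * f (S_inv b1 * \<beta>' (u * S v) * q1)) (CT_fun t (n * S_inv b2))) s"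
        unfolding contr[symmetric] by (rule trans[OF SW_swap], rule SW_cong, rule SW_swap)
      then show "SW (\<lambda>b3 q3. SW (\<lambda>b1 b2. SW (\<lambda>u v. ?E (\<beta> (S_inv b1) * u * S_inv (\<alpha> (S_inv b3))) v q1 q3)
            (CT_fun t (n * S_inv b2))) s) w =
          \<epsilon> w * SW (\<lambda>b1 b2. \<epsilon> (CT_fun t (n * S_inv b2)) * f (S_inv b1 * q1)) s"
        by (simp only: SW_mult_right[symmetric] u)
    qed (intro L)+
    also have "\<dots> = SW (\<lambda>q1 b1. \<epsilon> (CT_fun t 1) * f (S_inv b1 * q1)) X"
    proof (rule SW_contract_last)
      fix q1 b1 w
      show "SW (\<lambda>b2 n. \<epsilon> (CT_fun t (n * S_inv b2)) * f (S_inv b1 * q1)) w =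
          \<epsilon> w * (\<epsilon> (CT_fun t 1) * f (S_inv b1 * q1))"
        by (rule SW_S_inv_right) (intro L)
    qed (intro L)+
    also have "\<dots> = \<epsilon> X * (\<epsilon> (CT_fun t 1) * f 1)"
      by (rule SW_S_inv_left) (intro L)
    also have "\<dots> = f (CT_fun (pscale (CT_cou a t) (\<epsilon> \<bowtie> 1)) X)"
      by (simp add: CT_fun_unit CT_cou_eq[OF t] lin_scale[OF f])
    finally show "?lhs = \<dots>" .
  qed
qed

section \<open>The crossing\<close>

lemma conj_G:
  assumes "\<alpha> \<in> Aut_Hopf" "\<beta> \<in> Aut_Hopf" "\<gamma> \<in> Aut_Hopf" "\<delta> \<in> Aut_Hopf"
  shows "(\<alpha>, \<beta>) \<otimes>\<^bsub>G\<^esub> (\<gamma>, \<delta>) \<otimes>\<^bsub>G\<^esub> inv\<^bsub>G\<^esub> (\<alpha>, \<beta>) =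
    (inv_into UNIV \<beta> \<circ> \<delta> \<circ> \<alpha> \<circ> inv_into UNIV \<delta> \<circ> \<gamma> \<circ> inv_into UNIV \<alpha> \<circ> \<beta>, inv_into UNIV \<beta> \<circ> \<delta> \<circ> \<beta>)"
  using assms by (simp add: inv_G mult_G Aut_simps Aut_closed fun_eq_iff)

text \<open>The crossing is F -> \<phi> F \<theta>, and in these terms the conjugated component has
  the automorphisms \<phi>\<gamma>\<theta> and \<phi>\<delta>\<theta>. So \<phi> can be pulled out
  of the first leg of the coproduct and \<theta> pushed into the legs of Y.\<close>

lemma CT_cross_cop:
  assumes G: "a \<in> carrier G" "b \<in> carrier G" and t: "t \<in> carrier CT_space"
  shows "CT_cop (b \<otimes>\<^bsub>G\<^esub> a \<otimes>\<^bsub>G\<^esub> inv\<^bsub>G\<^esub> b) (CT_cross b a t) =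
    sweedler CT a CC (\<lambda>x1 x2. pure CT_space CT_space (CT_cross b a x1) (CT_cross b a x2)) t"
    (is "?L = ?R")
proof -
  interpret G: group G by (rule group_G)
  obtain \<alpha> \<beta> \<gamma> \<delta> where p: "b = (\<alpha>, \<beta>)" "a = (\<gamma>, \<delta>)"
    and aut: "\<alpha> \<in> Aut_Hopf" "\<beta> \<in> Aut_Hopf" "\<gamma> \<in> Aut_Hopf" "\<delta> \<in> Aut_Hopf"
    using G by (cases a; cases b) (auto simp: carrier_G)
  define \<theta> \<phi> where "\<theta> = inv_into UNIV \<alpha> \<circ> \<beta>" and "\<phi> = inv_into UNIV \<beta> \<circ> \<delta> \<circ> \<alpha> \<circ> inv_into UNIV \<delta>"
  have tp: "\<theta> \<in> Aut_Hopf" "\<phi> \<in> Aut_Hopf" unfolding \<theta>_def \<phi>_def by (intro Aut_closed aut)+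
  have conj: "b \<otimes>\<^bsub>G\<^esub> a \<otimes>\<^bsub>G\<^esub> inv\<^bsub>G\<^esub> b = (\<phi> \<circ> \<gamma> \<circ> \<theta>, \<phi> \<circ> \<delta> \<circ> \<theta>)"
    unfolding p conj_G[OF aut] \<theta>_def \<phi>_def using aut by (simp add: Aut_simps Aut_closed fun_eq_iff)
  have aut': "\<phi> \<circ> \<gamma> \<circ> \<theta> \<in> Aut_Hopf" "\<phi> \<circ> \<delta> \<circ> \<theta> \<in> Aut_Hopf"
    using aut tp by (simp_all add: Aut_closed)
  have cross: "CT_fun (CT_cross b a s) x = \<phi> (CT_fun s (\<theta> x))" if "s \<in> carrier CT_space" for s x
    using CT_fun_cross[OF aut that] by (simp add: p \<theta>_def \<phi>_def)
  have B: "bilinear_map CT_space CT_space CC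
      (\<lambda>x1 x2. pure CT_space CT_space (CT_cross b a x1) (CT_cross b a x2))"
    by (intro bilinear_mapI lm_pure_left lm_pure_right lm_CT_cross lm_id G CT_cross_closed)
  have ct: "CT_cross b a t \<in> carrier CT_space" by (rule CT_cross_closed[OF G(2,1) t])
  show ?thesis
  proof (rule CC_eqI[OF CT_cop_closed sweedler_closed[OF G(1) t is_vspace_CC B]])
    show "b \<otimes>\<^bsub>G\<^esub> a \<otimes>\<^bsub>G\<^esub> inv\<^bsub>G\<^esub> b \<in> carrier G" using G by simp
    show "CT_cross b a t \<in> carrier CT_space" by (rule ct)
    fix X Y and f g :: "'h \<Rightarrow> 'k" assume lk: "lk f" "lk g"
    let ?D = "\<lambda>s s'. f (CT_fun s X) * g (CT_fun s' Y)"
    note L = lin_intros' lk lk[THEN lin_comp] aut[THEN lh_Aut, THEN lin_comp] tp[THEN lh_Aut, THEN lin_comp]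
      aut'[THEN lh_Aut, THEN lin_comp] lin_comp[OF lh_CT_fun[OF t]]
    have D: "bilinear_map CT_space CT_space scalars ?D"
      by (intro bilinear_mapI lm_kmult_left lm_kmult_right lk[THEN lm_lk] linear_CT_fun)
    have "?L ?D = SW (\<lambda>a' r. SW (\<lambda>b' c. SW (\<lambda>u v.
        f ((\<phi> \<circ> \<delta> \<circ> \<theta>) c * u * S_inv ((\<phi> \<circ> \<gamma> \<circ> \<theta>) a')) * g v) (CT_fun (CT_cross b a t) (X * b'))) r) Y" (is "?lhs = _")
      unfolding conj by (rule CT_cop_apply[OF aut' ct]) (intro L)+
    also have "\<dots> = SW (\<lambda>a' r. SW (\<lambda>b' c. SW (\<lambda>u v.
        f (\<phi> (\<delta> (\<theta> c)) * u * S_inv (\<phi> (\<gamma> (\<theta> a')))) * g v) (\<phi> (CT_fun t (\<theta> X * \<theta> b')))) r) Y"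
      by (simp add: cross[OF t] Aut_mult[OF tp(1)])
    also have "\<dots> = SW (\<lambda>a' r. SW (\<lambda>b' c. SW (\<lambda>u v.
        f (\<phi> (\<delta> (\<theta> c)) * \<phi> u * S_inv (\<phi> (\<gamma> (\<theta> a')))) * g (\<phi> v)) (CT_fun t (\<theta> X * \<theta> b'))) r) Y"
      by (intro SW_cong SW_Aut[OF tp(2)]) (intro L)+
    also have "\<dots> = SW (\<lambda>a' r. SW (\<lambda>b' c. SW (\<lambda>u v.
        f (\<phi> (\<delta> (\<theta> c) * u * S_inv (\<gamma> (\<theta> a')))) * g (\<phi> v)) (CT_fun t (\<theta> X * \<theta> b'))) r) Y"
      by (simp add: Aut_mult[OF tp(2)] Aut_S_inv[OF tp(2)])
    also have "\<dots> = SW (\<lambda>a' r. SW (\<lambda>b' c. SW (\<lambda>u v.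
        f (\<phi> (\<delta> c * u * S_inv (\<gamma> (\<theta> a')))) * g (\<phi> v)) (CT_fun t (\<theta> X * b'))) (\<theta> r)) Y"
      by (intro SW_cong SW_Aut[OF tp(1), symmetric]) (intro L)+
    also have "\<dots> = SW (\<lambda>a' r. SW (\<lambda>b' c. SW (\<lambda>u v.
        f (\<phi> (\<delta> c * u * S_inv (\<gamma> a'))) * g (\<phi> v)) (CT_fun t (\<theta> X * b'))) r) (\<theta> Y)"
      by (rule SW_Aut[OF tp(1), symmetric]) (intro L)+
    also have "\<dots> = CT_cop a t (\<lambda>s s'. f (\<phi> (CT_fun s (\<theta> X))) * g (\<phi> (CT_fun s' (\<theta> Y))))"
      unfolding p by (rule CT_cop_apply[OF aut(3,4) t, symmetric]) (intro L)+
    also have "\<dots> = CT_cop a t (\<lambda>s s'. pure CT_space CT_space (CT_cross b a s) (CT_cross b a s') ?D)"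
      by (rule CT_cop_cong[OF G(1) t]) (simp add: pure_apply[OF D] cross)
    also have "\<dots> = ?R ?D"
      by (rule linear_sweedler[OF G(1) t is_vspace_CC B eval_linear, symmetric])
    finally show "?lhs = \<dots>" .
  qed
qed

lemma CT_cross_cou:
  assumes "a \<in> carrier G" "b \<in> carrier G" "t \<in> carrier CT_space"
  shows "CT_cou c (CT_cross b a t) = CT_cou a t"
proof -
  obtain \<alpha> \<beta> \<gamma> \<delta> where p: "b = (\<alpha>, \<beta>)" "a = (\<gamma>, \<delta>)"
    and aut: "\<alpha> \<in> Aut_Hopf" "\<beta> \<in> Aut_Hopf" "\<gamma> \<in> Aut_Hopf" "\<delta> \<in> Aut_Hopf"
    using assms(1,2) by (cases a; cases b) (auto simp: carrier_G)
  show ?thesis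
    using CT_cross_closed[OF assms(2,1,3)] assms(3) aut
    by (simp add: p CT_cou_eq CT_fun_cross Aut_counit Aut_one inv_Aut)
qed

lemma CT_cross_cross:
  assumes "a \<in> carrier G" "b \<in> carrier G" "c \<in> carrier G" "x \<in> carrier CT_space"
  shows "CT_cross (b \<otimes>\<^bsub>G\<^esub> c) a x = CT_cross b (c \<otimes>\<^bsub>G\<^esub> a \<otimes>\<^bsub>G\<^esub> inv\<^bsub>G\<^esub> c) (CT_cross c a x)"
proof (rule CT_eqI)
  interpret G: group G by (rule group_G)
  show "CT_cross (b \<otimes>\<^bsub>G\<^esub> c) a x \<in> carrier CT_space"
    "CT_cross b (c \<otimes>\<^bsub>G\<^esub> a \<otimes>\<^bsub>G\<^esub> inv\<^bsub>G\<^esub> c) (CT_cross c a x) \<in> carrier CT_space"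
    using assms by (simp_all add: CT_cross_closed)
  obtain \<alpha> \<beta> \<gamma> \<delta> \<mu> \<nu> where p: "a = (\<gamma>, \<delta>)" "b = (\<alpha>, \<beta>)" "c = (\<mu>, \<nu>)"
    and aut: "\<alpha> \<in> Aut_Hopf" "\<beta> \<in> Aut_Hopf" "\<gamma> \<in> Aut_Hopf" "\<delta> \<in> Aut_Hopf" "\<mu> \<in> Aut_Hopf" "\<nu> \<in> Aut_Hopf"
    using assms(1-3) by (cases a; cases b; cases c) (auto simp: carrier_G)
  have "CT_cross c a x \<in> carrier CT_space" using assms by (simp add: CT_cross_closed)
  then show "CT_fun (CT_cross (b \<otimes>\<^bsub>G\<^esub> c) a x) X =
      CT_fun (CT_cross b (c \<otimes>\<^bsub>G\<^esub> a \<otimes>\<^bsub>G\<^esub> inv\<^bsub>G\<^esub> c) (CT_cross c a x)) X" for X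
    using aut assms(4) unfolding p conj_G[OF aut(5,6,3,4)]
    by (simp add: mult_G CT_fun_cross Aut_closed Aut_simps)
qed

lemma CT_cross_one:
  assumes "a \<in> carrier G" "x \<in> carrier CT_space"
  shows "CT_cross \<one>\<^bsub>G\<^esub> a x = x"
proof (rule CT_eqI[OF CT_cross_closed assms(2)])
  obtain \<alpha> \<beta> where p: "a = (\<alpha>, \<beta>)" and aut: "\<alpha> \<in> Aut_Hopf" "\<beta> \<in> Aut_Hopf"
    using assms(1) by (cases a) (auto simp: carrier_G)
  show "CT_fun (CT_cross \<one>\<^bsub>G\<^esub> a x) X = CT_fun x X" for X
    using aut assms(2) by (simp add: p one_G CT_fun_cross id_Aut Aut_simps)
qed (use assms in \<open>auto simp: one_G carrier_G id_Aut\<close>)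

lemma CT_cross_bij:
  assumes "a \<in> carrier G" "b \<in> carrier G"
  shows "bij_betw (CT_cross b a) (carrier CT_space) (carrier CT_space)"
proof -
  interpret G: group G by (rule group_G)
  let ?c = "b \<otimes>\<^bsub>G\<^esub> a \<otimes>\<^bsub>G\<^esub> inv\<^bsub>G\<^esub> b"
  have c: "?c \<in> carrier G" using assms by simp
  have conj: "inv\<^bsub>G\<^esub> b \<otimes>\<^bsub>G\<^esub> ?c \<otimes>\<^bsub>G\<^esub> inv\<^bsub>G\<^esub> (inv\<^bsub>G\<^esub> b) = a"
    using assms by (metis G.inv_closed G.inv_inv G.l_inv G.l_one G.m_assoc G.m_closed G.r_inv G.r_one)
  show ?thesis
  proof (rule bij_betw_byWitness[where f'="CT_cross (inv\<^bsub>G\<^esub> b) ?c"])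
    show "\<forall>x\<in>carrier CT_space. CT_cross (inv\<^bsub>G\<^esub> b) ?c (CT_cross b a x) = x"
      using CT_cross_cross[of a "inv\<^bsub>G\<^esub> b" b] assms by (simp add: CT_cross_one)
    show "\<forall>x\<in>carrier CT_space. CT_cross b a (CT_cross (inv\<^bsub>G\<^esub> b) ?c x) = x"
      using CT_cross_cross[of ?c b "inv\<^bsub>G\<^esub> b"] assms c by (simp only: conj) (simp add: CT_cross_one)
  qed (use assms c in \<open>auto intro: CT_cross_closed\<close>)
qed

text \<open>The left automorphism of the crossing depends on the component: for the product it is
  built from \<delta>\<beta>. Distributed over the two factors, it telescopes to the crossings of x
  and y and the conjugated automorphisms in their product.\<close>

lemma CT_cross_mult:
  assumes "a \<in> carrier G" "b \<in> carrier G" "c \<in> carrier G" "x \<in> carrier CT_space" "y \<in> carrier CT_space"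
  shows "CT_cross c (a \<otimes>\<^bsub>G\<^esub> b) (CT_mult a b x y) =
    CT_mult (c \<otimes>\<^bsub>G\<^esub> a \<otimes>\<^bsub>G\<^esub> inv\<^bsub>G\<^esub> c) (c \<otimes>\<^bsub>G\<^esub> b \<otimes>\<^bsub>G\<^esub> inv\<^bsub>G\<^esub> c) (CT_cross c a x) (CT_cross c b y)"
proof (rule CT_eqI[OF _ _ lk_separates])
  interpret G: group G by (rule group_G)
  have cl: "CT_mult a b x y \<in> carrier CT_space" "CT_cross c a x \<in> carrier CT_space"
    "CT_cross c b y \<in> carrier CT_space"
    using assms by (simp_all add: CT_cross_closed CT_mult_closed)
  with assms show "CT_cross c (a \<otimes>\<^bsub>G\<^esub> b) (CT_mult a b x y) \<in> carrier CT_space"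
    "CT_mult (c \<otimes>\<^bsub>G\<^esub> a \<otimes>\<^bsub>G\<^esub> inv\<^bsub>G\<^esub> c) (c \<otimes>\<^bsub>G\<^esub> b \<otimes>\<^bsub>G\<^esub> inv\<^bsub>G\<^esub> c) (CT_cross c a x) (CT_cross c b y)
      \<in> carrier CT_space"
    by (simp_all add: CT_cross_closed CT_mult_closed)
  obtain \<alpha> \<beta> \<gamma> \<delta> \<mu> \<nu> where p: "a = (\<alpha>, \<beta>)" "b = (\<gamma>, \<delta>)" "c = (\<mu>, \<nu>)"
    and aut: "\<alpha> \<in> Aut_Hopf" "\<beta> \<in> Aut_Hopf" "\<gamma> \<in> Aut_Hopf" "\<delta> \<in> Aut_Hopf" "\<mu> \<in> Aut_Hopf" "\<nu> \<in> Aut_Hopf"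
    using assms(1-3) by (cases a; cases b; cases c) (auto simp: carrier_G)
  fix X and f :: "'h \<Rightarrow> 'k" assume f: "lk f"
  note L = lin_intros lin_comp[OF f] aut[THEN lh_Aut, THEN lin_comp]
    aut[THEN inv_Aut, THEN lh_Aut, THEN lin_comp] assms(4,5)[THEN lh_CT_fun, THEN lin_comp]
  let ?\<phi> = "inv_into UNIV \<nu> \<circ> (\<delta> \<circ> \<beta>) \<circ> \<mu> \<circ> inv_into UNIV (\<delta> \<circ> \<beta>)" and ?\<theta> = "inv_into UNIV \<mu> \<circ> \<nu>"
  have tp: "?\<phi> \<in> Aut_Hopf" "?\<theta> \<in> Aut_Hopf" using aut by (simp_all add: Aut_closed)
  have conj: "inv_into UNIV \<nu> \<circ> \<beta> \<circ> \<mu> \<circ> inv_into UNIV \<beta> \<circ> \<alpha> \<circ> inv_into UNIV \<mu> \<circ> \<nu> \<in> Aut_Hopf"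
    "inv_into UNIV \<nu> \<circ> \<delta> \<circ> \<nu> \<in> Aut_Hopf"
    using aut by (simp_all add: Aut_closed)
  have "f (CT_fun (CT_cross c (a \<otimes>\<^bsub>G\<^esub> b) (CT_mult a b x y)) X) =
      f (?\<phi> (CT_fun (CT_mult a b x y) (?\<theta> X)))" (is "?lhs = _")
    using aut cl(1) by (simp add: p mult_G CT_fun_cross Aut_closed)
  also have "\<dots> = SW (\<lambda>m n. f (?\<phi> (\<delta> (CT_fun x n) * \<delta> (\<alpha> (inv_into UNIV \<delta> (CT_fun y m)))))) (?\<theta> X)"
    unfolding p by (rule lk_CT_fun_mult[OF aut(1,4) assms(4,5)])
      (intro lin_comp[OF f] lh_Aut tp)
  also have "\<dots> = SW (\<lambda>m n. f (?\<phi> (\<delta> (CT_fun x (?\<theta> n)) *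
      \<delta> (\<alpha> (inv_into UNIV \<delta> (CT_fun y (?\<theta> m))))))) X"
    by (rule SW_Aut[OF tp(2)]) (intro L lin_comp[OF lh_Aut[OF tp(1)]])+
  also have "\<dots> = SW (\<lambda>m n. f ((inv_into UNIV \<nu> \<circ> \<delta> \<circ> \<nu>) (CT_fun (CT_cross c a x) n) *
      (inv_into UNIV \<nu> \<circ> \<delta> \<circ> \<nu>)
        ((inv_into UNIV \<nu> \<circ> \<beta> \<circ> \<mu> \<circ> inv_into UNIV \<beta> \<circ> \<alpha> \<circ> inv_into UNIV \<mu> \<circ> \<nu>)
          (inv_into UNIV (inv_into UNIV \<nu> \<circ> \<delta> \<circ> \<nu>) (CT_fun (CT_cross c b y) m))))) X"
    using aut assms(4,5) tp
    by (simp add: p CT_fun_cross Aut_closed Aut_simps Aut_mult)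
  also have "\<dots> = f (CT_fun (CT_mult (c \<otimes>\<^bsub>G\<^esub> a \<otimes>\<^bsub>G\<^esub> inv\<^bsub>G\<^esub> c) (c \<otimes>\<^bsub>G\<^esub> b \<otimes>\<^bsub>G\<^esub> inv\<^bsub>G\<^esub> c)
      (CT_cross c a x) (CT_cross c b y)) X)"
    unfolding p conj_G[OF aut(5,6,1,2)] conj_G[OF aut(5,6,3,4)]
    by (rule lk_CT_fun_mult[OF conj cl(2,3)[unfolded p] f, symmetric])
  finally show "?lhs = \<dots>" .
qed

lemma CT_cross_unit:
  assumes "c \<in> carrier G"
  shows "CT_cross c \<one>\<^bsub>G\<^esub> (\<epsilon> \<bowtie> 1) = (\<epsilon> \<bowtie> 1)"
proof (rule CT_eqI[OF CT_cross_closed CT_unit_closed])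
  obtain \<alpha> \<beta> where p: "c = (\<alpha>, \<beta>)" and aut: "\<alpha> \<in> Aut_Hopf" "\<beta> \<in> Aut_Hopf"
    using assms(1) by (cases c) (auto simp: carrier_G)
  show "CT_fun (CT_cross c \<one>\<^bsub>G\<^esub> (\<epsilon> \<bowtie> 1)) x = CT_fun (\<epsilon> \<bowtie> 1) x" for x
    using aut
    by (simp add: p one_G CT_fun_cross CT_unit_closed id_Aut inv_Aut CT_fun_unit lin_scale[OF lh_Aut]
        Aut_one Aut_counit)
qed (use assms in \<open>auto simp: one_G carrier_G id_Aut CT_unit_closed\<close>)

lemma CT_cross_antip:
  assumes "a \<in> carrier G" "c \<in> carrier G" "t \<in> carrier CT_space"
  shows "CT_cross c (inv\<^bsub>G\<^esub> a) (CT_antip a t) =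
    CT_antip (c \<otimes>\<^bsub>G\<^esub> a \<otimes>\<^bsub>G\<^esub> inv\<^bsub>G\<^esub> c) (CT_cross c a t)"
proof (rule CT_eqI[OF _ _ lk_separates])
  interpret G: group G by (rule group_G)
  have cl: "CT_antip a t \<in> carrier CT_space" "CT_cross c a t \<in> carrier CT_space"
    using assms by (simp_all add: CT_cross_closed CT_antip_closed)
  with assms show "CT_cross c (inv\<^bsub>G\<^esub> a) (CT_antip a t) \<in> carrier CT_space"
    "CT_antip (c \<otimes>\<^bsub>G\<^esub> a \<otimes>\<^bsub>G\<^esub> inv\<^bsub>G\<^esub> c) (CT_cross c a t) \<in> carrier CT_space"
    by (simp_all add: CT_cross_closed CT_antip_closed)
  obtain \<alpha> \<beta> \<mu> \<nu> where p: "a = (\<alpha>, \<beta>)" "c = (\<mu>, \<nu>)"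
    and aut: "\<alpha> \<in> Aut_Hopf" "\<beta> \<in> Aut_Hopf" "\<mu> \<in> Aut_Hopf" "\<nu> \<in> Aut_Hopf"
    using assms(1,2) by (cases a; cases c) (auto simp: carrier_G)
  fix X and f :: "'h \<Rightarrow> 'k" assume f: "lk f"
  note L = lin_intros' lin_comp[OF f] aut[THEN lh_Aut, THEN lin_comp]
    aut[THEN inv_Aut, THEN lh_Aut, THEN lin_comp] lin_comp[OF lh_CT_fun[OF assms(3)]]
  let ?\<alpha> = "inv_into UNIV \<alpha>" and ?\<beta> = "inv_into UNIV \<beta>" and ?\<mu> = "inv_into UNIV \<mu>" and ?\<nu> = "inv_into UNIV \<nu>"
  let ?\<phi> = "?\<nu> \<circ> ?\<beta> \<circ> \<mu> \<circ> \<beta>" and ?\<theta> = "?\<mu> \<circ> \<nu>"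
  let ?a = "?\<nu> \<circ> \<beta> \<circ> \<mu> \<circ> ?\<beta> \<circ> \<alpha> \<circ> ?\<mu> \<circ> \<nu>" and ?b = "?\<nu> \<circ> \<beta> \<circ> \<nu>"
  have tp: "?\<phi> \<in> Aut_Hopf" "?\<theta> \<in> Aut_Hopf" "?a \<in> Aut_Hopf" "?b \<in> Aut_Hopf"
    using aut by (simp_all add: Aut_closed)
  note L' = L tp[THEN lh_Aut, THEN lin_comp]
  have lf: "lk (\<lambda>z. f (?\<phi> z))" by (rule lin_comp[OF f lh_Aut[OF tp(1)]])
  have "f (CT_fun (CT_cross c (inv\<^bsub>G\<^esub> a) (CT_antip a t)) X) = f (?\<phi> (CT_fun (CT_antip a t) (?\<theta> X)))" (is "?lhs = _")
    using aut cl(1) by (simp add: p inv_G CT_fun_cross Aut_closed Aut_simps)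
  also have "\<dots> = SW (\<lambda>r c. SW (\<lambda>a b. f (?\<phi> (?\<beta> (S_inv c) * ?\<beta> (?\<alpha> (S (CT_fun t (S_inv b)))) *
      ?\<beta> (?\<alpha> (\<beta> a))))) r) (?\<theta> X)"
    unfolding p CT_fun_antip[OF aut(1,2) assms(3)] lin_SW[OF lf] ..
  also have "\<dots> = SW (\<lambda>r c. SW (\<lambda>a b. f (?\<phi> (?\<beta> (S_inv (?\<theta> c)) *
      ?\<beta> (?\<alpha> (S (CT_fun t (S_inv b)))) * ?\<beta> (?\<alpha> (\<beta> a))))) (?\<theta> r)) X"
    by (rule SW_Aut[OF tp(2)]) (intro L')+
  also have "\<dots> = SW (\<lambda>r c. SW (\<lambda>a b. f (?\<phi> (?\<beta> (S_inv (?\<theta> c)) *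
      ?\<beta> (?\<alpha> (S (CT_fun t (S_inv (?\<theta> b))))) * ?\<beta> (?\<alpha> (\<beta> (?\<theta> a)))))) r) X"
    by (intro SW_cong SW_Aut[OF tp(2)]) (intro L')+
  also have "\<dots> = SW (\<lambda>r d. SW (\<lambda>a' b'. f (inv_into UNIV ?b (S_inv d) *
      inv_into UNIV ?b (inv_into UNIV ?a (S (CT_fun (CT_cross c a t) (S_inv b')))) *
      inv_into UNIV ?b (inv_into UNIV ?a (?b a')))) r) X"
    using aut assms(3)
    by (simp add: p CT_fun_cross Aut_closed Aut_simps Aut_mult Aut_S[symmetric] Aut_S_inv[symmetric] inv_Aut)
  also have "\<dots> = f (CT_fun (CT_antip (c \<otimes>\<^bsub>G\<^esub> a \<otimes>\<^bsub>G\<^esub> inv\<^bsub>G\<^esub> c) (CT_cross c a t)) X)"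
    unfolding p conj_G[OF aut(3,4,1,2)] CT_fun_antip[OF tp(3,4) cl(2)[unfolded p]] lin_SW[OF f] ..
  finally show "?lhs = \<dots>" .
qed

lemma crossed_turaev_CT: "crossed_turaev G CT"
proof (rule crossed_turaev.intro[OF group_G], unfold_locales,
    goal_cases cop bil mcop mcou assoc unit ucop ucou ul ur alin aleft aright clin cbij ccop ccou
      ccross cmult cunit cantip)
  case (cbij a b)
  then show ?case by (simp add: CT_cross_bij)
next
  case (mcou a b x y)
  then show ?case by (simp add: CT_mult_cou)
next
  case (ccou a b x)
  then show ?case by (simp add: CT_cross_cou)
qed (simp_all add: coalgebra_CT CT_mult_bilinear CT_mult_cop CT_mult_assoc CT_unit_closed CT_unit_cop
    CT_unit_cou CT_unit_left CT_unit_right CT_antip_linear CT_antip_left CT_antip_right CT_cross_linear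
    CT_cross_cop CT_cross_cross CT_cross_mult CT_cross_unit CT_cross_antip Let_def)

subsection \<open>The coquasitriangular structure\<close>

lemma CT_sigma_linear:
  assumes "\<delta> \<in> Aut_Hopf"
  shows "bilinear_map CT_space CT_space scalars
    (\<lambda>s t. \<epsilon> (CT_fun s (inv_into UNIV \<delta> (CT_fun t 1))))"
  by (intro bilinear_mapI lm_intros linear_CT_fun lm_lk[OF lin_comp[OF lk_counit lh_CT_fun]]
      lm_lh[OF lh_Aut[OF inv_Aut[OF assms]]])

lemma CT_sigma_bilinear:
  assumes "a \<in> carrier G" "b \<in> carrier G"
  shows "bilinear_map CT_space CT_space scalars (CT_sigma a b)"
proof -
  obtain \<alpha> \<beta> \<gamma> \<delta> where p: "a = (\<alpha>, \<beta>)" "b = (\<gamma>, \<delta>)" and aut: "\<delta> \<in> Aut_Hopf"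
    using assms by (cases a; cases b) (auto simp: carrier_G)
  show ?thesis
    by (rule bilinear_map_cong[OF _ is_vspace_CT is_vspace_CT CT_sigma_linear[OF aut]])
      (simp add: p CT_sigma_eq aut)
qed

text \<open>One computation for both orders of the convolution. Splitting t yields the legs of K(1),
  splitting s multiplies the two arguments of F, and d(u_1) e(u_2) = \<epsilon>(u) reduces the
  result to \<epsilon>(F(1)) \<epsilon>(K(1)).\<close>

lemma CT_sigma_convolution:
  assumes a: "a \<in> carrier G" and b: "b \<in> carrier G" and st: "s \<in> carrier CT_space" "t \<in> carrier CT_space"
    and d: "lh d" "lh e" and m: "\<And>x f. lk f \<Longrightarrow> SW (\<lambda>u v. f (d u * e v)) x = \<epsilon> x * f 1"
  shows "CT_cop a s (\<lambda>x1 x2. CT_cop b t (\<lambda>y1 y2.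
    \<epsilon> (CT_fun x1 (d (CT_fun y1 1))) * \<epsilon> (CT_fun x2 (e (CT_fun y2 1))))) = CT_cou a s * CT_cou b t"
proof -
  note L = lin_intros d[THEN lin_comp]
  note LM = bilinear_mapI lm_intros linear_CT_fun
  have "CT_cop a s (\<lambda>x1 x2. CT_cop b t (\<lambda>y1 y2.
      \<epsilon> (CT_fun x1 (d (CT_fun y1 1))) * \<epsilon> (CT_fun x2 (e (CT_fun y2 1))))) =
    CT_cop a s (\<lambda>x1 x2. SW (\<lambda>u v. \<epsilon> (CT_fun x1 (d u)) * \<epsilon> (CT_fun x2 (e v))) (CT_fun t 1))"
  proof (rule CT_cop_cong[OF a st(1)])
    fix x1 x2 assume x: "x1 \<in> carrier CT_space" "x2 \<in> carrier CT_space"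
    show "CT_cop b t (\<lambda>y1 y2. \<epsilon> (CT_fun x1 (d (CT_fun y1 1))) * \<epsilon> (CT_fun x2 (e (CT_fun y2 1)))) =
        SW (\<lambda>u v. \<epsilon> (CT_fun x1 (d u)) * \<epsilon> (CT_fun x2 (e v))) (CT_fun t 1)"
      by (rule CT_cop_apply_one[OF b st(2)]) (intro L x[THEN lh_CT_fun, THEN lin_comp])+
  qed
  also have "\<dots> = SW (\<lambda>u v. CT_cop a s (\<lambda>x1 x2. \<epsilon> (CT_fun x1 (d u)) * \<epsilon> (CT_fun x2 (e v)))) (CT_fun t 1)"
    by (rule CT_cop_SW[OF a st(1)]) (intro LM)
  also have "\<dots> = SW (\<lambda>u v. \<epsilon> (CT_fun s (d u * e v))) (CT_fun t 1)"
    by (simp only: CT_cop_apply_counit[OF a st(1) lk_counit])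
  also have "\<dots> = \<epsilon> (CT_fun t 1) * \<epsilon> (CT_fun s 1)"
    by (rule m) (intro L lh_CT_fun st)
  finally show ?thesis by (simp add: CT_cou_eq st)
qed

lemma CT_sigma_invertible:
  assumes a: "a \<in> carrier G" and b: "b \<in> carrier G"
  shows "\<exists>\<tau>. bilinear_map CT_space CT_space scalars \<tau> \<and>
    (\<forall>x\<in>carrier CT_space. \<forall>y\<in>carrier CT_space.
      sweedler CT a scalars (\<lambda>x1 x2. sweedler CT b scalars
        (\<lambda>y1 y2. CT_sigma a b x1 y1 * \<tau> x2 y2) y) x = CT_cou a x * CT_cou b y \<and>
      sweedler CT a scalars (\<lambda>x1 x2. sweedler CT b scalars
        (\<lambda>y1 y2. \<tau> x1 y1 * CT_sigma a b x2 y2) y) x = CT_cou a x * CT_cou b y)"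
proof -
  obtain \<alpha> \<beta> \<gamma> \<delta> where p: "a = (\<alpha>, \<beta>)" "b = (\<gamma>, \<delta>)" and aut: "\<delta> \<in> Aut_Hopf"
    using assms by (cases a; cases b) (auto simp: carrier_G)
  let ?d = "inv_into UNIV \<delta>"
  \<comment> \<open>Convolution multiplies the arguments that F receives from the legs of K(1). To
    invert \<sigma>, it is therefore enough to apply S to that argument.\<close>
  let ?\<tau> = "\<lambda>s t. \<epsilon> (CT_fun s (S (?d (CT_fun t 1))))"
  have d: "lh ?d" "lh (\<lambda>x. S (?d x))"
    by (intro lin_comp[OF lh_S] lh_Aut inv_Aut aut)+
  have \<tau>: "bilinear_map CT_space CT_space scalars ?\<tau>"
    by (intro bilinear_mapI lm_intros linear_CT_fun lm_lk[OF lin_comp[OF lk_counit lh_CT_fun]]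
        lm_lh[OF d(1)])
  note \<sigma> = CT_sigma_bilinear[OF a b]
  have mult: "bilinear_map CT_space CT_space scalars (\<lambda>y1 y2. f x1 y1 * g x2 y2)"
    "bilinear_map CT_space CT_space scalars (\<lambda>x1 x2. f x1 y1 * g x2 y2)"
    if "bilinear_map CT_space CT_space scalars f" "bilinear_map CT_space CT_space scalars g"
      "x1 \<in> carrier CT_space" "x2 \<in> carrier CT_space" "y1 \<in> carrier CT_space" "y2 \<in> carrier CT_space"
    for f g x1 x2 y1 y2
    using that by (auto intro!: bilinear_map_mult dest: bilinear_map_left bilinear_map_right)
  have conv: "sweedler CT a scalars (\<lambda>x1 x2. sweedler CT b scalars (\<lambda>y1 y2. f x1 y1 * g x2 y2) y) x =
      CT_cop a x (\<lambda>x1 x2. CT_cop b y (\<lambda>y1 y2. f x1 y1 * g x2 y2))"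
    if "bilinear_map CT_space CT_space scalars f" "bilinear_map CT_space CT_space scalars g"
      "x \<in> carrier CT_space" "y \<in> carrier CT_space" for f g x y
    using linear_sweedler2[OF a that(3) b that(4) is_vspace_scalars, of "\<lambda>x1 x2 y1 y2. f x1 y1 * g x2 y2" "\<lambda>x. x"]
      mult[OF that(1,2)] vs_zero[OF is_vspace_CT] by (auto simp: linear_map_def)
  have inv: "SW (\<lambda>u v. f (?d u * S (?d v))) x = \<epsilon> x * f 1" "SW (\<lambda>u v. f (S (?d u) * ?d v)) x = \<epsilon> x * f 1"
    if f: "lk f" for f x
  proof -
    have i: "SW (\<lambda>u v. f (?d (u * S v))) x = \<epsilon> x * f (?d 1)" "SW (\<lambda>u v. f (?d (S u * v))) x = \<epsilon> x * f (?d 1)"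
      by (rule SW_antipode_right[OF lin_comp[OF f d(1)]], rule SW_antipode_left[OF lin_comp[OF f d(1)]])
    then show "SW (\<lambda>u v. f (?d u * S (?d v))) x = \<epsilon> x * f 1" "SW (\<lambda>u v. f (S (?d u) * ?d v)) x = \<epsilon> x * f 1"
      using inv_Aut[OF aut] by (simp_all add: Aut_mult Aut_S Aut_one)
  qed
  show ?thesis
  proof (intro exI[of _ ?\<tau>] conjI ballI \<tau>)
    fix x y assume x: "x \<in> carrier CT_space" and y: "y \<in> carrier CT_space"
    have "CT_cop a x (\<lambda>x1 x2. CT_cop b y (\<lambda>y1 y2. CT_sigma a b x1 y1 * ?\<tau> x2 y2)) =
        CT_cop a x (\<lambda>x1 x2. CT_cop b y (\<lambda>y1 y2. \<epsilon> (CT_fun x1 (?d (CT_fun y1 1))) * ?\<tau> x2 y2))"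
      by (intro CT_cop_cong a b x y) (simp add: p CT_sigma_eq aut)
    also have "\<dots> = CT_cou a x * CT_cou b y"
      by (rule CT_sigma_convolution[OF a b x y d inv(1)])
    finally show "sweedler CT a scalars (\<lambda>x1 x2. sweedler CT b scalars
        (\<lambda>y1 y2. CT_sigma a b x1 y1 * ?\<tau> x2 y2) y) x = CT_cou a x * CT_cou b y"
      by (simp only: conv[OF \<sigma> \<tau> x y])
    have "CT_cop a x (\<lambda>x1 x2. CT_cop b y (\<lambda>y1 y2. ?\<tau> x1 y1 * CT_sigma a b x2 y2)) =
        CT_cop a x (\<lambda>x1 x2. CT_cop b y (\<lambda>y1 y2. ?\<tau> x1 y1 * \<epsilon> (CT_fun x2 (?d (CT_fun y2 1)))))"
      by (intro CT_cop_cong a b x y) (simp add: p CT_sigma_eq aut)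
    also have "\<dots> = CT_cou a x * CT_cou b y"
      by (rule CT_sigma_convolution[OF a b x y d(2,1) inv(2)])
    finally show "sweedler CT a scalars (\<lambda>x1 x2. sweedler CT b scalars
        (\<lambda>y1 y2. ?\<tau> x1 y1 * CT_sigma a b x2 y2) y) x = CT_cou a x * CT_cou b y"
      by (simp only: conv[OF \<tau> \<sigma> x y])
  qed
qed

text \<open>The product of x and y is evaluated at \<nu>^{-1}(K(1)), where K belongs to z, and this
  element is split. The factor x receives the second leg because of the opposite multiplication; the
  automorphisms in the product are invisible to \<epsilon>.\<close>

lemma CT_TCT1:
  assumes G: "a \<in> carrier G" "b \<in> carrier G" "c \<in> carrier G"
    and xyz: "x \<in> carrier CT_space" "y \<in> carrier CT_space" "z \<in> carrier CT_space"
  shows "CT_sigma (a \<otimes>\<^bsub>G\<^esub> b) c (CT_mult a b x y) z =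
    sweedler CT c scalars (\<lambda>z1 z2. CT_sigma a c x z2 * CT_sigma b c y z1) z"
proof -
  obtain \<alpha> \<beta> \<gamma> \<delta> \<mu> \<nu> where p: "a = (\<alpha>, \<beta>)" "b = (\<gamma>, \<delta>)" "c = (\<mu>, \<nu>)"
    and aut: "\<alpha> \<in> Aut_Hopf" "\<beta> \<in> Aut_Hopf" "\<gamma> \<in> Aut_Hopf" "\<delta> \<in> Aut_Hopf" "\<mu> \<in> Aut_Hopf" "\<nu> \<in> Aut_Hopf"
    using G by (cases a; cases b; cases c) (auto simp: carrier_G)
  let ?n = "inv_into UNIV \<nu>"
  note L = lin_intros aut[THEN inv_Aut, THEN lh_Aut, THEN lin_comp] xyz[THEN lh_CT_fun, THEN lin_comp]
  have B: "bilinear_map CT_space CT_space scalars (\<lambda>z1 z2. CT_sigma a c x z2 * CT_sigma b c y z1)"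
    by (intro bilinear_mapI lm_kmult_left lm_kmult_right bilinear_map_right[OF CT_sigma_bilinear]
        G xyz)
  have "CT_sigma (a \<otimes>\<^bsub>G\<^esub> b) c (CT_mult a b x y) z = \<epsilon> (CT_fun (CT_mult a b x y) (?n (CT_fun z 1)))"
    unfolding p mult_G
    by (rule CT_sigma_eq[OF aut(6) CT_mult_closed[OF G(1,2) xyz(1,2), unfolded p] xyz(3)])
  also have "\<dots> = SW (\<lambda>m n. \<epsilon> (\<delta> (CT_fun x n) * \<delta> (\<alpha> (inv_into UNIV \<delta> (CT_fun y m))))) (?n (CT_fun z 1))"
    unfolding p by (rule lk_CT_fun_mult[OF aut(1,4) xyz(1,2) lk_counit])
  also have "\<dots> = SW (\<lambda>m n. \<epsilon> (CT_fun x n) * \<epsilon> (CT_fun y m)) (?n (CT_fun z 1))"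
    using aut by (simp add: counit_mult Aut_counit inv_Aut)
  also have "\<dots> = SW (\<lambda>m n. \<epsilon> (CT_fun x (?n n)) * \<epsilon> (CT_fun y (?n m))) (CT_fun z 1)"
    by (rule SW_Aut[OF inv_Aut[OF aut(6)]]) (intro L)+
  also have "\<dots> = CT_cop c z (\<lambda>z1 z2. \<epsilon> (CT_fun x (?n (CT_fun z2 1))) * \<epsilon> (CT_fun y (?n (CT_fun z1 1))))"
    by (rule CT_cop_apply_one[OF G(3) xyz(3), symmetric]) (intro L)+
  also have "\<dots> = CT_cop c z (\<lambda>z1 z2. CT_sigma a c x z2 * CT_sigma b c y z1)"
    by (rule CT_cop_cong[OF G(3) xyz(3)]) (simp add: p CT_sigma_eq aut xyz)
  also have "\<dots> = sweedler CT c scalars (\<lambda>z1 z2. CT_sigma a c x z2 * CT_sigma b c y z1) z"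
    by (rule sweedler_scalars[OF G(3) xyz(3) B, symmetric])
  finally show ?thesis .
qed

text \<open>The value of the product of y and z at 1 is a product in H, and evaluating F at it is
  undone by \<open>CT_cop_apply_counit\<close>. Crossing by b^{-1} precomposes with
  \<delta>^{-1}\<gamma>, exactly the map left on the factor from z.\<close>

lemma CT_TCT2:
  assumes G: "a \<in> carrier G" "b \<in> carrier G" "c \<in> carrier G"
    and xyz: "x \<in> carrier CT_space" "y \<in> carrier CT_space" "z \<in> carrier CT_space"
  shows "CT_sigma a (b \<otimes>\<^bsub>G\<^esub> c) x (CT_mult b c y z) = sweedler CT a scalars
    (\<lambda>x1 x2. CT_sigma a b x1 y *
      CT_sigma (inv\<^bsub>G\<^esub> b \<otimes>\<^bsub>G\<^esub> a \<otimes>\<^bsub>G\<^esub> b) c (CT_cross (inv\<^bsub>G\<^esub> b) a x2) z) x"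
proof -
  interpret G: group G by (rule group_G)
  obtain \<alpha> \<beta> \<gamma> \<delta> \<mu> \<nu> where p: "a = (\<alpha>, \<beta>)" "b = (\<gamma>, \<delta>)" "c = (\<mu>, \<nu>)"
    and aut: "\<alpha> \<in> Aut_Hopf" "\<beta> \<in> Aut_Hopf" "\<gamma> \<in> Aut_Hopf" "\<delta> \<in> Aut_Hopf" "\<mu> \<in> Aut_Hopf" "\<nu> \<in> Aut_Hopf"
    using G by (cases a; cases b; cases c) (auto simp: carrier_G)
  let ?d = "inv_into UNIV \<delta>" and ?n = "inv_into UNIV \<nu>"
  obtain e e' where e: "inv\<^bsub>G\<^esub> b \<otimes>\<^bsub>G\<^esub> a \<otimes>\<^bsub>G\<^esub> b = (e, e')" by fastforce
  have ib: "inv\<^bsub>G\<^esub> b \<in> carrier G" "inv\<^bsub>G\<^esub> b \<otimes>\<^bsub>G\<^esub> a \<otimes>\<^bsub>G\<^esub> b \<in> carrier G" using G by auto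
  have B: "bilinear_map CT_space CT_space scalars (\<lambda>x1 x2. CT_sigma a b x1 y *
      CT_sigma (inv\<^bsub>G\<^esub> b \<otimes>\<^bsub>G\<^esub> a \<otimes>\<^bsub>G\<^esub> b) c (CT_cross (inv\<^bsub>G\<^esub> b) a x2) z)"
    by (intro bilinear_map_mult bilinear_map_left[OF CT_sigma_bilinear]
        linear_map_comp[OF CT_cross_linear bilinear_map_left[OF CT_sigma_bilinear]] G ib xyz)
  have "CT_sigma a (b \<otimes>\<^bsub>G\<^esub> c) x (CT_mult b c y z) =
      \<epsilon> (CT_fun x (inv_into UNIV (\<nu> \<circ> \<delta>) (CT_fun (CT_mult b c y z) 1)))"
    unfolding p mult_G
    by (rule CT_sigma_eq[OF comp_Aut[OF aut(6,4)] xyz(1) CT_mult_closed[OF G(2,3) xyz(2,3), unfolded p]])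
  also have "\<dots> = \<epsilon> (CT_fun x (?d (CT_fun y 1) * ?d (\<gamma> (?n (CT_fun z 1)))))"
    using aut by (simp add: p CT_fun_mult_one[OF aut(3,6) xyz(2,3)] Aut_simps Aut_mult inv_Aut)
  also have "\<dots> = CT_cop a x (\<lambda>x1 x2. \<epsilon> (CT_fun x1 (?d (CT_fun y 1))) *
      \<epsilon> (CT_fun x2 (?d (\<gamma> (?n (CT_fun z 1))))))"
    by (rule CT_cop_apply_counit[OF G(1) xyz(1) lk_counit, symmetric])
  also have "\<dots> = CT_cop a x (\<lambda>x1 x2. CT_sigma a b x1 y *
      CT_sigma (inv\<^bsub>G\<^esub> b \<otimes>\<^bsub>G\<^esub> a \<otimes>\<^bsub>G\<^esub> b) c (CT_cross (inv\<^bsub>G\<^esub> b) a x2) z)"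
  proof (rule CT_cop_cong[OF G(1) xyz(1)])
    fix x1 x2 assume x: "x1 \<in> carrier CT_space" "x2 \<in> carrier CT_space"
    have cr: "CT_cross (inv\<^bsub>G\<^esub> b) a x2 \<in> carrier CT_space" by (rule CT_cross_closed[OF ib(1) G(1) x(2)])
    have "\<epsilon> (CT_fun (CT_cross (inv\<^bsub>G\<^esub> b) a x2) h) = \<epsilon> (CT_fun x2 (?d (\<gamma> h)))" for h
      using aut x(2) by (simp add: p inv_G CT_fun_cross Aut_closed Aut_simps Aut_counit)
    then show "\<epsilon> (CT_fun x1 (?d (CT_fun y 1))) * \<epsilon> (CT_fun x2 (?d (\<gamma> (?n (CT_fun z 1))))) =
        CT_sigma a b x1 y * CT_sigma (inv\<^bsub>G\<^esub> b \<otimes>\<^bsub>G\<^esub> a \<otimes>\<^bsub>G\<^esub> b) c (CT_cross (inv\<^bsub>G\<^esub> b) a x2) z"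
      unfolding e p(3) CT_sigma_eq[OF aut(6) cr xyz(3)] unfolding p
      by (simp add: CT_sigma_eq[OF aut(4) x(1) xyz(2)])
  qed
  also have "\<dots> = sweedler CT a scalars (\<lambda>x1 x2. CT_sigma a b x1 y *
      CT_sigma (inv\<^bsub>G\<^esub> b \<otimes>\<^bsub>G\<^esub> a \<otimes>\<^bsub>G\<^esub> b) c (CT_cross (inv\<^bsub>G\<^esub> b) a x2) z) x"
    by (rule sweedler_scalars[OF G(1) xyz(1) B, symmetric])
  finally show ?thesis .
qed

text \<open>The right automorphism of the crossing of x, the inverse of the conjugated \<delta> and
  the left automorphism of the crossing of y compose to \<delta>^{-1}; the remaining left
  automorphism is invisible to \<epsilon>.\<close>

lemma CT_TCT4:
  assumes G: "a \<in> carrier G" "b \<in> carrier G" "c \<in> carrier G"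
    and xy: "x \<in> carrier CT_space" "y \<in> carrier CT_space"
  shows "CT_sigma a b x y = CT_sigma (c \<otimes>\<^bsub>G\<^esub> a \<otimes>\<^bsub>G\<^esub> inv\<^bsub>G\<^esub> c) (c \<otimes>\<^bsub>G\<^esub> b \<otimes>\<^bsub>G\<^esub> inv\<^bsub>G\<^esub> c)
    (CT_cross c a x) (CT_cross c b y)"
proof -
  obtain \<alpha> \<beta> \<gamma> \<delta> \<mu> \<nu> where p: "a = (\<alpha>, \<beta>)" "b = (\<gamma>, \<delta>)" "c = (\<mu>, \<nu>)"
    and aut: "\<alpha> \<in> Aut_Hopf" "\<beta> \<in> Aut_Hopf" "\<gamma> \<in> Aut_Hopf" "\<delta> \<in> Aut_Hopf" "\<mu> \<in> Aut_Hopf" "\<nu> \<in> Aut_Hopf"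
    using G by (cases a; cases b; cases c) (auto simp: carrier_G)
  have d: "inv_into UNIV \<nu> \<circ> \<delta> \<circ> \<nu> \<in> Aut_Hopf" using aut by (simp add: Aut_closed)
  show ?thesis
    unfolding p conj_G[OF aut(5,6,1,2)] conj_G[OF aut(5,6,3,4)] CT_sigma_eq[OF aut(4) xy]
      CT_sigma_eq[OF d CT_cross_closed[OF G(3,1) xy(1), unfolded p] CT_cross_closed[OF G(3,2) xy(2), unfolded p]]
    using aut xy by (simp add: CT_fun_cross Aut_simps Aut_closed Aut_counit Aut_one inv_Aut)
qed

text \<open>With F and K for x and y, both sides at X equal \<delta>\<beta>\<delta>^{-1}(K(X_1)_2)
  \<delta>(F(X_2 \<delta>^{-1}(K(X_1)_1))). On each side one outer factor of a coproduct cancels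
  against a neighbouring leg.\<close>

lemma CT_TCT3:
  assumes G: "a \<in> carrier G" "b \<in> carrier G"
    and xy: "x \<in> carrier CT_space" "y \<in> carrier CT_space"
  shows "sweedler CT a CT_space (\<lambda>x1 x2. sweedler CT b CT_space (\<lambda>y1 y2.
      pscale (CT_sigma a b x1 y1)
        (CT_mult b (inv\<^bsub>G\<^esub> b \<otimes>\<^bsub>G\<^esub> a \<otimes>\<^bsub>G\<^esub> b) y2 (CT_cross (inv\<^bsub>G\<^esub> b) a x2))) y) x =
    sweedler CT a CT_space (\<lambda>x1 x2. sweedler CT b CT_space (\<lambda>y1 y2.
      pscale (CT_sigma a b x2 y2) (CT_mult a b x1 y1)) y) x" (is "?L = ?R")
proof -
  interpret G: group G by (rule group_G)
  obtain \<alpha> \<beta> \<gamma> \<delta> where p: "a = (\<alpha>, \<beta>)" "b = (\<gamma>, \<delta>)"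
    and aut: "\<alpha> \<in> Aut_Hopf" "\<beta> \<in> Aut_Hopf" "\<gamma> \<in> Aut_Hopf" "\<delta> \<in> Aut_Hopf"
    using G by (cases a; cases b) (auto simp: carrier_G)
  define d where "d = inv_into UNIV \<delta>"
  have d: "d \<in> Aut_Hopf" unfolding d_def by (rule inv_Aut[OF aut(4)])
  have inv_simps: "\<delta> (d h) = h" "d (\<delta> h) = h" for h using aut by (simp_all add: d_def Aut_simps)
  let ?c = "inv\<^bsub>G\<^esub> b \<otimes>\<^bsub>G\<^esub> a \<otimes>\<^bsub>G\<^esub> b"
  have ib: "inv\<^bsub>G\<^esub> b \<in> carrier G" "?c \<in> carrier G" using G by auto
  define e where "e = fst ?c"
  have c: "?c = (e, \<delta> \<circ> \<beta> \<circ> d)"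
    using aut by (simp add: e_def p inv_G mult_G d_def fun_eq_iff)
  have scale_bil: "bilinear_map CT_space CT_space CT_space (\<lambda>u v. pscale (f u) (g v))"
    "bilinear_map CT_space CT_space CT_space (\<lambda>u v. pscale (f v) (g u))"
    if "linear_map CT_space scalars f" "linear_map CT_space CT_space g" for f g
    using that vs_scal[OF is_vspace_CT] vs_scal_add[OF is_vspace_CT] vs_scal_add_left[OF is_vspace_CT]
      vs_scal_scal[OF is_vspace_CT]
    by (auto simp: bilinear_map_def linear_map_def mult.commute)
  note \<sigma> = CT_sigma_bilinear[OF G]
  have L1: "bilinear_map CT_space CT_space CT_space (\<lambda>y1 y2. pscale (CT_sigma a b x1 y1)
      (CT_mult b ?c y2 (CT_cross (inv\<^bsub>G\<^esub> b) a x2)))"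
    "bilinear_map CT_space CT_space CT_space (\<lambda>y1 y2. pscale (CT_sigma a b x2 y2) (CT_mult a b x1 y1))"
    if "x1 \<in> carrier CT_space" "x2 \<in> carrier CT_space" for x1 x2
    by (intro scale_bil bilinear_map_right[OF \<sigma>] lm_CT_mult_left lm_CT_mult_right lm_id
        CT_cross_closed G ib that)+
  have L2: "bilinear_map CT_space CT_space CT_space (\<lambda>x1 x2. pscale (CT_sigma a b x1 y1)
      (CT_mult b ?c y2 (CT_cross (inv\<^bsub>G\<^esub> b) a x2)))"
    "bilinear_map CT_space CT_space CT_space (\<lambda>x1 x2. pscale (CT_sigma a b x2 y2) (CT_mult a b x1 y1))"
    if "y1 \<in> carrier CT_space" "y2 \<in> carrier CT_space" for y1 y2
    by (intro scale_bil bilinear_map_left[OF \<sigma>] lm_CT_mult_left lm_CT_mult_right lm_CT_cross lm_id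
        G ib that)+
  show ?thesis
  proof (rule CT_eqI[OF _ _ lk_separates])
    show "?L \<in> carrier CT_space" "?R \<in> carrier CT_space"
      by (rule sweedler_closed[OF G(1) xy(1) is_vspace_CT
            sweedler2_bilinear[OF G(2) xy(2) is_vspace_CT L1(1) L2(1)]],
          assumption+,
          rule sweedler_closed[OF G(1) xy(1) is_vspace_CT
            sweedler2_bilinear[OF G(2) xy(2) is_vspace_CT L1(2) L2(2)]])
    fix X and f :: "'h \<Rightarrow> 'k" assume f: "lk f"
    note Lx = lin_intros' f f[THEN lin_comp] aut[THEN lh_Aut, THEN lin_comp] lin_comp[OF lh_Aut[OF d]]
    note L = Lx xy[THEN lh_CT_fun, THEN lin_comp]
    note LM = bilinear_mapI lm_intros lm_lk[OF f] aut[THEN lh_Aut, THEN lm_lh] lm_lh[OF lh_Aut[OF d]]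
      linear_CT_fun
    have ef: "linear_map CT_space scalars (\<lambda>t. f (CT_fun t X))" by (rule lm_lk[OF f linear_CT_fun])
    let ?T = "SW (\<lambda>q r. SW (\<lambda>u v. f (\<delta> (\<beta> (d v)) * \<delta> (CT_fun x (r * d u)))) (CT_fun y q)) X"
    have "f (CT_fun ?L X) = CT_cop a x (\<lambda>x1 x2. CT_cop b y (\<lambda>y1 y2.
        f (CT_fun (pscale (CT_sigma a b x1 y1) (CT_mult b ?c y2 (CT_cross (inv\<^bsub>G\<^esub> b) a x2))) X)))"
      by (rule linear_sweedler2[OF G(1) xy(1) G(2) xy(2) is_vspace_CT L1(1) L2(1) ef])
    also have "\<dots> = CT_cop a x (\<lambda>x1 x2. SW (\<lambda>m n. SW (\<lambda>p1 r. SW (\<lambda>p2 p3. SW (\<lambda>u v.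
        \<epsilon> (CT_fun x1 (d (\<delta> p3 * u * S_inv (\<gamma> p1)))) *
          f (\<delta> (\<beta> (d v)) * \<delta> (CT_fun x2 (d (\<gamma> m))))) (CT_fun y p2)) r) n) X)"
    proof (rule CT_cop_cong[OF G(1) xy(1)])
      fix x1 x2 assume x12: "x1 \<in> carrier CT_space" "x2 \<in> carrier CT_space"
      note Lx' = Lx x12[THEN lh_CT_fun, THEN lin_comp]
      have cr: "CT_cross (inv\<^bsub>G\<^esub> b) a x2 \<in> carrier CT_space" by (rule CT_cross_closed[OF ib(1) G(1) x12(2)])
      have aut1: "\<delta> \<circ> \<beta> \<circ> d \<in> Aut_Hopf" using aut d by (simp add: Aut_closed)
      \<comment> \<open>The automorphisms from the crossing by b^{-1} and those from the product
        telescope: on the second factor only \<delta> outside and \<delta>^{-1}\<gamma> inside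
        remain.\<close>
      have cross: "(\<delta> \<circ> \<beta> \<circ> d) (\<gamma> (inv_into UNIV (\<delta> \<circ> \<beta> \<circ> d) (CT_fun (CT_cross (inv\<^bsub>G\<^esub> b) a x2) m))) =
          \<delta> (CT_fun x2 (d (\<gamma> m)))" for m
        using aut d x12(2) unfolding d_def
        by (simp add: p inv_G CT_fun_cross Aut_closed Aut_simps)
      have "CT_cop b y (\<lambda>y1 y2.
          f (CT_fun (pscale (CT_sigma a b x1 y1) (CT_mult b ?c y2 (CT_cross (inv\<^bsub>G\<^esub> b) a x2))) X)) =
        CT_cop b y (\<lambda>y1 y2. SW (\<lambda>m n. \<epsilon> (CT_fun x1 (d (CT_fun y1 1))) *
          f (\<delta> (\<beta> (d (CT_fun y2 n))) * \<delta> (CT_fun x2 (d (\<gamma> m))))) X)"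
      proof (rule CT_cop_cong[OF G(2) xy(2)])
        fix y1 y2 assume y12: "y1 \<in> carrier CT_space" "y2 \<in> carrier CT_space"
        have "f (CT_fun (CT_mult b ?c y2 (CT_cross (inv\<^bsub>G\<^esub> b) a x2)) X) =
            SW (\<lambda>m n. f (\<delta> (\<beta> (d (CT_fun y2 n))) * \<delta> (CT_fun x2 (d (\<gamma> m))))) X"
          using lk_CT_fun_mult[OF aut(3) aut1 y12(2) cr f, of \<delta> e X]
          unfolding cross c[symmetric] p(2)[symmetric] by simp
        then show "f (CT_fun (pscale (CT_sigma a b x1 y1) (CT_mult b ?c y2 (CT_cross (inv\<^bsub>G\<^esub> b) a x2))) X) =
          SW (\<lambda>m n. \<epsilon> (CT_fun x1 (d (CT_fun y1 1))) *
            f (\<delta> (\<beta> (d (CT_fun y2 n))) * \<delta> (CT_fun x2 (d (\<gamma> m))))) X"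
          using CT_sigma_eq[OF aut(4) x12(1) y12(1), of \<alpha> \<beta> \<gamma>]
          by (simp add: lin_scale[OF f] SW_mult_right p d_def)
      qed
      also have "\<dots> = SW (\<lambda>m n. CT_cop b y (\<lambda>y1 y2. \<epsilon> (CT_fun x1 (d (CT_fun y1 1))) *
          f (\<delta> (\<beta> (d (CT_fun y2 n))) * \<delta> (CT_fun x2 (d (\<gamma> m)))))) X"
        by (rule CT_cop_SW[OF G(2) xy(2)]) (intro LM lm_lh[OF lh_CT_fun] x12)
      also have "\<dots> = SW (\<lambda>m n. SW (\<lambda>p1 r. SW (\<lambda>p2 p3. SW (\<lambda>u v.
        \<epsilon> (CT_fun x1 (d (\<delta> p3 * u * S_inv (\<gamma> p1)))) *
          f (\<delta> (\<beta> (d v)) * \<delta> (CT_fun x2 (d (\<gamma> m))))) (CT_fun y (1 * p2))) r) n) X"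
      proof (rule SW_cong)
        fix m n
        show "CT_cop b y (\<lambda>y1 y2. \<epsilon> (CT_fun x1 (d (CT_fun y1 1))) *
          f (\<delta> (\<beta> (d (CT_fun y2 n))) * \<delta> (CT_fun x2 (d (\<gamma> m))))) =
          SW (\<lambda>p1 r. SW (\<lambda>p2 p3. SW (\<lambda>u v.
        \<epsilon> (CT_fun x1 (d (\<delta> p3 * u * S_inv (\<gamma> p1)))) *
          f (\<delta> (\<beta> (d v)) * \<delta> (CT_fun x2 (d (\<gamma> m))))) (CT_fun y (1 * p2))) r) n"
          unfolding p by (rule CT_cop_apply[OF aut(3,4) xy(2)]) (intro Lx')+
      qed
      finally show "CT_cop b y (\<lambda>y1 y2.
          f (CT_fun (pscale (CT_sigma a b x1 y1) (CT_mult b ?c y2 (CT_cross (inv\<^bsub>G\<^esub> b) a x2))) X)) =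
        SW (\<lambda>m n. SW (\<lambda>p1 r. SW (\<lambda>p2 p3. SW (\<lambda>u v.
        \<epsilon> (CT_fun x1 (d (\<delta> p3 * u * S_inv (\<gamma> p1)))) *
          f (\<delta> (\<beta> (d v)) * \<delta> (CT_fun x2 (d (\<gamma> m))))) (CT_fun y p2)) r) n) X"
        by simp
    qed
    also have "\<dots> = SW (\<lambda>m n. SW (\<lambda>p1 r. SW (\<lambda>p2 p3. SW (\<lambda>u v. CT_cop a x (\<lambda>x1 x2.
        \<epsilon> (CT_fun x1 (d (\<delta> p3 * u * S_inv (\<gamma> p1)))) *
          f (\<delta> (\<beta> (d v)) * \<delta> (CT_fun x2 (d (\<gamma> m)))))) (CT_fun y p2)) r) n) X"
      by (rule trans[OF CT_cop_SW[OF G(1) xy(1)]], (intro LM),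
          (rule SW_cong, rule trans[OF CT_cop_SW[OF G(1) xy(1)]], (intro LM))+, rule refl)
    also have "\<dots> = SW (\<lambda>m n. SW (\<lambda>p1 r. SW (\<lambda>p2 p3. SW (\<lambda>u v.
        f (\<delta> (\<beta> (d v)) * \<delta> (CT_fun x (d (\<delta> p3 * u * S_inv (\<gamma> p1)) * d (\<gamma> m)))))
          (CT_fun y p2)) r) n) X"
      by (intro SW_cong CT_cop_apply_counit[OF G(1) xy(1), where f="\<lambda>h. f (\<delta> (\<beta> (d _)) * \<delta> h)"]) (intro L)
    \<comment> \<open>The right outer factor S^{-1}(\<gamma>(p_1)) of the coproduct of y stands next
      to \<gamma>(m), up to \<delta>^{-1}, in the argument of F, and m, p_1 are neighbouring legs of
      X.\<close>
    also have "\<dots> = ?T"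
    proof (rule SW_contract_outer)
      fix p2 p3 w
      have contr: "SW (\<lambda>m p1. f (\<delta> (\<beta> (d v)) * \<delta> (CT_fun x (d (\<delta> p3 * u * S_inv (\<gamma> p1)) * d (\<gamma> m))))) w =
          \<epsilon> w * f (\<delta> (\<beta> (d v)) * \<delta> (CT_fun x (p3 * d u)))" for u v
      proof -
        have "SW (\<lambda>m p1. f (\<delta> (\<beta> (d v)) * \<delta> (CT_fun x (p3 * d u * d (\<gamma> (S_inv p1 * m)))))) w =
          \<epsilon> w * f (\<delta> (\<beta> (d v)) * \<delta> (CT_fun x (p3 * d u * d (\<gamma> 1))))"
          by (rule SW_S_inv_left) (intro L)
        then show ?thesis
          using aut d by (simp add: Aut_mult Aut_S_inv Aut_one inv_simps mult.assoc)
      qed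
      show "SW (\<lambda>m p1. SW (\<lambda>u v. f (\<delta> (\<beta> (d v)) *
          \<delta> (CT_fun x (d (\<delta> p3 * u * S_inv (\<gamma> p1)) * d (\<gamma> m))))) (CT_fun y p2)) w =
        \<epsilon> w * SW (\<lambda>u v. f (\<delta> (\<beta> (d v)) * \<delta> (CT_fun x (p3 * d u)))) (CT_fun y p2)"
        unfolding SW_mult_right contr[symmetric] by (rule SW_swap)
    qed (intro L)+
    finally have left: "f (CT_fun ?L X) = ?T" .
    have "f (CT_fun ?R X) = CT_cop a x (\<lambda>x1 x2. CT_cop b y (\<lambda>y1 y2.
        f (CT_fun (pscale (CT_sigma a b x2 y2) (CT_mult a b x1 y1)) X)))"
      by (rule linear_sweedler2[OF G(1) xy(1) G(2) xy(2) is_vspace_CT L1(2) L2(2) ef])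
    also have "\<dots> = CT_cop a x (\<lambda>x1 x2. SW (\<lambda>m n. SW (\<lambda>u v.
        \<epsilon> (CT_fun x2 (d v)) * f (\<delta> (CT_fun x1 n) * \<delta> (\<alpha> (d u)))) (CT_fun y m)) X)"
    proof (rule CT_cop_cong[OF G(1) xy(1)])
      fix x1 x2 assume x12: "x1 \<in> carrier CT_space" "x2 \<in> carrier CT_space"
      note Lx' = Lx x12[THEN lh_CT_fun, THEN lin_comp]
      have "CT_cop b y (\<lambda>y1 y2. f (CT_fun (pscale (CT_sigma a b x2 y2) (CT_mult a b x1 y1)) X)) =
        CT_cop b y (\<lambda>y1 y2. SW (\<lambda>m n. \<epsilon> (CT_fun x2 (d (CT_fun y2 1))) *
          f (\<delta> (CT_fun x1 n) * \<delta> (\<alpha> (d (CT_fun y1 m))))) X)" (is "?lhs = _")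
      proof (rule CT_cop_cong[OF G(2) xy(2)])
        fix y1 y2 assume y12: "y1 \<in> carrier CT_space" "y2 \<in> carrier CT_space"
        show "f (CT_fun (pscale (CT_sigma a b x2 y2) (CT_mult a b x1 y1)) X) =
          SW (\<lambda>m n. \<epsilon> (CT_fun x2 (d (CT_fun y2 1))) * f (\<delta> (CT_fun x1 n) * \<delta> (\<alpha> (d (CT_fun y1 m))))) X"
          using CT_sigma_eq[OF aut(4) x12(2) y12(2), of \<alpha> \<beta> \<gamma>]
            lk_CT_fun_mult[OF aut(1,4) x12(1) y12(1) f, of \<beta> \<gamma> X]
          by (simp add: lin_scale[OF f] SW_mult_right p d_def)
      qed
      also have "\<dots> = SW (\<lambda>m n. CT_cop b y (\<lambda>y1 y2. \<epsilon> (CT_fun x2 (d (CT_fun y2 1))) *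
          f (\<delta> (CT_fun x1 n) * \<delta> (\<alpha> (d (CT_fun y1 m)))))) X"
        by (rule CT_cop_SW[OF G(2) xy(2)]) (intro LM lm_lh[OF lh_CT_fun] x12)
      also have "\<dots> = SW (\<lambda>m n. SW (\<lambda>u v.
        \<epsilon> (CT_fun x2 (d v)) * f (\<delta> (CT_fun x1 n) * \<delta> (\<alpha> (d u)))) (CT_fun y m)) X"
        by (intro SW_cong CT_cop_apply_one[OF G(2) xy(2)]) (intro Lx')+
      finally show "?lhs = \<dots>" .
    qed
    also have "\<dots> = SW (\<lambda>m n. SW (\<lambda>u v. CT_cop a x (\<lambda>x1 x2.
        \<epsilon> (CT_fun x2 (d v)) * f (\<delta> (CT_fun x1 n) * \<delta> (\<alpha> (d u))))) (CT_fun y m)) X"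
      by (rule trans[OF CT_cop_SW[OF G(1) xy(1)]], (intro LM),
          (rule SW_cong, rule trans[OF CT_cop_SW[OF G(1) xy(1)]], (intro LM))+, rule refl)
    also have "\<dots> = SW (\<lambda>m n. SW (\<lambda>u v. SW (\<lambda>q1 r. SW (\<lambda>q2 q3.
        f (\<delta> (\<beta> (d q3) * CT_fun x (n * d q2) * S_inv (\<alpha> (d q1))) * \<delta> (\<alpha> (d u)))) r) v) (CT_fun y m)) X"
    proof (intro SW_cong)
      fix m n u v
      have "CT_cop a x (\<lambda>x1 x2. \<epsilon> (CT_fun x2 (d v)) * f (\<delta> (CT_fun x1 n) * \<delta> (\<alpha> (d u)))) =
          SW (\<lambda>q1 r. SW (\<lambda>q2 q3. SW (\<lambda>w z. \<epsilon> z * f (\<delta> (\<beta> q3 * w * S_inv (\<alpha> q1)) * \<delta> (\<alpha> (d u))))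
            (CT_fun x (n * q2))) r) (d v)" (is "?lhs = _")
        unfolding p by (rule CT_cop_apply[OF aut(1,2) xy(1)]) (intro Lx)+
      also have "\<dots> = SW (\<lambda>q1 r. SW (\<lambda>q2 q3.
          f (\<delta> (\<beta> q3 * CT_fun x (n * q2) * S_inv (\<alpha> q1)) * \<delta> (\<alpha> (d u)))) r) (d v)"
        by (intro SW_cong SW_counit_right) (intro Lx)
      also have "\<dots> = SW (\<lambda>q1 r. SW (\<lambda>q2 q3.
          f (\<delta> (\<beta> q3 * CT_fun x (n * q2) * S_inv (\<alpha> (d q1))) * \<delta> (\<alpha> (d u)))) (d r)) v"
        by (rule SW_Aut[OF d]) (intro L)+
      also have "\<dots> = SW (\<lambda>q1 r. SW (\<lambda>q2 q3.
          f (\<delta> (\<beta> (d q3) * CT_fun x (n * d q2) * S_inv (\<alpha> (d q1))) * \<delta> (\<alpha> (d u)))) r) v"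
        by (intro SW_cong SW_Aut[OF d]) (intro L)+
      finally show "?lhs = \<dots>" .
    qed
    \<comment> \<open>Here the cancelling legs come from K(m): u is its first leg and q_1 the first
      leg of v, and they meet as S^{-1}(q_1) u inside \<delta>\<alpha>\<delta>^{-1}.\<close>
    also have "\<dots> = ?T"
    proof (rule SW_cong, rule SW_contract_outer)
      fix m n q2 q3 w
      have "SW (\<lambda>u q1. f (\<delta> (\<beta> (d q3)) * \<delta> (CT_fun x (n * d q2)) * \<delta> (\<alpha> (d (S_inv q1 * u))))) w =
          \<epsilon> w * f (\<delta> (\<beta> (d q3)) * \<delta> (CT_fun x (n * d q2)) * \<delta> (\<alpha> (d 1)))"
        by (rule SW_S_inv_left) (intro L)
      then show "SW (\<lambda>u q1. f (\<delta> (\<beta> (d q3) * CT_fun x (n * d q2) * S_inv (\<alpha> (d q1))) * \<delta> (\<alpha> (d u)))) w =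
          \<epsilon> w * f (\<delta> (\<beta> (d q3)) * \<delta> (CT_fun x (n * d q2)))"
        using aut d by (simp add: Aut_mult Aut_S_inv Aut_one mult.assoc)
    qed (intro L)+
    finally show "f (CT_fun ?L X) = f (CT_fun ?R X)" using left by simp
  qed
qed

lemma coquasitriangular_CT: "coquasitriangular G CT CT_sigma"
proof (rule coquasitriangular.intro[OF crossed_turaev_CT], unfold_locales, goal_cases bil inv t1 t2 t3 t4)
  case (inv a b)
  then show ?case by (simp add: CT_sigma_invertible)
next
  case (t3 a b x y)
  then show ?case using CT_TCT3 by (simp add: Let_def)
next
  case (t4 a b c x y)
  then show ?case unfolding cross_CT by (intro CT_TCT4) simp_all
qed (simp_all add: CT_sigma_bilinear CT_TCT1 CT_TCT2)

end

theorem proposition3p12: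
  fixes scale :: "'k::field \<Rightarrow> 'h::ring_1 \<Rightarrow> 'h"
    and \<Delta> :: "'h \<Rightarrow> ('h, 'h, 'k) tensor"
    and \<epsilon> :: "'h \<Rightarrow> 'k"
    and S :: "'h \<Rightarrow> 'h"
    and Basis :: "'h set"
  assumes "fd_hopf_algebra scale \<Delta> \<epsilon> S Basis"
  shows "coquasitriangular
    (hopf_algebra.G scale \<Delta> \<epsilon> S)
    (fd_hopf_algebra.CT scale \<Delta> \<epsilon> S Basis)
    (fd_hopf_algebra.CT_sigma scale \<epsilon>)"
  by (rule fd_hopf_algebra.coquasitriangular_CT[OF assms])

end
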